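(* Let $U$ be an open subset of $\mathbb{R}^n$, $V$ an open subset of $\mathbb{R}^m$ and $F\in\mathcal{G}(U\times V)^{m\times n}$. Suppose that for every $x_0\in U$ and every $\tilde y_0\in\tilde V_c$ the following data are chosen and the following assumptions hold: $\alpha>0$ is such that $\overline{B_\alpha(x_0)}\subset\subset U$; $(\tilde y_{0\varepsilon})_\varepsilon$ is a representative of $\tilde y_0$, and $L\subset\subset V$, $\varepsilon_0\in(0,1]$ are such that $\tilde y_{0\varepsilon}\in L$ for all $\varepsilon\le\varepsilon_0$; $\beta>0$ satisfies $L_\beta:=L+\overline{B_\beta(0)}\subset\subset V$; and, with $$Q:=\overline{B_\alpha(x_0)}\times L_\beta\qquad(\subset\subset U\times V),$$ $F$ has a representative $(F_\varepsilon)_\varepsilon$ satisfying $$\sup_{(x,y)\in Q}|F_\varepsilon(x,y)|\le a\qquad(\varepsilon\le\varepsilon_0)$$ for some constant $a>0$ and $$\sup_{(x,y)\in Q}|\partial_2F_\varepsilon(x,y)|=O(|\log\varepsilon|)\quad\text{as }\varepsilon\to0.$$ Then the following are equivalent: (A) For all $(\tilde x_0,\tilde y_0)\in\tilde U_c\times\tilde V_c$ with $\tilde x_0\approx x_0\in U$ the initial value problem $$\mathrm{D}u(x)=F(x,u(x)),\quad u(\tilde x_0)=\tilde y_0$$ has a unique solution $u(\tilde x_0,\tilde y_0)$ in $\mathcal{G}[U(\tilde x_0,\tilde y_0),W]$, where $U(\tilde x_0,\tilde y_0)$ is an (i.e. some) open neighbourhood of $x_0$ in $U$ and $W=L+B_\beta(0)$,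 with $L,\beta$ the data chosen for $(x_0,\tilde y_0)$. (B) The integrability condition is satisfied, i.e., the mapping $$(x,y,v_1,v_2)\mapsto \mathrm{D}F(x,y)(v_1,F(x,y)(v_1))(v_2)$$ is symmetric in $v_1,v_2\in\mathbb{R}^n$ as a generalized function in $\mathcal{G}(U\times V\times\mathbb{R}^n\times\mathbb{R}^n)^m$.
   Context: Notation. $A\subset\subset B$ means that $A$ is a compact subset of the interior of $B$. $B_r(x)$ is the open ball with centre $x$ and radius $r>0$. $\partial_2F_\varepsilon$ is the derivative with respect to the second slot ($y\in V$). $\mathbb{R}^{m\times n}$ is the space of real $(m\times n)$-matrices, identified with linear maps $\mathbb{R}^n\to\mathbb{R}^m$; $\mathcal{G}(U)^{m\times n}$ is the space of $(m\times n)$-matrices over $\mathcal{G}(U)$. For $u\in\mathcal{G}(U)^m$ the derivative $\mathrm{D}u$ is regarded as an element of $\mathcal{G}(U)^{m\times n}$. In (B), on representatives, $\mathrm{D}F_\varepsilon(x,y)$ is the total derivative of $F_\varepsilon:U\times V\to\mathbb{R}^{m\times n}$, a linear map $\mathbb{R}^n\times\mathbb{R}^m\to\mathbb{R}^{m\times n}$; it is applied to $(v_1,F_\varepsilon(x,y)v_1)$ and the resulting matrix is applied to $v_2$. Special Colombeau algebra. For a non-empty open $U\subseteq\mathbb{R}^n$ let $\mathcal{E}(U):=C^\infty(U,\mathbb{R})^{(0,1]}$. $\mathcal{E}_M(U)$ (moderate nets) is the set of $(u_\varepsilon)_\varepsilon\in\mathcal{E}(U)$ such that for all $K\subset\subset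 U$ and all $\alpha\in\mathbb{N}_0^n$ there is $N\in\mathbb{N}$ with $\sup_{x\in K}|\partial^\alpha u_\varepsilon(x)|=O(\varepsilon^{-N})$ as $\varepsilon\to0$. $\mathcal{N}(U)$ (negligible nets) is the set of $(u_\varepsilon)_\varepsilon\in\mathcal{E}(U)$ such that for all $K\subset\subset U$, $\alpha\in\mathbb{N}_0^n$, $m\in\mathbb{N}$ one has $\sup_{x\in K}|\partial^\alpha u_\varepsilon(x)|=O(\varepsilon^m)$ as $\varepsilon\to0$. $\mathcal{G}(U):=\mathcal{E}_M(U)/\mathcal{N}(U)$; the class of $(u_\varepsilon)_\varepsilon$ is $[(u_\varepsilon)_\varepsilon]$. Derivatives are taken componentwise in $\varepsilon$. Generalized functions with values in $\mathbb{R}^m$ are elements of $\mathcal{G}(U)^m$. c-boundedness. For open $U\subseteq\mathbb{R}^n$, $V\subseteq\mathbb{R}^m$, a net $(u_\varepsilon)_\varepsilon\in\mathcal{E}_M(U)^m$ is c-bounded from $U$ into $V$ if (a) there is $\varepsilon_0\in(0,1]$ with $u_\varepsilon(U)\subseteq V$ for all $\varepsilon\le\varepsilon_0$, and (b) for every $K\subset\subset U$ there are $L\subset\subset V$ and $\varepsilon_0\in(0,1]$ with $u_\varepsilon(K)\subseteq L$ for all $\varepsilon\le\varepsilon_0$. $\mathcal{G}[U,V]$ is the set of $u\in\mathcal{G}(U)^m$ having a representative that is c-bounded from $U$ into $V$. For $u\in\mathcal{G}[U,V]$ and $v\in\mathcal{G}(V)^l$ the composition $v\circ u:=[(v_\varepsilon\circ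 u_\varepsilon)_\varepsilon]\in\mathcal{G}(U)^l$ is well defined (with a c-bounded representative $(u_\varepsilon)_\varepsilon$; only small $\varepsilon$ matter). Generalized points. $U_M$ is the set of nets $(x_\varepsilon)_\varepsilon\in U^{(0,1]}$ with $|x_\varepsilon|=O(\varepsilon^{-N})$ for some $N\in\mathbb{N}$; $(x_\varepsilon)_\varepsilon\sim(y_\varepsilon)_\varepsilon$ iff $|x_\varepsilon-y_\varepsilon|=O(\varepsilon^m)$ for all $m\in\mathbb{N}$; $\tilde U:=U_M/\!\sim$. $\tilde U_c$ (compactly supported points) is the set of $\tilde x=[(\tilde x_\varepsilon)_\varepsilon]\in\tilde U$ for which there are $K\subset\subset U$ and $\varepsilon_0\in(0,1]$ with $\tilde x_\varepsilon\in K$ for all $\varepsilon\le\varepsilon_0$. For $u\in\mathcal{G}(U)^m$, $\tilde x\in\tilde U_c$, the point value is $u(\tilde x):=[(u_\varepsilon(\tilde x_\varepsilon))_\varepsilon]$. A point $\tilde x\in\tilde U_c$ is near-standard, written $\tilde x\approx x$, if there is $x\in U$ with $\tilde x_\varepsilon\to x$ as $\varepsilon\to0$ for one (hence every) representative. Solutions. A solution of $\mathrm{D}u(x)=F(x,u(x))$, $u(\tilde x_0)=\tilde y_0$ in $\mathcal{G}[U',W]$ ($U'\subseteq U$ an open neighbourhood of $x_0$, $W\subseteq V$ open) is a $u\in\mathcal{G}[U',W]$ such that the differential equation holds in $\mathcal{G}(U')^{m\times n}$, where $F(x,u(x))$ is the composition $F\circ(\mathrm{id},u)$, and the initial condition holds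 as an equality of generalized points. *)

theory Defs
  imports "HOL-Analysis.Analysis" "HOL-Library.Landau_Symbols" "HOL-Library.Set_Algebras"
begin

definition compactly_contained :: "'a::topological_space set \<Rightarrow> 'a set \<Rightarrow> bool"
    (infix \<open>\<subset>\<subset>\<close> 50) where
  "K \<subset>\<subset> U \<longleftrightarrow> compact K \<and> K \<subseteq> interior U"

text \<open>A multi-index is encoded as a list of basis directions; for smooth functions the order
  is immaterial, so all lists of basis vectors give exactly all derivatives
  \<open>\<partial>\<^sup>\<alpha>\<close>.\<close>

primrec partials :: "'a::euclidean_space list \<Rightarrow> ('a \<Rightarrow> 'b::real_normed_vector) \<Rightarrow> 'a \<Rightarrow> 'b" where
  "partials [] f = f"
| "partials (b # bs) f = (\<lambda>x. frechet_derivative (partials bs f) (at x) b)"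

text \<open>Meant for open \<open>U\<close>: all iterated partial derivatives exist and are
  (Frechet) differentiable, hence continuous, on \<open>U\<close>.\<close>

definition smooth_on :: "'a::euclidean_space set \<Rightarrow> ('a \<Rightarrow> 'b::real_normed_vector) \<Rightarrow> bool" where
  "smooth_on U f \<longleftrightarrow>
     (\<forall>bs. set bs \<subseteq> Basis \<longrightarrow> (\<forall>x\<in>U. partials bs f differentiable (at x)))"

text \<open>Nets are total functions. Only their values for \<open>0 < \<epsilon> \<le> 1\<close> (and on the relevant
  open set) matter: nets that agree there lie in the same class. An element of
  \<open>\<G>(U)\<^sup>m\<close> is represented by one \<open>\<real>\<^sup>m\<close>-valued net instead of
  \<open>m\<close> real-valued ones, and likewise for matrices.\<close>

type_synonym ('a, 'b) net = "real \<Rightarrow> 'a \<Rightarrow> 'b"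
type_synonym 'a pnet = "real \<Rightarrow> 'a"

text \<open>\<open>sup_bigo K f g\<close> says \<open>sup\<^bsub>x\<in>K\<^esub> |f\<^sub>\<epsilon>(x)| = O(g(\<epsilon>))\<close> as
  \<open>\<epsilon> \<rightarrow> 0\<close>. It is written with a pointwise bound because the real supremum is
  unspecified for \<open>K = {}\<close>.\<close>

definition sup_bigo ::
    "'a set \<Rightarrow> ('a, 'b::real_normed_vector) net \<Rightarrow> (real \<Rightarrow> real) \<Rightarrow> bool" where
  "sup_bigo K f g \<longleftrightarrow>
     (\<exists>C. \<forall>\<^sub>F \<epsilon> in at_right 0. \<forall>x\<in>K. norm (f \<epsilon> x) \<le> C * \<bar>g \<epsilon>\<bar>)"

definition smooth_nets ::
    "'a::euclidean_space set \<Rightarrow> ('a, 'b::real_normed_vector) net set" where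
  "smooth_nets U = {u. \<forall>\<epsilon>\<in>{0<..1}. smooth_on U (u \<epsilon>)}"

definition moderate_nets ::
    "'a::euclidean_space set \<Rightarrow> ('a, 'b::real_normed_vector) net set" where
  "moderate_nets U = {u \<in> smooth_nets U. \<forall>K bs. K \<subset>\<subset> U \<longrightarrow> set bs \<subseteq> Basis \<longrightarrow>
     (\<exists>N::nat. sup_bigo K (\<lambda>\<epsilon>. partials bs (u \<epsilon>)) (\<lambda>\<epsilon>. inverse (\<epsilon> ^ N)))}"

definition negligible_nets ::
    "'a::euclidean_space set \<Rightarrow> ('a, 'b::real_normed_vector) net set" where
  "negligible_nets U = {u \<in> smooth_nets U. \<forall>K bs. K \<subset>\<subset> U \<longrightarrow> set bs \<subseteq> Basis \<longrightarrow>
     (\<forall>m::nat. sup_bigo K (\<lambda>\<epsilon>. partials bs (u \<epsilon>)) (\<lambda>\<epsilon>. \<epsilon> ^ m))}"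

definition colombeau_rel ::
    "'a::euclidean_space set \<Rightarrow> (('a, 'b::real_normed_vector) net \<times> ('a, 'b) net) set" where
  "colombeau_rel U = {(u, v). u \<in> moderate_nets U \<and> v \<in> moderate_nets U \<and>
     (\<lambda>\<epsilon> x. u \<epsilon> x - v \<epsilon> x) \<in> negligible_nets U}"

definition colombeau ::
    "'a::euclidean_space set \<Rightarrow> ('a, 'b::real_normed_vector) net set set" where
  "colombeau U = moderate_nets U // colombeau_rel U"

text \<open>\<open>gfun_lift U T u\<close> is the class in \<open>\<G>(U)\<close> of \<open>T u'\<close> for a representative
  \<open>u'\<close> of \<open>u\<close>. The union over all representatives is the usual idiom for functions on
  quotients; it is only used for \<open>T\<close> respecting the equivalence.\<close>

definition gfun_lift :: "'c::euclidean_space set \<Rightarrow>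
    (('a, 'b) net \<Rightarrow> ('c, 'd::real_normed_vector) net) \<Rightarrow> ('a, 'b) net set \<Rightarrow> ('c, 'd) net set" where
  "gfun_lift U T u = (\<Union>u'\<in>u. colombeau_rel U `` {T u'})"

definition gderiv :: "(real^'n) set \<Rightarrow> (real^'n, real^'m) net set \<Rightarrow> (real^'n, real^'n^'m) net set" where
  "gderiv U = gfun_lift U (\<lambda>u \<epsilon> x. jacobian (u \<epsilon>) (at x))"

definition gpair_id :: "'a::euclidean_space set \<Rightarrow>
    ('a, 'b::euclidean_space) net set \<Rightarrow> ('a, 'a \<times> 'b) net set" where
  "gpair_id U = gfun_lift U (\<lambda>u \<epsilon> x. (x, u \<epsilon> x))"

definition c_bounded :: "'a::euclidean_space set \<Rightarrow> 'b::euclidean_space set \<Rightarrow> ('a, 'b) net \<Rightarrow> bool" where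
  "c_bounded U V u \<longleftrightarrow> u \<in> moderate_nets U \<and>
     (\<exists>\<epsilon>0\<in>{0<..1}. \<forall>\<epsilon>\<in>{0<..\<epsilon>0}. u \<epsilon> ` U \<subseteq> V) \<and>
     (\<forall>K. K \<subset>\<subset> U \<longrightarrow>
        (\<exists>L. L \<subset>\<subset> V \<and> (\<exists>\<epsilon>0\<in>{0<..1}. \<forall>\<epsilon>\<in>{0<..\<epsilon>0}. u \<epsilon> ` K \<subseteq> L)))"

definition colombeau_cb ::
    "'a::euclidean_space set \<Rightarrow> 'b::euclidean_space set \<Rightarrow> ('a, 'b) net set set" where
  "colombeau_cb U V = {u \<in> colombeau U. \<exists>u'\<in>u. c_bounded U V u'}"

text \<open>The composition \<open>v \<circ> u\<close>. For the large \<open>\<epsilon>\<close> with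
  \<open>u\<^sub>\<epsilon>(U) \<not>\<subseteq> V\<close> the pointwise composition is not defined; it is replaced by
  \<open>0\<close>, which does not affect the class.\<close>

definition gcompose :: "'a::euclidean_space set \<Rightarrow> 'b::euclidean_space set \<Rightarrow>
    ('b, 'c::real_normed_vector) net set \<Rightarrow> ('a, 'b) net set \<Rightarrow> ('a, 'c) net set" where
  "gcompose U V v u = (\<Union>u'\<in>{u'\<in>u. c_bounded U V u'}.
     gfun_lift U (\<lambda>v' \<epsilon>. if u' \<epsilon> ` U \<subseteq> V then v' \<epsilon> \<circ> u' \<epsilon> else (\<lambda>x. 0)) v)"

definition moderate_points :: "'a::real_normed_vector set \<Rightarrow> 'a pnet set" where
  "moderate_points U = {x. (\<forall>\<epsilon>\<in>{0<..1}. x \<epsilon> \<in> U) \<and>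
     (\<exists>N::nat. (\<lambda>\<epsilon>. norm (x \<epsilon>)) \<in> O[at_right 0](\<lambda>\<epsilon>. inverse (\<epsilon> ^ N)))}"

definition pnet_equiv :: "'a::real_normed_vector pnet \<Rightarrow> 'a pnet \<Rightarrow> bool" where
  "pnet_equiv x y \<longleftrightarrow> (\<forall>m::nat. (\<lambda>\<epsilon>. norm (x \<epsilon> - y \<epsilon>)) \<in> O[at_right 0](\<lambda>\<epsilon>. \<epsilon> ^ m))"

definition gpoint_rel :: "'a::real_normed_vector set \<Rightarrow> ('a pnet \<times> 'a pnet) set" where
  "gpoint_rel U = {(x, y). x \<in> moderate_points U \<and> y \<in> moderate_points U \<and> pnet_equiv x y}"

definition gpoints :: "'a::real_normed_vector set \<Rightarrow> 'a pnet set set" where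
  "gpoints U = moderate_points U // gpoint_rel U"

definition gpoints_c :: "'a::real_normed_vector set \<Rightarrow> 'a pnet set set" where
  "gpoints_c U = {X \<in> gpoints U. \<exists>x\<in>X. \<exists>K. K \<subset>\<subset> U \<and>
     (\<exists>\<epsilon>0\<in>{0<..1}. \<forall>\<epsilon>\<in>{0<..\<epsilon>0}. x \<epsilon> \<in> K)}"

definition near_standard :: "'a::real_normed_vector pnet set \<Rightarrow> 'a \<Rightarrow> bool" where
  "near_standard X x0 \<longleftrightarrow> (\<exists>x\<in>X. (x \<longlongrightarrow> x0) (at_right 0))"

text \<open>Regards a generalized point of one set as a generalized point of \<open>S\<close>. As classes
  depend on the set the nets live in, this is needed to evaluate a generalized function on
  \<open>U'\<close> at a point of \<open>U\<close> near-standard in \<open>U'\<close>, and to compare a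
  point of \<open>V\<close> with a point value, which is a point of \<open>\<real>\<^sup>m\<close>.\<close>

definition gpoint_in :: "'a::real_normed_vector set \<Rightarrow> 'a pnet set \<Rightarrow> 'a pnet set" where
  "gpoint_in S X = {z \<in> moderate_points S. \<exists>x\<in>X. pnet_equiv x z}"

definition point_value ::
    "('a::euclidean_space, 'b::real_normed_vector) net set \<Rightarrow> 'a pnet set \<Rightarrow> 'b pnet set" where
  "point_value u X = (\<Union>u'\<in>u. \<Union>x\<in>X. gpoint_rel UNIV `` {\<lambda>\<epsilon>. u' \<epsilon> (x \<epsilon>)})"

text \<open>\<open>u\<close> solves \<open>Du(x) = F(x, u(x))\<close>, \<open>u(X) = Y\<close> in \<open>\<G>[U', W]\<close>.\<close>

definition is_solution :: "(real^'n) set \<Rightarrow> (real^'m) set \<Rightarrow>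
    ((real^'n) \<times> (real^'m), real^'n^'m) net set \<Rightarrow> (real^'n) pnet set \<Rightarrow> (real^'m) pnet set \<Rightarrow>
    (real^'n) set \<Rightarrow> (real^'m) set \<Rightarrow> (real^'n, real^'m) net set \<Rightarrow> bool" where
  "is_solution U V F X Y U' W u \<longleftrightarrow>
     u \<in> colombeau_cb U' W \<and>
     gderiv U' u = gcompose U' (U \<times> V) F (gpair_id U' u) \<and>
     point_value u (gpoint_in U' X) = gpoint_in UNIV Y"

definition integrability_gfun :: "(real^'n) set \<Rightarrow> (real^'m) set \<Rightarrow>
    ((real^'n) \<times> (real^'m), real^'n^'m) net set \<Rightarrow>
    ((real^'n) \<times> (real^'m) \<times> (real^'n) \<times> (real^'n), real^'m) net set" where
  "integrability_gfun U V = gfun_lift (U \<times> V \<times> UNIV \<times> UNIV)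
     (\<lambda>F \<epsilon> (x, y, v1, v2).
        frechet_derivative (F \<epsilon>) (at (x, y)) (v1, F \<epsilon> (x, y) *v v1) *v v2)"

definition gswap :: "('a::euclidean_space \<times> 'b::euclidean_space \<times> 'c::euclidean_space \<times> 'c) set \<Rightarrow>
    ('a \<times> 'b \<times> 'c \<times> 'c, 'd::real_normed_vector) net set \<Rightarrow> ('a \<times> 'b \<times> 'c \<times> 'c, 'd) net set" where
  "gswap S = gfun_lift S (\<lambda>G \<epsilon> (x, y, v1, v2). G \<epsilon> (x, y, v2, v1))"

definition integrability_condition :: "(real^'n) set \<Rightarrow> (real^'m) set \<Rightarrow>
    ((real^'n) \<times> (real^'m), real^'n^'m) net set \<Rightarrow> bool" where
  "integrability_condition U V F \<longleftrightarrow>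
     gswap (U \<times> V \<times> UNIV \<times> UNIV) (integrability_gfun U V F) = integrability_gfun U V F"

end

theory Submission
  imports Defs
begin

text \<open>
  Every assertion about classes is first translated into estimates for representatives. Two facts make
  this manageable. A moderate net whose values are negligible on compact sets is negligible together
  with all its derivatives (\<open>negligible_nets_iff\<close>), and negligible perturbations of the argument change the values of a
  moderate net negligibly (\<open>moderate_perturb\<close>). Hence the operations on classes are computed on arbitrary
  representatives, the differential equation says that the residual \<open>Da - f(\<cdot>, a)\<close> is small on
  compact sets (\<open>ode_residual_iff\<close>), and the integrability condition says the same of
  \<open>defect f (x, y, v, w) = Df(x, y)(v, f(x, y) v) w - Df(x, y)(w, f(x, y) w) v\<close> (\<open>integrability_condition_iff\<close>).

  \<^emph>\<open>Solvability implies integrability.\<close> Differentiating the equation for a solution \<open>a\<close> once more, the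
  symmetry of \<open>D\<^sup>2a\<close> shows that the defect is negligible along the graph of \<open>a\<close> (\<open>defect_bound\<close>), in particular
  at the initial point. By hypothesis every pair of a near-standard and a compactly supported point is
  initial point of a solution, and such points detect whether a net is negligible (\<open>negl_if_negl_on_convergent_nets\<close>).

  \<^emph>\<open>Uniqueness.\<close> The difference of two solutions satisfies a linear differential inequality on segments
  issuing from the initial point, with a Lipschitz constant \<open>O(\<bar>log \<epsilon>\<bar>)\<close>. Gronwall's inequality loses
  a factor \<open>exp (O(\<bar>log \<epsilon>\<bar>))\<close>, that is, a power of \<open>1/\<epsilon>\<close>, which a negligible net absorbs (\<open>solutions_agree\<close>).

  \<^emph>\<open>Existence.\<close> Since the equation has to hold only up to negligible terms, a sufficiently fine explicit
  approximation already is a solution. On a ball around \<open>x\<^sub>0\<close> let \<open>u\<^sub>\<epsilon>(x)\<close> be the last vertex of the Euler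
  polygon with \<open>N\<close> steps, \<open>N\<close> about \<open>exp (1/\<epsilon>)\<close>, for the equation restricted to the segment from the
  initial point to \<open>x\<close>:
  \<open>z\<^sub>0 = y\<^sub>0\<close>, \<open>z\<^bsub>j+1\<^esub> = z\<^sub>j + f(x\<^sub>j, z\<^sub>j)(x - \<xi>)/N\<close>, \<open>x\<^sub>j = \<xi> + (j/N)(x - \<xi>)\<close>.
  It is smooth in \<open>x\<close> because it is a finite composition of smooth maps, and it stays in \<open>W\<close> because
  \<open>f\<close> is bounded. The quantity \<open>h\<^sub>j = Dz\<^sub>j v - (j/N) f(x\<^sub>j, z\<^sub>j) v\<close> satisfies
  \<open>h\<^bsub>j+1\<^esub> = h\<^sub>j + (1/N) \<partial>\<^sub>2f(h\<^sub>j)(x - \<xi>) + (j/N\<^sup>2) defect f (x\<^sub>j, z\<^sub>j, v, x - \<xi>) + O(1/N\<^sup>2)\<close>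
  with a moderate constant in the last term. Thus, by the discrete Gronwall inequality, integrability
  makes the residual \<open>h\<^sub>N\<close> negligible (\<open>residual_negl\<close>). The derivatives of \<open>z\<^sub>j\<close> of order \<open>k\<close> obey a recursion of
  the same kind whose inhomogeneity involves derivatives of lower order only (\<open>partials_compose_remainder\<close>), so they are
  moderate by induction on \<open>k\<close>, uniformly in \<open>j\<close> (\<open>polygon_moderate\<close>).
\<close>

section \<open>Iterated partial derivatives\<close>

lemma partials_append: "partials (bs @ cs) f = partials bs (partials cs f)"
  by (induct bs) auto

text \<open>Functions are total, so that derivatives at points of an open set are only determined by the
  values there. Equations between nets that hold on an open set are transported by these rules.\<close>

lemma frechet_derivative_cong_open:
  assumes "open U" "x \<in> U" "\<And>y. y \<in> U \<Longrightarrow> f y = g y"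
  shows "frechet_derivative f (at x) = frechet_derivative g (at x)"
proof -
  have "(f has_derivative D) (at x) \<longleftrightarrow> (g has_derivative D) (at x)" for D
    using has_derivative_transform_within_open[OF _ assms(1,2)] assms(3) by metis
  then show ?thesis
    unfolding frechet_derivative_def by simp
qed

lemma differentiable_cong_open:
  assumes "open U" "x \<in> U" "\<And>y. y \<in> U \<Longrightarrow> f y = g y" "g differentiable at x"
  shows "f differentiable at x"
  using has_derivative_transform_within_open[OF _ assms(1,2), of g] assms(3,4)
  unfolding differentiable_def by metis

lemma partials_cong_open:
  assumes "open U" "\<And>y. y \<in> U \<Longrightarrow> f y = g y" "x \<in> U"
  shows "partials bs f x = partials bs g x"
  using assms(3)
proof (induct bs arbitrary: x)
  case (Cons b bs)
  then show ?case
    using frechet_derivative_cong_open[OF assms(1) Cons.prems, of "partials bs f" "partials bs g"]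
    by simp
qed (use assms in simp)

lemma smooth_on_cong:
  assumes "open U" "\<And>y. y \<in> U \<Longrightarrow> f y = g y" "smooth_on U g"
  shows "smooth_on U f"
  unfolding smooth_on_def
proof (intro allI impI ballI)
  fix bs :: "'a list" and x assume "set bs \<subseteq> Basis" "x \<in> U"
  then show "partials bs f differentiable at x"
    using assms partials_cong_open[OF assms(1,2)]
    by (intro differentiable_cong_open[OF assms(1), of x "partials bs f" "partials bs g"])
       (auto simp: smooth_on_def)
qed

lemma smooth_on_partials:
  "smooth_on U f \<Longrightarrow> set bs \<subseteq> Basis \<Longrightarrow> smooth_on U (partials bs f)"
  unfolding smooth_on_def by (metis partials_append set_append Un_subset_iff)

lemma smooth_on_differentiable: "smooth_on U f \<Longrightarrow> x \<in> U \<Longrightarrow> f differentiable at x"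
  unfolding smooth_on_def by (metis empty_subsetI list.set(1) partials.simps(1))

lemma frechet_derivative_eq:
  "(f has_derivative D) (at x) \<Longrightarrow> frechet_derivative f (at x) = D"
  by (metis frechet_derivative_at)

lemma frechet_derivative_expand:
  fixes f :: "'a::euclidean_space \<Rightarrow> 'b::real_normed_vector"
  assumes "f differentiable at x"
  shows "frechet_derivative f (at x) v = (\<Sum>b\<in>Basis. (v \<bullet> b) *\<^sub>R partials [b] f x)"
proof -
  have lin: "linear (frechet_derivative f (at x))"
    using assms by (rule linear_frechet_derivative)
  have "frechet_derivative f (at x) v
      = frechet_derivative f (at x) (\<Sum>b\<in>Basis. (v \<bullet> b) *\<^sub>R b)"
    by (simp add: euclidean_representation)
  then show ?thesis
    by (simp add: linear_sum[OF lin] linear_cmul[OF lin])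
qed

lemma norm_frechet_derivative_le:
  fixes f :: "'a::euclidean_space \<Rightarrow> 'b::real_normed_vector"
  assumes "f differentiable at x"
  shows "norm (frechet_derivative f (at x) v) \<le> (\<Sum>b\<in>Basis. norm (partials [b] f x)) * norm v"
proof -
  have "norm (frechet_derivative f (at x) v) \<le> (\<Sum>b\<in>Basis. norm ((v \<bullet> b) *\<^sub>R partials [b] f x))"
    unfolding frechet_derivative_expand[OF assms] by (rule norm_sum)
  also have "\<dots> \<le> (\<Sum>b\<in>Basis. norm (partials [b] f x) * norm v)"
    by (intro sum_mono) (simp add: Basis_le_norm mult_right_mono mult.commute[of _ "norm v"])
  finally show ?thesis by (simp add: sum_distrib_right)
qed

section \<open>Moderate growth along a filter\<close>

text \<open>The estimates below are needed for \<open>\<epsilon> \<rightarrow> 0\<close>, uniformly over the vertices of a polygon as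
  well, and once without any limit, for single functions. All are instances of growth along a filter
  on an index type with a scale function \<open>s\<close>, which plays the role of \<open>1/\<epsilon>\<close>. A lower bound greater
  than \<open>1\<close> lets powers of \<open>s\<close> absorb constants.\<close>

locale scale =
  fixes F :: "'i filter" and s :: "'i \<Rightarrow> real"
  assumes scale_ge_2: "\<forall>\<^sub>F i in F. 2 \<le> s i"
begin

definition mod_bdd :: "'a set \<Rightarrow> ('i \<Rightarrow> 'a \<Rightarrow> 'b::real_normed_vector) \<Rightarrow> bool" where
  "mod_bdd K f \<longleftrightarrow> (\<exists>M::nat. \<forall>\<^sub>F i in F. \<forall>x\<in>K. norm (f i x) \<le> s i ^ M)"

text \<open>The order is bounded so that properties can be proved by induction on it. Smoothness on \<open>U\<close> and
  bounds on \<open>K\<close> are kept apart because moderate nets are bounded on compact subsets only.\<close>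

definition tame :: "'a::euclidean_space set \<Rightarrow> 'a set \<Rightarrow> nat
    \<Rightarrow> ('i \<Rightarrow> 'a \<Rightarrow> 'b::real_normed_vector) \<Rightarrow> bool" where
  "tame U K k f \<longleftrightarrow> (\<forall>bs. set bs \<subseteq> Basis \<and> length bs \<le> k \<longrightarrow>
     (\<forall>\<^sub>F i in F. \<forall>x\<in>U. partials bs (f i) differentiable at x) \<and>
     mod_bdd K (\<lambda>i. partials bs (f i)))"

lemma const_le_scale_power: obtains p where "\<forall>\<^sub>F i in F. C \<le> s i ^ p"
proof -
  obtain p where p: "C < 2 ^ p"
    using real_arch_pow[of 2 C] by auto
  have "\<forall>\<^sub>F i in F. C \<le> s i ^ p"
    using scale_ge_2
  proof eventually_elim
    case (elim i)
    then have "(2::real) ^ p \<le> s i ^ p" by (intro power_mono) auto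
    with p show ?case by linarith
  qed
  then show ?thesis by (rule that)
qed

lemma mod_bddI:
  assumes "\<forall>\<^sub>F i in F. \<forall>x\<in>K. norm (f i x) \<le> C * s i ^ M"
  shows "mod_bdd K f"
proof -
  obtain p where p: "\<forall>\<^sub>F i in F. C \<le> s i ^ p" by (rule const_le_scale_power)
  have "\<forall>\<^sub>F i in F. \<forall>x\<in>K. norm (f i x) \<le> s i ^ (p + M)"
    using assms p scale_ge_2
  proof eventually_elim
    case (elim i)
    then have "C * s i ^ M \<le> s i ^ p * s i ^ M"
      by (intro mult_right_mono) auto
    then show ?case using elim(1) by (force simp: power_add)
  qed
  then show ?thesis unfolding mod_bdd_def by blast
qed

lemma mod_bddE:
  assumes "mod_bdd K f"
  obtains M where "\<forall>\<^sub>F i in F. \<forall>x\<in>K. norm (f i x) \<le> s i ^ M"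
  using assms unfolding mod_bdd_def by blast

lemma mod_bdd_raise:
  assumes "\<forall>\<^sub>F i in F. \<forall>x\<in>K. norm (f i x) \<le> s i ^ M" "M \<le> M'"
  shows "\<forall>\<^sub>F i in F. \<forall>x\<in>K. norm (f i x) \<le> s i ^ M'"
  using assms(1) scale_ge_2
proof eventually_elim
  case (elim i)
  then have "s i ^ M \<le> s i ^ M'" by (intro power_increasing assms) auto
  then show ?case using elim(1) by force
qed

lemma mod_bdd_mono:
  assumes "mod_bdd K g" "\<forall>\<^sub>F i in F. \<forall>x\<in>K'. x \<in> K \<and> norm (f i x) \<le> norm (g i x)"
  shows "mod_bdd K' f"
proof -
  obtain M where "\<forall>\<^sub>F i in F. \<forall>x\<in>K. norm (g i x) \<le> s i ^ M" using assms(1) by (rule mod_bddE)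
  with assms(2) have "\<forall>\<^sub>F i in F. \<forall>x\<in>K'. norm (f i x) \<le> s i ^ M"
    by eventually_elim force
  then show ?thesis unfolding mod_bdd_def by blast
qed

lemma mod_bdd_cong:
  assumes "mod_bdd K g" "\<forall>\<^sub>F i in F. \<forall>x\<in>K. f i x = g i x"
  shows "mod_bdd K f"
  by (rule mod_bdd_mono[OF assms(1)]) (rule eventually_mono[OF assms(2)], simp)

lemma mod_bdd_const: "mod_bdd K (\<lambda>i x. c)"
  by (rule mod_bddI[where C="norm c" and M=0]) simp

lemma mod_bdd_add:
  assumes "mod_bdd K f" "mod_bdd K g"
  shows "mod_bdd K (\<lambda>i x. f i x + g i x)"
proof -
  obtain M where M: "\<forall>\<^sub>F i in F. \<forall>x\<in>K. norm (f i x) \<le> s i ^ M" using assms(1) by (rule mod_bddE)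
  obtain M' where M': "\<forall>\<^sub>F i in F. \<forall>x\<in>K. norm (g i x) \<le> s i ^ M'" using assms(2) by (rule mod_bddE)
  have "\<forall>\<^sub>F i in F. \<forall>x\<in>K. norm (f i x + g i x) \<le> 2 * s i ^ (M + M')"
    using mod_bdd_raise[OF M le_add1[of M M']] mod_bdd_raise[OF M' le_add2[of M' M]]
  proof eventually_elim
    case (elim i)
    show ?case
    proof
      fix x assume "x \<in> K"
      with elim show "norm (f i x + g i x) \<le> 2 * s i ^ (M + M')"
        using norm_triangle_ineq[of "f i x" "g i x"] by fastforce
    qed
  qed
  then show ?thesis by (rule mod_bddI)
qed

lemma mod_bdd_sum:
  assumes "\<And>c. c \<in> A \<Longrightarrow> mod_bdd K (f c)"
  shows "mod_bdd K (\<lambda>i x. \<Sum>c\<in>A. f c i x)"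
  using assms
  by (induct A rule: infinite_finite_induct) (auto intro: mod_bdd_add mod_bdd_const)

lemma mod_bdd_bilinear:
  assumes "bounded_bilinear h" "mod_bdd K f" "mod_bdd K g"
  shows "mod_bdd K (\<lambda>i x. h (f i x) (g i x))"
proof -
  obtain C where C: "C \<ge> 0" "\<And>a b. norm (h a b) \<le> norm a * norm b * C"
    using bounded_bilinear.nonneg_bounded[OF assms(1)] by blast
  obtain M where M: "\<forall>\<^sub>F i in F. \<forall>x\<in>K. norm (f i x) \<le> s i ^ M" using assms(2) by (rule mod_bddE)
  obtain M' where M': "\<forall>\<^sub>F i in F. \<forall>x\<in>K. norm (g i x) \<le> s i ^ M'" using assms(3) by (rule mod_bddE)
  have "\<forall>\<^sub>F i in F. \<forall>x\<in>K. norm (h (f i x) (g i x)) \<le> C * s i ^ (M + M')"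
    using M M' scale_ge_2
  proof eventually_elim
    case (elim i)
    show ?case
    proof
      fix x assume "x \<in> K"
      then have "norm (f i x) * norm (g i x) \<le> s i ^ M * s i ^ M'"
        using elim by (intro mult_mono) auto
      then have "norm (f i x) * norm (g i x) * C \<le> s i ^ M * s i ^ M' * C"
        using C(1) by (rule mult_right_mono)
      then show "norm (h (f i x) (g i x)) \<le> C * s i ^ (M + M')"
        using C(2)[of "f i x" "g i x"] by (simp add: power_add mult_ac)
    qed
  qed
  then show ?thesis by (rule mod_bddI)
qed

lemma mod_bdd_linear:
  assumes "bounded_linear h" "mod_bdd K f"
  shows "mod_bdd K (\<lambda>i x. h (f i x))"
proof -
  obtain C where C: "C > 0" "\<And>a. norm (h a) \<le> norm a * C"
    using bounded_linear.pos_bounded[OF assms(1)] by blast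
  obtain M where M: "\<forall>\<^sub>F i in F. \<forall>x\<in>K. norm (f i x) \<le> s i ^ M" using assms(2) by (rule mod_bddE)
  then have "\<forall>\<^sub>F i in F. \<forall>x\<in>K. norm (h (f i x)) \<le> C * s i ^ M"
  proof eventually_elim
    case (elim i)
    show ?case
    proof
      fix x assume "x \<in> K"
      with elim have "norm (f i x) * C \<le> s i ^ M * C"
        using C(1) by (intro mult_right_mono) auto
      then show "norm (h (f i x)) \<le> C * s i ^ M"
        using C(2)[of "f i x"] by (simp add: mult.commute)
    qed
  qed
  then show ?thesis by (rule mod_bddI)
qed

lemma mod_bdd_subset: "mod_bdd K f \<Longrightarrow> K' \<subseteq> K \<Longrightarrow> mod_bdd K' f"
  by (rule mod_bdd_mono[of K f K' f]) (auto intro: always_eventually)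

lemma mod_bdd_empty: "mod_bdd {} f"
  unfolding mod_bdd_def by simp

lemma mod_bdd_compose:
  assumes "mod_bdd L v" "\<forall>\<^sub>F i in F. p i ` K \<subseteq> L"
  shows "mod_bdd K (\<lambda>i x. v i (p i x))"
proof -
  obtain M where M: "\<forall>\<^sub>F i in F. \<forall>x\<in>L. norm (v i x) \<le> s i ^ M" using assms(1) by (rule mod_bddE)
  have "\<forall>\<^sub>F i in F. \<forall>x\<in>K. norm (v i (p i x)) \<le> s i ^ M"
    using M assms(2) by eventually_elim auto
  then show ?thesis unfolding mod_bdd_def by blast
qed

lemma tame_mono:
  assumes "tame U K k f" "k' \<le> k" "U' \<subseteq> U" "K' \<subseteq> K"
  shows "tame U' K' k' f"
  unfolding tame_def
proof (intro allI impI)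
  fix bs :: "'a list" assume "set bs \<subseteq> Basis \<and> length bs \<le> k'"
  then have *: "\<forall>\<^sub>F i in F. \<forall>x\<in>U. partials bs (f i) differentiable at x"
      "mod_bdd K (\<lambda>i. partials bs (f i))"
    using assms(1,2) by (auto simp: tame_def)
  have "\<forall>\<^sub>F i in F. \<forall>x\<in>U'. partials bs (f i) differentiable at x"
    using *(1) by eventually_elim (use assms(3) in blast)
  with mod_bdd_subset[OF *(2) assms(4)]
  show "(\<forall>\<^sub>F i in F. \<forall>x\<in>U'. partials bs (f i) differentiable at x) \<and>
      mod_bdd K' (\<lambda>i. partials bs (f i))" by simp
qed

lemma tame_0:
  "tame U K 0 f \<longleftrightarrow> (\<forall>\<^sub>F i in F. \<forall>x\<in>U. f i differentiable at x) \<and> mod_bdd K f"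
  by (simp add: tame_def)

text \<open>The recursion behind all closure properties: the first derivatives of sums, products and
  compositions are again sums, products and compositions.\<close>

lemma tame_Suc:
  "tame U K (Suc k) f \<longleftrightarrow> tame U K 0 f \<and> (\<forall>b\<in>Basis. tame U K k (\<lambda>i. partials [b] (f i)))"
  (is "?l \<longleftrightarrow> ?r")
proof
  assume l: ?l
  have "tame U K k (\<lambda>i. partials [b] (f i))" if "b \<in> Basis" for b
    unfolding tame_def partials_append[symmetric]
    using l that unfolding tame_def by auto
  moreover have "tame U K 0 f" by (rule tame_mono[OF l]) auto
  ultimately show ?r by blast
next
  assume r: ?r
  show ?l unfolding tame_def
  proof (intro allI impI)
    fix bs :: "'a list" assume bs: "set bs \<subseteq> Basis \<and> length bs \<le> Suc k"
    show "(\<forall>\<^sub>F i in F. \<forall>x\<in>U. partials bs (f i) differentiable at x) \<and>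
      mod_bdd K (\<lambda>i. partials bs (f i))"
    proof (cases bs rule: rev_cases)
      case Nil
      then show ?thesis using r by (simp add: tame_0)
    next
      case (snoc cs b)
      then have "tame U K k (\<lambda>i. partials [b] (f i))" using r bs by auto
      then show ?thesis using bs
        unfolding snoc partials_append tame_def by auto
    qed
  qed
qed

lemma tame_0D: "tame U K k f \<Longrightarrow> tame U K 0 f"
  by (rule tame_mono) auto

lemma tame_SucD: "tame U K (Suc k) f \<Longrightarrow> tame U K k f"
  by (rule tame_mono) auto

lemma tame_partial: "tame U K (Suc k) f \<Longrightarrow> b \<in> Basis \<Longrightarrow> tame U K k (\<lambda>i. partials [b] (f i))"
  by (simp add: tame_Suc)

lemma tame_mod_bdd: "tame U K k f \<Longrightarrow> set bs \<subseteq> Basis \<Longrightarrow> length bs \<le> k \<Longrightarrow> mod_bdd K (\<lambda>i. partials bs (f i))"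
  by (simp add: tame_def)

lemma tame_cong:
  assumes "open U" "K \<subseteq> U" "\<forall>\<^sub>F i in F. \<forall>x\<in>U. f i x = g i x" "tame U K k g"
  shows "tame U K k f"
  unfolding tame_def
proof (intro allI impI conjI)
  fix bs :: "'a list" assume bs: "set bs \<subseteq> Basis \<and> length bs \<le> k"
  have eq: "\<forall>\<^sub>F i in F. \<forall>x\<in>U. partials bs (f i) x = partials bs (g i) x"
    using assms(3) by eventually_elim (use partials_cong_open[OF assms(1)] in blast)
  have "\<forall>\<^sub>F i in F. \<forall>x\<in>U. partials bs (g i) differentiable at x"
    using assms(4) bs unfolding tame_def by auto
  with eq show "\<forall>\<^sub>F i in F. \<forall>x\<in>U. partials bs (f i) differentiable at x"
    by eventually_elim (use differentiable_cong_open[OF assms(1)] in blast)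
  show "mod_bdd K (\<lambda>i. partials bs (f i))"
  proof (rule mod_bdd_cong[where g="\<lambda>i. partials bs (g i)"])
    show "mod_bdd K (\<lambda>i. partials bs (g i))"
      using assms(4) bs by (simp add: tame_def)
    show "\<forall>\<^sub>F i in F. \<forall>x\<in>K. partials bs (f i) x = partials bs (g i) x"
      using eq by eventually_elim (use assms(2) in blast)
  qed
qed

lemma tame_const:
  assumes "mod_bdd K (\<lambda>i x. c i)"
  shows "tame U K k (\<lambda>i x. c i)"
  using assms
proof (induct k arbitrary: c)
  case (Suc k)
  have "partials [b] (\<lambda>x. c i) = (\<lambda>x. 0)" for b :: 'a and i
    by (auto simp: frechet_derivative_eq[OF has_derivative_const])
  then show ?case
    unfolding tame_Suc using Suc.hyps[of "\<lambda>i. 0"] Suc.prems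
    by (auto simp: tame_0 mod_bdd_const)
qed (simp add: tame_0)

lemma tame_id:
  assumes "bounded K"
  shows "tame U K k (\<lambda>i x. x)"
proof -
  obtain C where "\<forall>x\<in>K. norm x \<le> C" using assms by (auto simp: bounded_iff)
  then have "mod_bdd K (\<lambda>i x. x)" by (intro mod_bddI[where C=C and M=0]) simp
  then have 0: "tame U K 0 (\<lambda>i x. x)" by (simp add: tame_0)
  have "partials [b] (\<lambda>x. x) = (\<lambda>x. b)" for b :: 'a
    by (auto simp: frechet_derivative_eq[OF has_derivative_ident])
  then show ?thesis
    using 0 by (cases k) (auto simp: tame_Suc intro!: tame_const mod_bdd_const)
qed

lemma tame_bounded_linear:
  assumes "open U" "K \<subseteq> U" "bounded_linear h" "tame U K k f"
  shows "tame U K k (\<lambda>i x. h (f i x))"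
  using assms(4)
proof (induct k arbitrary: f)
  case 0
  then have "\<forall>\<^sub>F i in F. \<forall>x\<in>U. (\<lambda>x. h (f i x)) differentiable at x"
    unfolding tame_0 differentiable_def
    by (elim conjE eventually_mono) (use bounded_linear.has_derivative[OF assms(3)] in blast)
  then show ?case using 0 mod_bdd_linear[OF assms(3), of K f] by (simp add: tame_0)
next
  case (Suc k)
  have "tame U K 0 (\<lambda>i x. h (f i x))"
    using Suc.hyps[of f] Suc.prems tame_SucD tame_0D by blast
  moreover have "tame U K k (\<lambda>i. partials [b] (\<lambda>x. h (f i x)))" if b: "b \<in> Basis" for b
  proof (rule tame_cong[OF assms(1,2)])
    show "tame U K k (\<lambda>i x. h (partials [b] (f i) x))"
      by (rule Suc.hyps) (use Suc.prems b in \<open>simp add: tame_Suc\<close>)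
    have "\<forall>\<^sub>F i in F. \<forall>x\<in>U. f i differentiable at x"
      using Suc.prems by (simp add: tame_Suc tame_0)
    then show "\<forall>\<^sub>F i in F. \<forall>x\<in>U. partials [b] (\<lambda>x. h (f i x)) x = h (partials [b] (f i) x)"
    proof eventually_elim
      case (elim i)
      then show ?case
        by (auto simp: frechet_derivative_works
            intro!: frechet_derivative_eq[THEN fun_cong] bounded_linear.has_derivative[OF assms(3)])
    qed
  qed
  ultimately show ?case unfolding tame_Suc by blast
qed

lemma tame_add:
  assumes "open U" "K \<subseteq> U" "tame U K k f" "tame U K k g"
  shows "tame U K k (\<lambda>i x. f i x + g i x)"
  using assms(3,4)
proof (induct k arbitrary: f g)
  case 0
  have "\<forall>\<^sub>F i in F. \<forall>x\<in>U. (\<lambda>x. f i x + g i x) differentiable at x"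
    using 0[unfolded tame_0, THEN conjunct1] by eventually_elim auto
  then show ?case using 0 mod_bdd_add[of K f g] by (simp add: tame_0)
next
  case (Suc k)
  have "tame U K 0 (\<lambda>i x. f i x + g i x)"
    using Suc.hyps[of f g] Suc.prems tame_SucD tame_0D by blast
  moreover have "tame U K k (\<lambda>i. partials [b] (\<lambda>x. f i x + g i x))" if b: "b \<in> Basis" for b
  proof (rule tame_cong[OF assms(1,2)])
    show "tame U K k (\<lambda>i x. partials [b] (f i) x + partials [b] (g i) x)"
      by (rule Suc.hyps) (use Suc.prems b in \<open>simp_all add: tame_Suc\<close>)
    have "\<forall>\<^sub>F i in F. \<forall>x\<in>U. f i differentiable at x" "\<forall>\<^sub>F i in F. \<forall>x\<in>U. g i differentiable at x"
      using Suc.prems by (simp_all add: tame_Suc tame_0)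
    then show "\<forall>\<^sub>F i in F. \<forall>x\<in>U. partials [b] (\<lambda>x. f i x + g i x) x
        = partials [b] (f i) x + partials [b] (g i) x"
    proof eventually_elim
      case (elim i)
      then show ?case
        by (auto simp: frechet_derivative_works
            intro!: frechet_derivative_eq[THEN fun_cong] has_derivative_add)
    qed
  qed
  ultimately show ?case unfolding tame_Suc by blast
qed

lemma tame_sum:
  assumes "open U" "K \<subseteq> U" "\<And>c. c \<in> A \<Longrightarrow> tame U K k (f c)"
  shows "tame U K k (\<lambda>i x. \<Sum>c\<in>A. f c i x)"
  using assms(3)
  by (induct A rule: infinite_finite_induct)
     (auto intro: tame_add[OF assms(1,2)] tame_const mod_bdd_const)

lemma differentiable_bilinear:
  assumes "bounded_bilinear h" "f differentiable at x" "g differentiable at x"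
  shows "(\<lambda>x. h (f x) (g x)) differentiable at x"
  using assms(2,3) bounded_bilinear.FDERIV[OF assms(1)] unfolding differentiable_def by blast

lemma partial_bilinear:
  assumes "bounded_bilinear h" "f differentiable at x" "g differentiable at x"
  shows "partials [b] (\<lambda>x. h (f x) (g x)) x = h (f x) (partials [b] g x) + h (partials [b] f x) (g x)"
  using assms
  by (auto simp: frechet_derivative_works
      intro!: frechet_derivative_eq[THEN fun_cong] bounded_bilinear.FDERIV)

lemma tame_bilinear:
  assumes "open U" "K \<subseteq> U" "bounded_bilinear h" "tame U K k f" "tame U K k g"
  shows "tame U K k (\<lambda>i x. h (f i x) (g i x))"
  using assms(4,5)
proof (induct k arbitrary: f g)
  case 0
  have "\<forall>\<^sub>F i in F. \<forall>x\<in>U. (\<lambda>x. h (f i x) (g i x)) differentiable at x"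
    using 0[unfolded tame_0, THEN conjunct1]
    by eventually_elim (use differentiable_bilinear[OF assms(3)] in blast)
  then show ?case using 0 mod_bdd_bilinear[OF assms(3), of K f g] by (simp add: tame_0)
next
  case (Suc k)
  have low: "tame U K k f" "tame U K k g"
    using Suc.prems by (simp_all add: tame_SucD)
  have "tame U K 0 (\<lambda>i x. h (f i x) (g i x))"
    using Suc.hyps[OF low] by (rule tame_0D)
  moreover have "tame U K k (\<lambda>i. partials [b] (\<lambda>x. h (f i x) (g i x)))" if b: "b \<in> Basis" for b
  proof (rule tame_cong[OF assms(1,2)])
    show "tame U K k (\<lambda>i x. h (f i x) (partials [b] (g i) x) + h (partials [b] (f i) x) (g i x))"
      by (intro tame_add[OF assms(1,2)] Suc.hyps low tame_partial Suc.prems b)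
    have "\<forall>\<^sub>F i in F. \<forall>x\<in>U. f i differentiable at x" "\<forall>\<^sub>F i in F. \<forall>x\<in>U. g i differentiable at x"
      using Suc.prems by (simp_all add: tame_Suc tame_0)
    then show "\<forall>\<^sub>F i in F. \<forall>x\<in>U. partials [b] (\<lambda>x. h (f i x) (g i x)) x
        = h (f i x) (partials [b] (g i) x) + h (partials [b] (f i) x) (g i x)"
      by eventually_elim (use partial_bilinear[OF assms(3)] in blast)
  qed
  ultimately show ?case unfolding tame_Suc by blast
qed

lemma partial_compose:
  fixes p :: "'a::euclidean_space \<Rightarrow> 'b::euclidean_space"
  assumes "p differentiable at x" "v differentiable at (p x)"
  shows "partials [b] (\<lambda>x. v (p x)) x = frechet_derivative v (at (p x)) (partials [b] p x)"
proof -
  have "((\<lambda>x. v (p x)) has_derivative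
      (\<lambda>h. frechet_derivative v (at (p x)) (frechet_derivative p (at x) h))) (at x)"
    using has_derivative_compose[OF assms[unfolded frechet_derivative_works]] by simp
  then show ?thesis by (simp add: frechet_derivative_eq)
qed

lemma tame_compose:
  assumes "open U" "K \<subseteq> U" "open V" "tame V L k v" "tame U K k p"
    and "\<forall>\<^sub>F i in F. p i ` U \<subseteq> V" "\<forall>\<^sub>F i in F. p i ` K \<subseteq> L"
  shows "tame U K k (\<lambda>i x. v i (p i x))"
  using assms(4,5)
proof (induct k arbitrary: v)
  case 0
  have "\<forall>\<^sub>F i in F. \<forall>x\<in>U. (\<lambda>x. v i (p i x)) differentiable at x"
    using 0[unfolded tame_0, THEN conjunct1] assms(6)
  proof eventually_elim
    case (elim i)
    show ?case
    proof
      fix x assume "x \<in> U"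
      with elim have "v i \<circ> p i differentiable at x" by (intro differentiable_chain_at) auto
      then show "(\<lambda>x. v i (p i x)) differentiable at x" by (simp add: o_def)
    qed
  qed
  then show ?case using 0 mod_bdd_compose[of L v p K] assms(7) by (simp add: tame_0)
next
  case (Suc k)
  have low: "tame V L k v" "tame U K k p"
    using Suc.prems by (simp_all add: tame_SucD)
  have "tame U K 0 (\<lambda>i x. v i (p i x))"
    using Suc.hyps[OF low] by (rule tame_0D)
  moreover have "tame U K k (\<lambda>i. partials [b] (\<lambda>x. v i (p i x)))" if b: "b \<in> Basis" for b
  proof (rule tame_cong[OF assms(1,2)])
    show "tame U K k (\<lambda>i x. \<Sum>c\<in>Basis. (partials [b] (p i) x \<bullet> c) *\<^sub>R partials [c] (v i) (p i x))"
    proof (rule tame_sum[OF assms(1,2)])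
      fix c :: 'b assume c: "c \<in> Basis"
      show "tame U K k (\<lambda>i x. (partials [b] (p i) x \<bullet> c) *\<^sub>R partials [c] (v i) (p i x))"
        by (intro tame_bilinear[OF assms(1,2) bounded_bilinear_scaleR] Suc.hyps low
            tame_bounded_linear[OF assms(1,2) bounded_linear_inner_left]
            tame_partial[OF Suc.prems(1) c] tame_partial[OF Suc.prems(2) b])
    qed
    have "\<forall>\<^sub>F i in F. \<forall>x\<in>V. v i differentiable at x" "\<forall>\<^sub>F i in F. \<forall>x\<in>U. p i differentiable at x"
      using Suc.prems by (simp_all add: tame_Suc tame_0)
    with assms(6) show "\<forall>\<^sub>F i in F. \<forall>x\<in>U. partials [b] (\<lambda>x. v i (p i x)) x
        = (\<Sum>c\<in>Basis. (partials [b] (p i) x \<bullet> c) *\<^sub>R partials [c] (v i) (p i x))"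
    proof eventually_elim
      case (elim i)
      show ?case
      proof
        fix x assume "x \<in> U"
        with elim have "p i differentiable at x" "v i differentiable at (p i x)" by auto
        then show "partials [b] (\<lambda>x. v i (p i x)) x
            = (\<Sum>c\<in>Basis. (partials [b] (p i) x \<bullet> c) *\<^sub>R partials [c] (v i) (p i x))"
          using partial_compose frechet_derivative_expand by metis
      qed
    qed
  qed
  ultimately show ?case unfolding tame_Suc by blast
qed

end

text \<open>For a one-point filter and an empty set of estimation, tameness of all orders is smoothness of a
  single function, which therefore inherits the closure properties.\<close>

interpretation pt: scale "principal {()}" "\<lambda>_. 2"
  by unfold_locales (simp add: eventually_principal)

lemma smooth_on_iff_tame: "smooth_on U f \<longleftrightarrow> (\<forall>k. pt.tame U {} k (\<lambda>_. f))"
  unfolding smooth_on_def pt.tame_def by (auto simp: eventually_principal pt.mod_bdd_empty)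

lemma smooth_on_compose:
  assumes "open U" "open V" "smooth_on V v" "smooth_on U p" "p ` U \<subseteq> V"
  shows "smooth_on U (\<lambda>x. v (p x))"
  using assms unfolding smooth_on_iff_tame
  by (auto intro!: pt.tame_compose[of U "{}" V "{}" _ "\<lambda>_. v" "\<lambda>_. p"] simp: eventually_principal)

lemma smooth_on_bilinear:
  assumes "open U" "bounded_bilinear h" "smooth_on U f" "smooth_on U g"
  shows "smooth_on U (\<lambda>x. h (f x) (g x))"
  using assms unfolding smooth_on_iff_tame
  by (auto intro!: pt.tame_bilinear[of U "{}" h _ "\<lambda>_. f" "\<lambda>_. g"])

lemma smooth_on_bounded_linear:
  assumes "open U" "bounded_linear h" "smooth_on U f"
  shows "smooth_on U (\<lambda>x. h (f x))"
  using assms unfolding smooth_on_iff_tame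
  by (auto intro!: pt.tame_bounded_linear[of U "{}" h _ "\<lambda>_. f"])

lemma smooth_on_add:
  assumes "open U" "smooth_on U f" "smooth_on U g"
  shows "smooth_on U (\<lambda>x. f x + g x)"
  using assms unfolding smooth_on_iff_tame
  by (auto intro!: pt.tame_add[of U "{}" _ "\<lambda>_. f" "\<lambda>_. g"])

lemma smooth_on_const: "smooth_on U (\<lambda>x. c)"
  unfolding smooth_on_iff_tame by (auto intro!: pt.tame_const pt.mod_bdd_empty)

lemma smooth_on_id: "smooth_on U (\<lambda>x. x)"
  unfolding smooth_on_iff_tame by (auto intro!: pt.tame_id)


lemma smooth_on_sum:
  assumes "open U" "\<And>c. c \<in> A \<Longrightarrow> smooth_on U (f c)"
  shows "smooth_on U (\<lambda>x. \<Sum>c\<in>A. f c x)"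
  using assms(2)
  by (induct A rule: infinite_finite_induct) (auto intro: smooth_on_add[OF assms(1)] smooth_on_const)

lemma partials_zero: "partials bs (\<lambda>x. 0) = (\<lambda>x. 0)"
  by (induct bs) (auto simp: frechet_derivative_eq[OF has_derivative_const])

lemma partials_bounded_linear:
  assumes "bounded_linear h" "open U" "smooth_on U f" "set bs \<subseteq> Basis" "x \<in> U"
  shows "partials bs (\<lambda>x. h (f x)) x = h (partials bs f x)"
  using assms(4,5)
proof (induct bs arbitrary: x)
  case (Cons b bs)
  have "partials bs f differentiable at x" using assms(3) Cons.prems by (auto simp: smooth_on_def)
  then have "((\<lambda>y. h (partials bs f y)) has_derivative
      (\<lambda>d. h (frechet_derivative (partials bs f) (at x) d))) (at x)"
    by (intro bounded_linear.has_derivative[OF assms(1)]) (simp add: frechet_derivative_works)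
  moreover have "frechet_derivative (partials bs (\<lambda>x. h (f x))) (at x)
      = frechet_derivative (\<lambda>y. h (partials bs f y)) (at x)"
    by (rule frechet_derivative_cong_open[OF assms(2)]) (use Cons in auto)
  ultimately show ?case by (simp add: frechet_derivative_eq)
qed simp

lemma partials_add:
  assumes "open U" "smooth_on U f" "smooth_on U g" "set bs \<subseteq> Basis" "x \<in> U"
  shows "partials bs (\<lambda>x. f x + g x) x = partials bs f x + partials bs g x"
  using assms(4,5)
proof (induct bs arbitrary: x)
  case (Cons b bs)
  have "partials bs f differentiable at x" "partials bs g differentiable at x"
    using assms(2,3) Cons.prems by (auto simp: smooth_on_def)
  then have "((\<lambda>y. partials bs f y + partials bs g y) has_derivative
      (\<lambda>d. frechet_derivative (partials bs f) (at x) d + frechet_derivative (partials bs g) (at x) d)) (at x)"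
    by (intro has_derivative_add) (simp_all add: frechet_derivative_works)
  moreover have "frechet_derivative (partials bs (\<lambda>x. f x + g x)) (at x)
      = frechet_derivative (\<lambda>y. partials bs f y + partials bs g y) (at x)"
    by (rule frechet_derivative_cong_open[OF assms(1)]) (use Cons in auto)
  ultimately show ?case by (simp add: frechet_derivative_eq)
qed simp

lemma partials_diff:
  assumes "open U" "smooth_on U f" "smooth_on U g" "set bs \<subseteq> Basis" "x \<in> U"
  shows "partials bs (\<lambda>x. f x - g x) x = partials bs f x - partials bs g x"
  using partials_add[OF assms(1,2) smooth_on_bounded_linear[OF assms(1)
        bounded_linear_minus[OF bounded_linear_ident] assms(3)] assms(4,5)]
    partials_bounded_linear[OF bounded_linear_minus[OF bounded_linear_ident] assms(1,3-5)]
  by simp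

lemma smooth_on_diff:
  assumes "open U" "smooth_on U f" "smooth_on U g"
  shows "smooth_on U (\<lambda>x. f x - g x)"
  using smooth_on_add[OF assms(1,2) smooth_on_bounded_linear[OF assms(1)
        bounded_linear_minus[OF bounded_linear_ident] assms(3)]] by simp

lemma partials_sum:
  assumes "open U" "\<And>c. c \<in> A \<Longrightarrow> smooth_on U (f c)" "set bs \<subseteq> Basis" "x \<in> U"
  shows "partials bs (\<lambda>x. \<Sum>c\<in>A. f c x) x = (\<Sum>c\<in>A. partials bs (f c) x)"
  using assms(2)
proof (induct A rule: infinite_finite_induct)
  case (insert c A)
  then show ?case
    using partials_add[OF assms(1) _ smooth_on_sum[OF assms(1)] assms(3,4), of "f c" A f] by auto
qed (simp_all add: partials_zero)

section \<open>The leading term of higher derivatives of compositions\<close>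

context scale
begin

lemma tame_smoothI:
  assumes "\<forall>\<^sub>F i in F. smooth_on U (f i)"
    and "\<And>bs. set bs \<subseteq> Basis \<Longrightarrow> length bs \<le> k \<Longrightarrow> mod_bdd K (\<lambda>i. partials bs (f i))"
  shows "tame U K k f"
  unfolding tame_def
proof (intro allI impI conjI)
  fix bs :: "'a list" assume bs: "set bs \<subseteq> Basis \<and> length bs \<le> k"
  show "\<forall>\<^sub>F i in F. \<forall>x\<in>U. partials bs (f i) differentiable at x"
    using assms(1) by eventually_elim (use bs in \<open>simp add: smooth_on_def\<close>)
qed (use assms(2) in blast)

text \<open>By the Leibniz rule every term of \<open>\<partial>\<^sup>\<alpha> h(f, g)\<close> other than \<open>h(f, \<partial>\<^sup>\<alpha> g)\<close> contains
  only derivatives of \<open>g\<close> of lower order.\<close>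

lemma partials_bilinear_remainder:
  assumes "open U" "K \<subseteq> U" "bounded_bilinear h" "set bs \<subseteq> Basis"
    and "\<forall>\<^sub>F i in F. smooth_on U (f i)" "\<forall>\<^sub>F i in F. smooth_on U (g i)"
    and "tame U K (length bs) f"
    and "\<And>cs. set cs \<subseteq> Basis \<Longrightarrow> length cs < length bs \<Longrightarrow> mod_bdd K (\<lambda>i. partials cs (g i))"
  shows "mod_bdd K (\<lambda>i x. partials bs (\<lambda>x. h (f i x) (g i x)) x - h (f i x) (partials bs (g i) x))"
  using assms(4-)
proof (induct bs arbitrary: f g rule: rev_induct)
  case Nil
  then show ?case by (simp add: mod_bdd_const)
next
  case (snoc b bs)
  have b: "b \<in> Basis" "set bs \<subseteq> Basis" using snoc.prems(1) by auto
  let ?f' = "\<lambda>i. partials [b] (f i)" and ?g' = "\<lambda>i. partials [b] (g i)"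
  have sm: "\<forall>\<^sub>F i in F. smooth_on U (?f' i)" "\<forall>\<^sub>F i in F. smooth_on U (?g' i)"
    using smooth_on_partials[of U _ "[b]"] b(1)
    by (auto intro: eventually_mono[OF snoc.prems(2)] eventually_mono[OF snoc.prems(3)] simp del: partials.simps)
  have 1: "mod_bdd K (\<lambda>i x. partials bs (\<lambda>x. h (f i x) (?g' i x)) x - h (f i x) (partials bs (?g' i) x))"
  proof (rule snoc.hyps[OF b(2) snoc.prems(2) sm(2)])
    show "tame U K (length bs) f" using snoc.prems(4) by (simp add: tame_SucD)
    show "mod_bdd K (\<lambda>i. partials cs (?g' i))" if "set cs \<subseteq> Basis" "length cs < length bs" for cs
      using snoc.prems(5)[of "cs @ [b]"] that b unfolding partials_append by simp
  qed
  have "tame U K (length bs) (\<lambda>i x. h (?f' i x) (g i x))"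
  proof (rule tame_bilinear[OF assms(1-3)])
    show "tame U K (length bs) ?f'" by (rule tame_partial) (use snoc.prems(4) b in auto)
    show "tame U K (length bs) g" by (rule tame_smoothI) (use snoc.prems(3,5) in auto)
  qed
  then have 2: "mod_bdd K (\<lambda>i. partials bs (\<lambda>x. h (?f' i x) (g i x)))"
    by (rule tame_mod_bdd) (use b in auto)
  show ?case
  proof (rule mod_bdd_cong[OF mod_bdd_add[OF 1 2]])
    show "\<forall>\<^sub>F i in F. \<forall>x\<in>K. partials (bs @ [b]) (\<lambda>x. h (f i x) (g i x)) x -
        h (f i x) (partials (bs @ [b]) (g i) x) =
        partials bs (\<lambda>x. h (f i x) (?g' i x)) x - h (f i x) (partials bs (?g' i) x) +
        partials bs (\<lambda>x. h (?f' i x) (g i x)) x"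
      using snoc.prems(2,3) sm
    proof eventually_elim
      case (elim i)
      show ?case
      proof
        fix x assume x: "x \<in> K"
        have "partials (bs @ [b]) (\<lambda>x. h (f i x) (g i x)) x
            = partials bs (\<lambda>x. h (f i x) (?g' i x) + h (?f' i x) (g i x)) x"
          unfolding partials_append
        proof (rule partials_cong_open[OF assms(1)])
          show "x \<in> U" using x assms(2) by blast
          show "partials [b] (\<lambda>x. h (f i x) (g i x)) y = h (f i y) (?g' i y) + h (?f' i y) (g i y)"
            if "y \<in> U" for y
            by (rule partial_bilinear[OF assms(3)]) (use elim that smooth_on_differentiable in blast)+
        qed
        also have "\<dots> = partials bs (\<lambda>x. h (f i x) (?g' i x)) x + partials bs (\<lambda>x. h (?f' i x) (g i x)) x"
          by (rule partials_add[OF assms(1)])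
             (use elim x b assms(2) in \<open>auto intro!: smooth_on_bilinear[OF assms(1,3)] simp del: partials.simps\<close>)
        finally show "partials (bs @ [b]) (\<lambda>x. h (f i x) (g i x)) x -
            h (f i x) (partials (bs @ [b]) (g i) x) =
            partials bs (\<lambda>x. h (f i x) (?g' i x)) x - h (f i x) (partials bs (?g' i) x) +
            partials bs (\<lambda>x. h (?f' i x) (g i x)) x"
          by (simp add: partials_append)
      qed
    qed
  qed
qed

text \<open>The chain rule analogue: the derivatives of \<open>p\<close> of top order enter
  \<open>\<partial>\<^sup>\<alpha>(v \<circ> p)\<close> only through \<open>Dv(p)(\<partial>\<^sup>\<alpha> p)\<close>. This makes it
  possible to bound derivatives by induction on their order.\<close>

lemma partials_compose_remainder:
  fixes p :: "'i \<Rightarrow> 'a::euclidean_space \<Rightarrow> 'b::euclidean_space"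
    and v :: "'i \<Rightarrow> 'b \<Rightarrow> 'c::real_normed_vector"
  assumes "open U" "K \<subseteq> U" "open V" "set bs \<subseteq> Basis" "bs \<noteq> []"
    and "\<forall>\<^sub>F i in F. smooth_on V (v i)" "\<forall>\<^sub>F i in F. smooth_on U (p i)"
    and "tame V L (length bs) v"
    and "\<And>cs. set cs \<subseteq> Basis \<Longrightarrow> length cs < length bs \<Longrightarrow> mod_bdd K (\<lambda>i. partials cs (p i))"
    and "\<forall>\<^sub>F i in F. p i ` U \<subseteq> V" "\<forall>\<^sub>F i in F. p i ` K \<subseteq> L"
  shows "mod_bdd K (\<lambda>i x. partials bs (\<lambda>x. v i (p i x)) x
      - frechet_derivative (v i) (at (p i x)) (partials bs (p i) x))"
proof -
  obtain cs b where bs: "bs = cs @ [b]" using assms(5) by (cases bs rule: rev_cases) auto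
  have b: "b \<in> Basis" "set cs \<subseteq> Basis" using assms(4) bs by auto
  let ?h = "\<lambda>(y::'c) (r::real). r *\<^sub>R y"
  have h: "bounded_bilinear ?h" by (rule bounded_bilinear.flip[OF bounded_bilinear_scaleR])
  let ?f = "\<lambda>c i x. partials [c] (v i) (p i x)" and ?g = "\<lambda>c i x. partials [b] (p i) x \<bullet> c"
  have smf: "\<forall>\<^sub>F i in F. smooth_on U (?f c i)" if "c \<in> Basis" for c
    using assms(6,7,10)
    by eventually_elim
      (use that in \<open>auto intro!: smooth_on_compose[OF assms(1,3)] smooth_on_partials simp del: partials.simps\<close>)
  have smg: "\<forall>\<^sub>F i in F. smooth_on U (?g c i)" for c
    using assms(7)
    by eventually_elim
      (use b in \<open>auto intro!: smooth_on_bounded_linear[OF assms(1) bounded_linear_inner_left]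
          smooth_on_partials simp del: partials.simps\<close>)
  have gpart: "partials ds (?g c i) x = partials (ds @ [b]) (p i) x \<bullet> c"
    if "smooth_on U (p i)" "set ds \<subseteq> Basis" "x \<in> U" for ds c i x
    unfolding partials_append
    by (rule partials_bounded_linear[OF bounded_linear_inner_left assms(1)])
       (use that b in \<open>auto intro!: smooth_on_partials simp del: partials.simps\<close>)
  have tp: "tame U K (length cs) p"
    by (rule tame_smoothI[OF assms(7)]) (use assms(9) bs in auto)
  have "mod_bdd K (\<lambda>i x. partials cs (\<lambda>x. ?h (?f c i x) (?g c i x)) x - ?h (?f c i x) (partials cs (?g c i) x))"
    if c: "c \<in> Basis" for c
  proof (rule partials_bilinear_remainder[OF assms(1,2) h b(2) smf[OF c] smg])
    have "tame V L (length cs) (\<lambda>i. partials [c] (v i))"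
      by (rule tame_partial) (use assms(8) bs c in auto)
    then show "tame U K (length cs) (?f c)"
      by (rule tame_compose[OF assms(1-3) _ tp assms(10,11)])
    show "mod_bdd K (\<lambda>i. partials ds (?g c i))" if ds: "set ds \<subseteq> Basis" "length ds < length cs" for ds
    proof (rule mod_bdd_cong)
      show "mod_bdd K (\<lambda>i x. partials (ds @ [b]) (p i) x \<bullet> c)"
        by (rule mod_bdd_linear[OF bounded_linear_inner_left assms(9)]) (use ds b bs in auto)
      show "\<forall>\<^sub>F i in F. \<forall>x\<in>K. partials ds (?g c i) x = partials (ds @ [b]) (p i) x \<bullet> c"
        using assms(7) by eventually_elim (use gpart ds assms(2) in blast)
    qed
  qed
  then have rem: "mod_bdd K (\<lambda>i x. \<Sum>c\<in>Basis. partials cs (\<lambda>x. ?h (?f c i x) (?g c i x)) x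
      - ?h (?f c i x) (partials cs (?g c i) x))"
    by (rule mod_bdd_sum)
  have "\<forall>\<^sub>F i in F. \<forall>c\<in>Basis. smooth_on U (?f c i) \<and> smooth_on U (?g c i)"
    using smf smg by (simp add: eventually_ball_finite_distrib eventually_conj del: partials.simps)
  with assms(6,7,10) have "\<forall>\<^sub>F i in F. \<forall>x\<in>K. partials bs (\<lambda>x. v i (p i x)) x
      - frechet_derivative (v i) (at (p i x)) (partials bs (p i) x)
      = (\<Sum>c\<in>Basis. partials cs (\<lambda>x. ?h (?f c i x) (?g c i x)) x
        - ?h (?f c i x) (partials cs (?g c i) x))"
  proof eventually_elim
    case (elim i)
    show ?case
    proof
      fix x assume "x \<in> K"
      then have x: "x \<in> U" using assms(2) by blast
      have "partials bs (\<lambda>x. v i (p i x)) x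
          = partials cs (\<lambda>x. \<Sum>c\<in>Basis. ?h (?f c i x) (?g c i x)) x"
        unfolding bs partials_append
      proof (rule partials_cong_open[OF assms(1) _ x])
        fix y assume "y \<in> U"
        then have "p i differentiable at y" "v i differentiable at (p i y)"
          using elim(1-3) by (auto intro: smooth_on_differentiable)
        then show "partials [b] (\<lambda>x. v i (p i x)) y = (\<Sum>c\<in>Basis. ?h (?f c i y) (?g c i y))"
          using partial_compose frechet_derivative_expand by metis
      qed
      also have "\<dots> = (\<Sum>c\<in>Basis. partials cs (\<lambda>x. ?h (?f c i x) (?g c i x)) x)"
        by (rule partials_sum[OF assms(1) _ b(2) x])
           (use elim(4) in \<open>auto intro!: smooth_on_bilinear[OF assms(1) h] simp del: partials.simps\<close>)
      finally have 1: "partials bs (\<lambda>x. v i (p i x)) x = \<dots>" .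
      have "v i differentiable at (p i x)"
        using elim(1,3) x by (auto intro: smooth_on_differentiable)
      then have "frechet_derivative (v i) (at (p i x)) (partials bs (p i) x)
          = (\<Sum>c\<in>Basis. ?h (?f c i x) (partials cs (?g c i) x))"
        unfolding gpart[OF elim(2) b(2) x] bs[symmetric] by (rule frechet_derivative_expand)
      then show "partials bs (\<lambda>x. v i (p i x)) x
          - frechet_derivative (v i) (at (p i x)) (partials bs (p i) x)
          = (\<Sum>c\<in>Basis. partials cs (\<lambda>x. ?h (?f c i x) (?g c i x)) x
            - ?h (?f c i x) (partials cs (?g c i) x))"
        unfolding 1 by (simp add: sum_subtractf del: partials.simps)
    qed
  qed
  then show ?thesis by (rule mod_bdd_cong[OF rem])
qed

end

section \<open>Moderate and negligible nets\<close>

lemma compactly_contained_open: "open U \<Longrightarrow> K \<subset>\<subset> U \<longleftrightarrow> compact K \<and> K \<subseteq> U"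
  by (simp add: compactly_contained_def interior_open)

lemma eventually_small_iff:
  "(\<forall>\<^sub>F \<epsilon> in at_right (0::real). P \<epsilon>) \<longleftrightarrow> (\<exists>\<epsilon>0\<in>{0<..1}. \<forall>\<epsilon>\<in>{0<..\<epsilon>0}. P \<epsilon>)"
proof
  assume "\<forall>\<^sub>F \<epsilon> in at_right (0::real). P \<epsilon>"
  then obtain b where "b > 0" "\<forall>y>0. y < b \<longrightarrow> P y"
    unfolding eventually_at_right_field by auto
  then show "\<exists>\<epsilon>0\<in>{0<..1}. \<forall>\<epsilon>\<in>{0<..\<epsilon>0}. P \<epsilon>"
    by (intro bexI[of _ "min (b/2) 1"]) auto
next
  assume "\<exists>\<epsilon>0\<in>{0<..1}. \<forall>\<epsilon>\<in>{0<..\<epsilon>0}. P \<epsilon>"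
  then show "\<forall>\<^sub>F \<epsilon> in at_right (0::real). P \<epsilon>"
    unfolding eventually_at_right_field by (metis greaterThanAtMost_iff less_eq_real_def)
qed

lemma eventually_le_small: "c > 0 \<Longrightarrow> \<forall>\<^sub>F \<epsilon> in at_right (0::real). 0 < \<epsilon> \<and> \<epsilon> \<le> c"
  unfolding eventually_at_right_field by (intro exI[of _ c]) auto

lemma eventually_unit: "\<forall>\<^sub>F \<epsilon> in at_right (0::real). 0 < \<epsilon> \<and> \<epsilon> \<le> 1"
  by (rule eventually_le_small) simp

interpretation ep: scale "at_right 0" "\<lambda>\<epsilon>::real. inverse \<epsilon>"
proof
  show "\<forall>\<^sub>F \<epsilon> in at_right 0. 2 \<le> inverse (\<epsilon>::real)"
    using eventually_le_small[of "1/2"]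
    by (auto elim!: eventually_mono simp: field_simps)
qed

text \<open>Constants are absorbed by raising the power.\<close>

lemma sup_bigo_inverse_iff:
  "(\<exists>N::nat. sup_bigo K f (\<lambda>\<epsilon>. inverse (\<epsilon> ^ N))) \<longleftrightarrow> ep.mod_bdd K f"
proof
  assume "\<exists>N::nat. sup_bigo K f (\<lambda>\<epsilon>. inverse (\<epsilon> ^ N))"
  then obtain N :: nat and C where
    "\<forall>\<^sub>F \<epsilon> in at_right 0. \<forall>x\<in>K. norm (f \<epsilon> x) \<le> C * \<bar>inverse (\<epsilon> ^ N)\<bar>"
    unfolding sup_bigo_def by blast
  then have "\<forall>\<^sub>F \<epsilon> in at_right 0. \<forall>x\<in>K. norm (f \<epsilon> x) \<le> C * inverse \<epsilon> ^ N"
    using eventually_unit by eventually_elim (simp_all add: power_inverse)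
  then show "ep.mod_bdd K f" by (rule ep.mod_bddI)
next
  assume "ep.mod_bdd K f"
  then obtain N where "\<forall>\<^sub>F \<epsilon> in at_right 0. \<forall>x\<in>K. norm (f \<epsilon> x) \<le> inverse \<epsilon> ^ N"
    by (rule ep.mod_bddE)
  then have "\<forall>\<^sub>F \<epsilon> in at_right 0. \<forall>x\<in>K. norm (f \<epsilon> x) \<le> 1 * \<bar>inverse (\<epsilon> ^ N)\<bar>"
    using eventually_unit by eventually_elim (simp_all add: power_inverse)
  then show "\<exists>N::nat. sup_bigo K f (\<lambda>\<epsilon>. inverse (\<epsilon> ^ N))"
    unfolding sup_bigo_def by blast
qed

text \<open>The estimate defining negligible nets, for values only and on an arbitrary index set; a one-point
  set gives generalized points.\<close>

definition negl :: "'a set \<Rightarrow> ('a, 'b::real_normed_vector) net \<Rightarrow> bool" where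
  "negl K f \<longleftrightarrow> (\<forall>m::nat. \<forall>\<^sub>F \<epsilon> in at_right 0. \<forall>x\<in>K. norm (f \<epsilon> x) \<le> \<epsilon> ^ m)"

lemma neglI:
  assumes "\<And>m::nat. \<exists>C. \<forall>\<^sub>F \<epsilon> in at_right 0. \<forall>x\<in>K. norm (f \<epsilon> x) \<le> C * \<epsilon> ^ m"
  shows "negl K f"
  unfolding negl_def
proof
  fix m :: nat
  obtain C where C: "\<forall>\<^sub>F \<epsilon> in at_right 0. \<forall>x\<in>K. norm (f \<epsilon> x) \<le> C * \<epsilon> ^ Suc m"
    using assms by blast
  have "\<forall>\<^sub>F \<epsilon> in at_right 0. 0 < \<epsilon> \<and> \<epsilon> \<le> inverse (1 + \<bar>C\<bar>)"
    by (rule eventually_le_small) (simp add: add_pos_nonneg)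
  with C show "\<forall>\<^sub>F \<epsilon> in at_right 0. \<forall>x\<in>K. norm (f \<epsilon> x) \<le> \<epsilon> ^ m"
  proof eventually_elim
    case (elim \<epsilon>)
    have "C * \<epsilon> \<le> 1"
    proof -
      have "C * \<epsilon> \<le> (1 + \<bar>C\<bar>) * \<epsilon>" using elim by (intro mult_right_mono) auto
      also have "\<dots> \<le> (1 + \<bar>C\<bar>) * inverse (1 + \<bar>C\<bar>)" using elim by (intro mult_left_mono) auto
      finally show ?thesis by (simp add: add_pos_nonneg)
    qed
    then have "C * \<epsilon> * \<epsilon> ^ m \<le> 1 * \<epsilon> ^ m" using elim by (intro mult_right_mono) auto
    then have "C * \<epsilon> ^ Suc m \<le> \<epsilon> ^ m" by (simp add: mult.assoc)
    then show ?case using elim(1) order_trans by blast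
  qed
qed

lemma sup_bigo_power_iff: "(\<forall>m::nat. sup_bigo K f (\<lambda>\<epsilon>. \<epsilon> ^ m)) \<longleftrightarrow> negl K f"
proof
  assume *: "\<forall>m::nat. sup_bigo K f (\<lambda>\<epsilon>. \<epsilon> ^ m)"
  show "negl K f"
  proof (rule neglI)
    fix m :: nat
    obtain C where "\<forall>\<^sub>F \<epsilon> in at_right 0. \<forall>x\<in>K. norm (f \<epsilon> x) \<le> C * \<bar>\<epsilon> ^ m\<bar>"
      using * unfolding sup_bigo_def by blast
    then have "\<forall>\<^sub>F \<epsilon> in at_right 0. \<forall>x\<in>K. norm (f \<epsilon> x) \<le> C * \<epsilon> ^ m"
      using eventually_unit by eventually_elim simp_all
    then show "\<exists>C. \<forall>\<^sub>F \<epsilon> in at_right 0. \<forall>x\<in>K. norm (f \<epsilon> x) \<le> C * \<epsilon> ^ m" by blast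
  qed
next
  assume *: "negl K f"
  show "\<forall>m::nat. sup_bigo K f (\<lambda>\<epsilon>. \<epsilon> ^ m)"
  proof
    fix m :: nat
    have "\<forall>\<^sub>F \<epsilon> in at_right 0. \<forall>x\<in>K. norm (f \<epsilon> x) \<le> \<epsilon> ^ m"
      using * by (simp add: negl_def)
    then have "\<forall>\<^sub>F \<epsilon> in at_right 0. \<forall>x\<in>K. norm (f \<epsilon> x) \<le> 1 * \<bar>\<epsilon> ^ m\<bar>"
      using eventually_unit by eventually_elim simp_all
    then show "sup_bigo K f (\<lambda>\<epsilon>. \<epsilon> ^ m)" unfolding sup_bigo_def by blast
  qed
qed

lemma negl_mono:
  assumes "negl K g" "\<forall>\<^sub>F \<epsilon> in at_right 0. \<forall>x\<in>K'. \<exists>y\<in>K. norm (f \<epsilon> x) \<le> norm (g \<epsilon> y)"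
  shows "negl K' f"
  unfolding negl_def
proof
  fix m :: nat
  have "\<forall>\<^sub>F \<epsilon> in at_right 0. \<forall>x\<in>K. norm (g \<epsilon> x) \<le> \<epsilon> ^ m"
    using assms(1) by (simp add: negl_def)
  with assms(2) show "\<forall>\<^sub>F \<epsilon> in at_right 0. \<forall>x\<in>K'. norm (f \<epsilon> x) \<le> \<epsilon> ^ m"
    by eventually_elim force
qed

lemma negl_mono_pointwise:
  assumes "negl K g" "\<forall>\<^sub>F \<epsilon> in at_right 0. \<forall>x\<in>K. norm (f \<epsilon> x) \<le> norm (g \<epsilon> x)"
  shows "negl K f"
  by (rule negl_mono[OF assms(1)]) (rule eventually_mono[OF assms(2)], blast)

lemma negl_cong:
  assumes "negl K g" "\<forall>\<^sub>F \<epsilon> in at_right 0. \<forall>x\<in>K. f \<epsilon> x = g \<epsilon> x"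
  shows "negl K f"
  by (rule negl_mono_pointwise[OF assms(1)]) (rule eventually_mono[OF assms(2)], simp)

lemma negl_subset: "negl K f \<Longrightarrow> K' \<subseteq> K \<Longrightarrow> negl K' f"
  by (rule negl_mono[of K f K' f]) (auto intro: always_eventually)

lemma negl_zero: "negl K (\<lambda>\<epsilon> x. 0)"
  by (rule neglI) (auto intro!: exI[of _ 0])

lemma negl_add:
  assumes "negl K f" "negl K g"
  shows "negl K (\<lambda>\<epsilon> x. f \<epsilon> x + g \<epsilon> x)"
proof (rule neglI)
  fix m :: nat
  have "\<forall>\<^sub>F \<epsilon> in at_right 0. \<forall>x\<in>K. norm (f \<epsilon> x) \<le> \<epsilon> ^ m" "\<forall>\<^sub>F \<epsilon> in at_right 0. \<forall>x\<in>K. norm (g \<epsilon> x) \<le> \<epsilon> ^ m"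
    using assms by (simp_all add: negl_def)
  then have "\<forall>\<^sub>F \<epsilon> in at_right 0. \<forall>x\<in>K. norm (f \<epsilon> x + g \<epsilon> x) \<le> 2 * \<epsilon> ^ m"
  proof eventually_elim
    case (elim \<epsilon>)
    show ?case
    proof
      fix x assume "x \<in> K"
      with elim show "norm (f \<epsilon> x + g \<epsilon> x) \<le> 2 * \<epsilon> ^ m"
        using norm_triangle_ineq[of "f \<epsilon> x" "g \<epsilon> x"] by fastforce
    qed
  qed
  then show "\<exists>C. \<forall>\<^sub>F \<epsilon> in at_right 0. \<forall>x\<in>K. norm (f \<epsilon> x + g \<epsilon> x) \<le> C * \<epsilon> ^ m" by blast
qed

lemma negl_sum:
  assumes "\<And>c. c \<in> A \<Longrightarrow> negl K (f c)"
  shows "negl K (\<lambda>\<epsilon> x. \<Sum>c\<in>A. f c \<epsilon> x)"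
  using assms
  by (induct A rule: infinite_finite_induct) (auto intro: negl_add negl_zero)

lemma negl_minus: "negl K f \<Longrightarrow> negl K (\<lambda>\<epsilon> x. - f \<epsilon> x)"
  by (simp add: negl_def)

lemma negl_diff: "negl K f \<Longrightarrow> negl K g \<Longrightarrow> negl K (\<lambda>\<epsilon> x. f \<epsilon> x - g \<epsilon> x)"
  using negl_add[OF _ negl_minus, of K f g] by simp

lemma negl_norm: "negl K (\<lambda>\<epsilon> x. norm (f \<epsilon> x)) \<longleftrightarrow> negl K f"
  by (simp add: negl_def)

lemma negl_bilinear:
  assumes "bounded_bilinear h" "negl K f" "ep.mod_bdd K g"
  shows "negl K (\<lambda>\<epsilon> x. h (f \<epsilon> x) (g \<epsilon> x))"
proof (rule neglI)
  fix m :: nat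
  obtain C where C: "C \<ge> 0" "\<And>a b. norm (h a b) \<le> norm a * norm b * C"
    using bounded_bilinear.nonneg_bounded[OF assms(1)] by blast
  obtain M where M: "\<forall>\<^sub>F \<epsilon> in at_right 0. \<forall>x\<in>K. norm (g \<epsilon> x) \<le> inverse \<epsilon> ^ M"
    using assms(3) by (rule ep.mod_bddE)
  have "\<forall>\<^sub>F \<epsilon> in at_right 0. \<forall>x\<in>K. norm (f \<epsilon> x) \<le> \<epsilon> ^ (m + M)"
    using assms(2) by (simp add: negl_def)
  with M have "\<forall>\<^sub>F \<epsilon> in at_right 0. \<forall>x\<in>K. norm (h (f \<epsilon> x) (g \<epsilon> x)) \<le> C * \<epsilon> ^ m"
    using eventually_unit
  proof eventually_elim
    case (elim \<epsilon>)
    show ?case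
    proof
      fix x assume x: "x \<in> K"
      have "norm (f \<epsilon> x) * norm (g \<epsilon> x) \<le> \<epsilon> ^ (m + M) * inverse \<epsilon> ^ M"
        using elim x by (intro mult_mono) auto
      also have "\<dots> = \<epsilon> ^ m" using elim by (simp add: power_add power_inverse)
      finally have "norm (f \<epsilon> x) * norm (g \<epsilon> x) * C \<le> \<epsilon> ^ m * C"
        using C(1) by (rule mult_right_mono)
      then show "norm (h (f \<epsilon> x) (g \<epsilon> x)) \<le> C * \<epsilon> ^ m"
        using C(2)[of "f \<epsilon> x" "g \<epsilon> x"] by (simp add: mult_ac)
    qed
  qed
  then show "\<exists>C. \<forall>\<^sub>F \<epsilon> in at_right 0. \<forall>x\<in>K. norm (h (f \<epsilon> x) (g \<epsilon> x)) \<le> C * \<epsilon> ^ m" by blast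
qed

lemma negl_linear:
  assumes "bounded_linear h" "negl K f"
  shows "negl K (\<lambda>\<epsilon> x. h (f \<epsilon> x))"
proof (rule neglI)
  fix m :: nat
  obtain C where C: "C > 0" "\<And>a. norm (h a) \<le> norm a * C"
    using bounded_linear.pos_bounded[OF assms(1)] by blast
  have "\<forall>\<^sub>F \<epsilon> in at_right 0. \<forall>x\<in>K. norm (f \<epsilon> x) \<le> \<epsilon> ^ m"
    using assms(2) by (simp add: negl_def)
  then have "\<forall>\<^sub>F \<epsilon> in at_right 0. \<forall>x\<in>K. norm (h (f \<epsilon> x)) \<le> C * \<epsilon> ^ m"
  proof eventually_elim
    case (elim \<epsilon>)
    show ?case
    proof
      fix x assume "x \<in> K"
      with elim have "norm (f \<epsilon> x) * C \<le> \<epsilon> ^ m * C"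
        using C(1) by (intro mult_right_mono) auto
      then show "norm (h (f \<epsilon> x)) \<le> C * \<epsilon> ^ m"
        using C(2)[of "f \<epsilon> x"] by (simp add: mult.commute)
    qed
  qed
  then show "\<exists>C. \<forall>\<^sub>F \<epsilon> in at_right 0. \<forall>x\<in>K. norm (h (f \<epsilon> x)) \<le> C * \<epsilon> ^ m" by blast
qed

lemma negl_compose:
  assumes "negl L v" "\<forall>\<^sub>F \<epsilon> in at_right 0. p \<epsilon> ` K \<subseteq> L"
  shows "negl K (\<lambda>\<epsilon> x. v \<epsilon> (p \<epsilon> x))"
  by (rule negl_mono[OF assms(1)]) (rule eventually_mono[OF assms(2)], blast)

lemma smooth_nets_eventually: "u \<in> smooth_nets U \<Longrightarrow> \<forall>\<^sub>F \<epsilon> in at_right 0. smooth_on U (u \<epsilon>)"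
  using eventually_unit by eventually_elim (simp add: smooth_nets_def)

lemma moderate_nets_mod_bdd:
  "u \<in> moderate_nets U \<longleftrightarrow> u \<in> smooth_nets U \<and>
     (\<forall>K bs. K \<subset>\<subset> U \<longrightarrow> set bs \<subseteq> Basis \<longrightarrow> ep.mod_bdd K (\<lambda>\<epsilon>. partials bs (u \<epsilon>)))"
  unfolding moderate_nets_def sup_bigo_inverse_iff by blast

lemma negligible_nets_negl:
  "u \<in> negligible_nets U \<longleftrightarrow> u \<in> smooth_nets U \<and>
     (\<forall>K bs. K \<subset>\<subset> U \<longrightarrow> set bs \<subseteq> Basis \<longrightarrow> negl K (\<lambda>\<epsilon>. partials bs (u \<epsilon>)))"
  unfolding negligible_nets_def sup_bigo_power_iff by blast

lemma moderate_nets_tame: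
  "u \<in> moderate_nets U \<longleftrightarrow> u \<in> smooth_nets U \<and> (\<forall>K k. K \<subset>\<subset> U \<longrightarrow> ep.tame U K k u)"
proof (intro iffI conjI allI impI)
  assume u: "u \<in> moderate_nets U"
  then show "u \<in> smooth_nets U" by (simp add: moderate_nets_mod_bdd)
  then have sm: "\<forall>\<^sub>F \<epsilon> in at_right 0. smooth_on U (u \<epsilon>)" by (rule smooth_nets_eventually)
  show "ep.tame U K k u" if "K \<subset>\<subset> U" for K k
    using u that by (intro ep.tame_smoothI[OF sm]) (simp add: moderate_nets_mod_bdd)
next
  assume *: "u \<in> smooth_nets U \<and> (\<forall>K k. K \<subset>\<subset> U \<longrightarrow> ep.tame U K k u)"
  show "u \<in> moderate_nets U"
    unfolding moderate_nets_mod_bdd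
  proof (intro conjI allI impI)
    fix K :: "'a set" and bs :: "'a list"
    assume "K \<subset>\<subset> U" "set bs \<subseteq> Basis"
    then show "ep.mod_bdd K (\<lambda>\<epsilon>. partials bs (u \<epsilon>))"
      using ep.tame_mod_bdd[of U K "length bs" u bs] * by simp
  qed (use * in blast)
qed

lemma moderate_nets_smooth: "u \<in> moderate_nets U \<Longrightarrow> u \<in> smooth_nets U"
  by (simp add: moderate_nets_def)

lemma moderate_mod_bdd: "u \<in> moderate_nets U \<Longrightarrow> K \<subset>\<subset> U \<Longrightarrow> ep.mod_bdd K u"
  unfolding moderate_nets_mod_bdd by (drule conjunct2, elim allE[of _ K] allE[of _ "[]"]) simp

lemma moderate_partial_mod_bdd:
  "u \<in> moderate_nets U \<Longrightarrow> K \<subset>\<subset> U \<Longrightarrow> set bs \<subseteq> Basis \<Longrightarrow> ep.mod_bdd K (\<lambda>\<epsilon>. partials bs (u \<epsilon>))"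
  by (simp add: moderate_nets_mod_bdd)

lemma moderate_nets_partials:
  assumes "u \<in> moderate_nets U" "set bs \<subseteq> Basis"
  shows "(\<lambda>\<epsilon>. partials bs (u \<epsilon>)) \<in> moderate_nets U"
  unfolding moderate_nets_mod_bdd
proof (intro conjI allI impI)
  show "(\<lambda>\<epsilon>. partials bs (u \<epsilon>)) \<in> smooth_nets U"
    using assms by (auto simp: moderate_nets_def smooth_nets_def intro: smooth_on_partials)
  show "ep.mod_bdd K (\<lambda>\<epsilon>. partials cs (partials bs (u \<epsilon>)))"
    if "K \<subset>\<subset> U" "set cs \<subseteq> Basis" for K cs
    unfolding partials_append[symmetric]
    by (rule moderate_partial_mod_bdd[OF assms(1)]) (use that assms in auto)
qed

lemma eventually_moderate_differentiable:
  "u \<in> moderate_nets U \<Longrightarrow> \<forall>\<^sub>F \<epsilon> in at_right 0. \<forall>x\<in>U. u \<epsilon> differentiable at x"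
  using smooth_nets_eventually[OF moderate_nets_smooth]
  by (rule eventually_mono) (auto simp: smooth_on_differentiable)

context
  fixes U :: "'a::euclidean_space set"
  assumes U: "open U"
begin

lemma moderate_nets_cong:
  assumes "\<And>\<epsilon> x. \<epsilon> \<in> {0<..1} \<Longrightarrow> x \<in> U \<Longrightarrow> f \<epsilon> x = g \<epsilon> x" "g \<in> moderate_nets U"
  shows "f \<in> moderate_nets U"
  unfolding moderate_nets_tame
proof (intro conjI allI impI)
  show "f \<in> smooth_nets U"
    unfolding smooth_nets_def
  proof (standard, standard)
    fix \<epsilon> :: real assume "\<epsilon> \<in> {0<..1}"
    then show "smooth_on U (f \<epsilon>)"
      using assms by (intro smooth_on_cong[OF U, of "f \<epsilon>" "g \<epsilon>"])
        (auto simp: moderate_nets_def smooth_nets_def)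
  qed
  fix K :: "'a set" and k assume K: "K \<subset>\<subset> U"
  have "\<forall>\<^sub>F \<epsilon> in at_right 0. \<forall>x\<in>U. f \<epsilon> x = g \<epsilon> x"
    using eventually_unit by eventually_elim (simp add: assms(1))
  moreover have "K \<subseteq> U" using K by (simp add: compactly_contained_open[OF U])
  moreover have "ep.tame U K k g" using K assms(2) by (simp add: moderate_nets_tame)
  ultimately show "ep.tame U K k f" using ep.tame_cong[OF U] by blast
qed

lemma moderate_nets_bounded_linear:
  assumes "bounded_linear h" "u \<in> moderate_nets U"
  shows "(\<lambda>\<epsilon> x. h (u \<epsilon> x)) \<in> moderate_nets U"
  using assms(2)
  by (auto simp: moderate_nets_tame smooth_nets_def compactly_contained_open[OF U]
      intro!: ep.tame_bounded_linear[OF U _ assms(1)] smooth_on_bounded_linear[OF U assms(1)])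

lemma moderate_nets_bilinear:
  assumes "bounded_bilinear h" "u \<in> moderate_nets U" "v \<in> moderate_nets U"
  shows "(\<lambda>\<epsilon> x. h (u \<epsilon> x) (v \<epsilon> x)) \<in> moderate_nets U"
  using assms(2,3)
  by (auto simp: moderate_nets_tame smooth_nets_def compactly_contained_open[OF U]
      intro!: ep.tame_bilinear[OF U _ assms(1)] smooth_on_bilinear[OF U assms(1)])

lemma moderate_nets_add:
  assumes "u \<in> moderate_nets U" "v \<in> moderate_nets U"
  shows "(\<lambda>\<epsilon> x. u \<epsilon> x + v \<epsilon> x) \<in> moderate_nets U"
  using assms
  by (auto simp: moderate_nets_tame smooth_nets_def compactly_contained_open[OF U]
      intro!: ep.tame_add[OF U] smooth_on_add[OF U])

lemma moderate_nets_diff: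
  assumes "u \<in> moderate_nets U" "v \<in> moderate_nets U"
  shows "(\<lambda>\<epsilon> x. u \<epsilon> x - v \<epsilon> x) \<in> moderate_nets U"
  using moderate_nets_add[OF assms(1)
      moderate_nets_bounded_linear[OF bounded_linear_minus[OF bounded_linear_ident] assms(2)]]
  by simp

lemma moderate_nets_const: "(\<lambda>\<epsilon> x. c) \<in> moderate_nets U"
  by (auto simp: moderate_nets_tame smooth_nets_def
      intro!: ep.tame_const ep.mod_bdd_const smooth_on_const)

lemma moderate_nets_id: "(\<lambda>\<epsilon> x. x) \<in> moderate_nets U"
  by (auto simp: moderate_nets_tame smooth_nets_def compactly_contained_open[OF U]
      intro!: ep.tame_id smooth_on_id compact_imp_bounded)

lemma moderate_nets_sum:
  assumes "\<And>c. c \<in> A \<Longrightarrow> u c \<in> moderate_nets U"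
  shows "(\<lambda>\<epsilon> x. \<Sum>c\<in>A. u c \<epsilon> x) \<in> moderate_nets U"
  using assms
  by (induct A rule: infinite_finite_induct) (auto intro: moderate_nets_add moderate_nets_const)

lemma moderate_nets_Pair:
  assumes "u \<in> moderate_nets U" "v \<in> moderate_nets U"
  shows "(\<lambda>\<epsilon> x. (u \<epsilon> x, v \<epsilon> x)) \<in> moderate_nets U"
proof -
  have "bounded_linear (\<lambda>x. (x, 0))" "bounded_linear (\<lambda>x. (0, x))"
    by (auto intro!: bounded_linear_Pair bounded_linear_ident bounded_linear_zero)
  from moderate_nets_add[OF moderate_nets_bounded_linear[OF this(1) assms(1)]
      moderate_nets_bounded_linear[OF this(2) assms(2)]]
  show ?thesis by simp
qed

end

lemma compact_cball_sum:
  fixes K :: "'a::euclidean_space set"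
  assumes "compact K"
  shows "compact (\<Union>x\<in>K. cball x \<delta>)"
proof -
  have "(\<Union>x\<in>K. cball x \<delta>) = {x + y | x y. x \<in> K \<and> y \<in> cball 0 \<delta>}"
  proof (intro set_eqI iffI)
    fix z assume "z \<in> (\<Union>x\<in>K. cball x \<delta>)"
    then obtain x where "x \<in> K" "dist x z \<le> \<delta>" by auto
    then have "x \<in> K \<and> z - x \<in> cball 0 \<delta> \<and> z = x + (z - x)" by (simp add: dist_norm norm_minus_commute)
    then show "z \<in> {x + y | x y. x \<in> K \<and> y \<in> cball 0 \<delta>}" by blast
  next
    fix z assume "z \<in> {x + y | x y. x \<in> K \<and> y \<in> cball 0 \<delta>}"
    then obtain x y where "x \<in> K" "norm y \<le> \<delta>" "z = x + y" by auto
    then show "z \<in> (\<Union>x\<in>K. cball x \<delta>)" by (intro UN_I[of x]) (auto simp: dist_norm)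
  qed
  then show ?thesis using compact_sums[OF assms compact_cball[of 0 \<delta>]] by simp
qed

text \<open>The mean value inequality: the difference quotients are bounded by the partial derivatives on the
  \<open>\<delta>\<close>-neighbourhood of \<open>K\<close>, which is compact. Stating this as moderateness over pairs of points
  allows several such bounds to be added.\<close>

lemma moderate_lipschitz:
  fixes u :: "('a::euclidean_space, 'b::real_normed_vector) net"
  assumes "open U" "compact K" "(\<Union>x\<in>K. cball x \<delta>) \<subseteq> U" "u \<in> moderate_nets U"
  shows "ep.mod_bdd {(p, q). p \<in> K \<and> q \<in> cball p \<delta>}
           (\<lambda>\<epsilon> (p, q). norm (u \<epsilon> q - u \<epsilon> p) / norm (q - p))"
proof -
  let ?K = "\<Union>x\<in>K. cball x \<delta>"
  have K: "?K \<subset>\<subset> U"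
    using assms compact_cball_sum by (simp add: compactly_contained_open)
  have "ep.mod_bdd ?K (\<lambda>\<epsilon> x. \<Sum>b\<in>Basis. norm (partials [b] (u \<epsilon>) x))"
  proof (rule ep.mod_bdd_sum)
    fix b :: 'a assume "b \<in> Basis"
    then have "ep.mod_bdd ?K (\<lambda>\<epsilon>. partials [b] (u \<epsilon>))"
      by (intro moderate_partial_mod_bdd[OF assms(4) K]) auto
    then show "ep.mod_bdd ?K (\<lambda>\<epsilon> x. norm (partials [b] (u \<epsilon>) x))"
      by (rule ep.mod_bdd_mono) simp
  qed
  then obtain M where M: "\<forall>\<^sub>F \<epsilon> in at_right 0. \<forall>x\<in>?K.
      norm (\<Sum>b\<in>Basis. norm (partials [b] (u \<epsilon>) x)) \<le> inverse \<epsilon> ^ M"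
    by (rule ep.mod_bddE)
  have "\<forall>\<^sub>F \<epsilon> in at_right 0. \<forall>z\<in>{(p, q). p \<in> K \<and> q \<in> cball p \<delta>}.
      norm (case z of (p, q) \<Rightarrow> norm (u \<epsilon> q - u \<epsilon> p) / norm (q - p)) \<le> 1 * inverse \<epsilon> ^ M"
    using M eventually_moderate_differentiable[OF assms(4)] eventually_unit
  proof eventually_elim
    case (elim \<epsilon>)
    have "norm (u \<epsilon> q - u \<epsilon> p) / norm (q - p) \<le> inverse \<epsilon> ^ M" if pq: "p \<in> K" "q \<in> cball p \<delta>" for p q
    proof -
      have sub: "cball p \<delta> \<subseteq> ?K" using pq by blast
      have "norm (u \<epsilon> q - u \<epsilon> p) \<le> inverse \<epsilon> ^ M * norm (q - p)"
      proof (rule differentiable_bound[OF convex_cball])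
        fix x assume x: "x \<in> cball p \<delta>"
        then have d: "u \<epsilon> differentiable at x" using elim sub assms(3) by blast
        then show "(u \<epsilon> has_derivative frechet_derivative (u \<epsilon>) (at x)) (at x within cball p \<delta>)"
          by (auto simp: frechet_derivative_works intro: has_derivative_at_withinI)
        show "onorm (frechet_derivative (u \<epsilon>) (at x)) \<le> inverse \<epsilon> ^ M"
        proof (rule onorm_le)
          fix v
          have "norm (frechet_derivative (u \<epsilon>) (at x) v)
              \<le> (\<Sum>b\<in>Basis. norm (partials [b] (u \<epsilon>) x)) * norm v"
            by (rule norm_frechet_derivative_le[OF d])
          also have "\<dots> \<le> inverse \<epsilon> ^ M * norm v"
            using elim(1) x sub by (intro mult_right_mono) (auto simp: sum_nonneg)
          finally show "norm (frechet_derivative (u \<epsilon>) (at x) v) \<le> inverse \<epsilon> ^ M * norm v" .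
        qed
      qed (use pq in \<open>auto intro: order_trans[OF zero_le_dist]\<close>)
      then show ?thesis
        using elim(3) by (cases "q = p") (auto simp: divide_le_eq)
    qed
    then show ?case by auto
  qed
  then show ?thesis by (rule ep.mod_bddI)
qed

lemma moderate_lipschitzE:
  fixes u :: "('a::euclidean_space, 'b::real_normed_vector) net"
  assumes "open U" "compact K" "(\<Union>x\<in>K. cball x \<delta>) \<subseteq> U" "u \<in> moderate_nets U"
  obtains M where "\<forall>\<^sub>F \<epsilon> in at_right 0. \<forall>p\<in>K. \<forall>q\<in>cball p \<delta>.
      norm (u \<epsilon> q - u \<epsilon> p) \<le> inverse \<epsilon> ^ M * norm (q - p)"
proof -
  obtain M where M: "\<forall>\<^sub>F \<epsilon> in at_right 0. \<forall>z\<in>{(p, q). p \<in> K \<and> q \<in> cball p \<delta>}.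
      norm (case z of (p, q) \<Rightarrow> norm (u \<epsilon> q - u \<epsilon> p) / norm (q - p)) \<le> inverse \<epsilon> ^ M"
    using moderate_lipschitz[OF assms] by (rule ep.mod_bddE)
  then have "\<forall>\<^sub>F \<epsilon> in at_right 0. \<forall>p\<in>K. \<forall>q\<in>cball p \<delta>.
      norm (u \<epsilon> q - u \<epsilon> p) \<le> inverse \<epsilon> ^ M * norm (q - p)"
  proof eventually_elim
    case (elim \<epsilon>)
    show ?case
    proof (intro ballI)
      fix p q assume "p \<in> K" "q \<in> cball p \<delta>"
      with elim show "norm (u \<epsilon> q - u \<epsilon> p) \<le> inverse \<epsilon> ^ M * norm (q - p)"
        by (cases "q = p") (auto simp: divide_le_eq)
    qed
  qed
  then show ?thesis by (rule that)
qed

text \<open>The derivative is Lipschitz with a moderate constant, because the partial derivatives are by the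
  mean value inequality. This gives a quadratic remainder.\<close>

lemma moderate_taylor:
  fixes u :: "('a::euclidean_space, 'b::real_normed_vector) net"
  assumes "open U" "compact K" "(\<Union>x\<in>K. cball x \<delta>) \<subseteq> U" "u \<in> moderate_nets U"
  obtains M where "\<forall>\<^sub>F \<epsilon> in at_right 0. \<forall>p\<in>K. \<forall>q\<in>cball p \<delta>.
      norm (u \<epsilon> q - u \<epsilon> p - frechet_derivative (u \<epsilon>) (at p) (q - p)) \<le> inverse \<epsilon> ^ M * (norm (q - p))\<^sup>2"
proof -
  let ?P = "{(p, q). p \<in> K \<and> q \<in> cball p \<delta>}"
  let ?d = "\<lambda>b \<epsilon> (p, q). norm (partials [b] (u \<epsilon>) q - partials [b] (u \<epsilon>) p) / norm (q - p)"
  have "ep.mod_bdd ?P (\<lambda>\<epsilon> z. \<Sum>b\<in>Basis. ?d b \<epsilon> z)"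
  proof (rule ep.mod_bdd_sum)
    fix b :: 'a assume "b \<in> Basis"
    then show "ep.mod_bdd ?P (?d b)"
      by (intro moderate_lipschitz[OF assms(1-3)] moderate_nets_partials assms(4)) auto
  qed
  then obtain M where M: "\<forall>\<^sub>F \<epsilon> in at_right 0. \<forall>z\<in>?P. norm (\<Sum>b\<in>Basis. ?d b \<epsilon> z) \<le> inverse \<epsilon> ^ M"
    by (rule ep.mod_bddE)
  have "\<forall>\<^sub>F \<epsilon> in at_right 0. \<forall>p\<in>K. \<forall>q\<in>cball p \<delta>.
      norm (u \<epsilon> q - u \<epsilon> p - frechet_derivative (u \<epsilon>) (at p) (q - p)) \<le> inverse \<epsilon> ^ M * (norm (q - p))\<^sup>2"
    using M eventually_moderate_differentiable[OF assms(4)] eventually_unit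
  proof eventually_elim
    case (elim \<epsilon>)
    show ?case
    proof (intro ballI)
      fix p q assume pq: "p \<in> K" "q \<in> cball p \<delta>"
      let ?S = "cball p (norm (q - p))"
      have sub: "?S \<subseteq> cball p \<delta>" using pq by (auto simp: dist_norm norm_minus_commute)
      then have d: "u \<epsilon> differentiable at x" if "x \<in> ?S" for x
        using elim(2) assms(3) pq(1) that by blast
      have "norm (u \<epsilon> q - u \<epsilon> p - frechet_derivative (u \<epsilon>) (at p) (q - p))
          \<le> norm (q - p) * (inverse \<epsilon> ^ M * norm (q - p))"
      proof (rule differentiable_bound_linearization[of p q ?S "u \<epsilon>"
            "\<lambda>x. frechet_derivative (u \<epsilon>) (at x)" p])
        show "p + t *\<^sub>R (q - p) \<in> ?S" if "t \<in> {0..1}" for t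
          using that by (auto simp: dist_norm intro: mult_left_le_one_le)
        show "(u \<epsilon> has_derivative frechet_derivative (u \<epsilon>) (at x)) (at x within ?S)" if "x \<in> ?S" for x
          using d[OF that] by (auto simp: frechet_derivative_works intro: has_derivative_at_withinI)
        show centre: "p \<in> ?S" by simp
        fix x assume x: "x \<in> ?S"
        show "onorm (frechet_derivative (u \<epsilon>) (at x) - frechet_derivative (u \<epsilon>) (at p)) \<le> inverse \<epsilon> ^ M * norm (q - p)"
        proof (rule onorm_le)
          fix v
          let ?e = "\<lambda>b. partials [b] (u \<epsilon>) x - partials [b] (u \<epsilon>) p"
          have "(frechet_derivative (u \<epsilon>) (at x) - frechet_derivative (u \<epsilon>) (at p)) v
              = (\<Sum>b\<in>Basis. (v \<bullet> b) *\<^sub>R ?e b)"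
            using frechet_derivative_expand[OF d[OF x], of v] frechet_derivative_expand[OF d[OF centre], of v]
            by (simp only: minus_apply sum_subtractf scaleR_diff_right)
          then have "norm ((frechet_derivative (u \<epsilon>) (at x) - frechet_derivative (u \<epsilon>) (at p)) v)
              \<le> (\<Sum>b\<in>Basis. norm ((v \<bullet> b) *\<^sub>R ?e b))"
            by (simp only: norm_sum)
          also have "\<dots> \<le> (\<Sum>b\<in>Basis. norm (?e b) * norm v)"
            by (intro sum_mono) (simp add: Basis_le_norm mult_right_mono mult.commute[of _ "norm v"])
          also have "\<dots> = (\<Sum>b\<in>Basis. norm (?e b)) * norm v" by (simp only: sum_distrib_right)
          also have "(\<Sum>b\<in>Basis. norm (?e b)) \<le> inverse \<epsilon> ^ M * norm (q - p)"
          proof (cases "x = p")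
            case False
            have "(\<Sum>b\<in>Basis. norm (?e b)) = (\<Sum>b\<in>Basis. ?d b \<epsilon> (p, x)) * norm (x - p)"
              using False by (simp add: sum_distrib_right)
            also have "\<dots> \<le> inverse \<epsilon> ^ M * norm (q - p)"
            proof (rule mult_mono)
              have "(p, x) \<in> ?P" using pq x sub by auto
              then have "norm (\<Sum>b\<in>Basis. ?d b \<epsilon> (p, x)) \<le> inverse \<epsilon> ^ M"
                by (rule bspec[OF elim(1)])
              then show "(\<Sum>b\<in>Basis. ?d b \<epsilon> (p, x)) \<le> inverse \<epsilon> ^ M"
                unfolding real_norm_def by (rule abs_le_D1)
            qed (use x elim(3) in \<open>auto simp: dist_norm norm_minus_commute\<close>)
            finally show ?thesis .
          qed (use elim(3) in simp)
          finally show "norm ((frechet_derivative (u \<epsilon>) (at x) - frechet_derivative (u \<epsilon>) (at p)) v)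
              \<le> inverse \<epsilon> ^ M * norm (q - p) * norm v"
            by (simp add: mult_right_mono)
        qed
      qed
      then show "norm (u \<epsilon> q - u \<epsilon> p - frechet_derivative (u \<epsilon>) (at p) (q - p)) \<le> inverse \<epsilon> ^ M * (norm (q - p))\<^sup>2"
        by (simp add: power2_eq_square mult_ac)
    qed
  qed
  then show ?thesis by (rule that)
qed

lemma compact_neighbourhood:
  fixes K :: "'a::euclidean_space set"
  assumes "compact K" "open U" "K \<subseteq> U"
  obtains \<delta> where "\<delta> > 0" "(\<Union>x\<in>K. cball x \<delta>) \<subseteq> U"
  using compact_subset_open_imp_cball_epsilon_subset[OF assms] by metis

text \<open>Landau's inequality: by the Taylor estimate, the difference quotient of a negligible net with
  step \<open>\<epsilon>\<^sup>k\<close> approximates its derivative up to \<open>\<epsilon>\<^sup>k\<close> times a moderate constant.\<close>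

lemma negl_partial:
  fixes u :: "('a::euclidean_space, 'b::real_normed_vector) net"
  assumes "open U" "u \<in> moderate_nets U" "\<And>K. K \<subset>\<subset> U \<Longrightarrow> negl K u" "K \<subset>\<subset> U" "b \<in> Basis"
  shows "negl K (\<lambda>\<epsilon>. partials [b] (u \<epsilon>))"
proof (rule neglI)
  fix m :: nat
  have K: "compact K" "K \<subseteq> U" using assms(1,4) by (simp_all add: compactly_contained_open)
  obtain \<delta> where \<delta>: "\<delta> > 0" "(\<Union>x\<in>K. cball x \<delta>) \<subseteq> U"
    using compact_neighbourhood[OF K(1) assms(1) K(2)] .
  let ?K = "\<Union>x\<in>K. cball x \<delta>"
  obtain M where M: "\<forall>\<^sub>F \<epsilon> in at_right 0. \<forall>p\<in>K. \<forall>q\<in>cball p \<delta>.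
      norm (u \<epsilon> q - u \<epsilon> p - frechet_derivative (u \<epsilon>) (at p) (q - p)) \<le> inverse \<epsilon> ^ M * (norm (q - p))\<^sup>2"
    using moderate_taylor[OF assms(1) K(1) \<delta>(2) assms(2)] .
  \<comment> \<open>with the step \<open>\<epsilon>\<^sup>k\<close> the second order term, of size \<open>\<epsilon>\<^bsup>k-M\<^esup>\<close>, is below \<open>\<epsilon>\<^sup>m\<close>\<close>
  define k where "k = m + M + 1"
  have "?K \<subset>\<subset> U" using assms(1) K \<delta> compact_cball_sum by (simp add: compactly_contained_open)
  then have "negl ?K u" by (rule assms(3))
  then have "\<forall>\<^sub>F \<epsilon> in at_right 0. \<forall>x\<in>?K. norm (u \<epsilon> x) \<le> \<epsilon> ^ (m + k)"
    unfolding negl_def by blast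
  moreover have "\<forall>\<^sub>F \<epsilon> in at_right 0. 0 < \<epsilon> \<and> \<epsilon> \<le> min 1 \<delta>"
    using eventually_le_small[of "min 1 \<delta>"] \<delta> by simp
  ultimately have "\<forall>\<^sub>F \<epsilon> in at_right 0. \<forall>x\<in>K. norm (partials [b] (u \<epsilon>) x) \<le> 3 * \<epsilon> ^ m"
    using M eventually_moderate_differentiable[OF assms(2)]
  proof eventually_elim
    case (elim \<epsilon>)
    show ?case
    proof
      fix p assume p: "p \<in> K"
      let ?t = "\<epsilon> ^ k" and ?q = "p + \<epsilon> ^ k *\<^sub>R b"
      have e: "0 < \<epsilon>" "\<epsilon> \<le> 1" "\<epsilon> \<le> \<delta>" using elim by auto
      have "?t \<le> \<epsilon> ^ 1" using e by (intro power_decreasing) (auto simp: k_def)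
      then have t: "0 < ?t" "?t \<le> \<delta>" using e by auto
      have q: "?q \<in> cball p \<delta>" using t assms(5) by (simp add: dist_norm)
      have "p \<in> cball p \<delta>" using \<delta> by simp
      then have u: "norm (u \<epsilon> ?q) \<le> \<epsilon> ^ m * ?t" "norm (u \<epsilon> p) \<le> \<epsilon> ^ m * ?t"
        using elim(1) p q unfolding power_add by blast+
      have lin: "linear (frechet_derivative (u \<epsilon>) (at p))"
        using elim(4) p K(2) by (intro linear_frechet_derivative) blast
      have "?q - p = ?t *\<^sub>R b" by simp
      then have fd: "frechet_derivative (u \<epsilon>) (at p) (?q - p) = ?t *\<^sub>R partials [b] (u \<epsilon>) p"
        by (simp add: linear_cmul[OF lin])
      have "norm (u \<epsilon> ?q - u \<epsilon> p - ?t *\<^sub>R partials [b] (u \<epsilon>) p) \<le> inverse \<epsilon> ^ M * (norm (?q - p))\<^sup>2"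
        using elim(3) p q fd by metis
      also have "norm (?q - p) = ?t" using assms(5) t by simp
      also have "inverse \<epsilon> ^ M * ?t\<^sup>2 = inverse \<epsilon> ^ M * \<epsilon> ^ M * \<epsilon> ^ (m + 1) * ?t"
        by (simp add: k_def power_add power2_eq_square)
      also have "\<dots> = \<epsilon> ^ (m + 1) * ?t" using e by (simp add: power_inverse)
      also have "\<dots> \<le> \<epsilon> ^ m * ?t" using e t
        by (intro mult_right_mono power_decreasing) auto
      finally have "norm (?t *\<^sub>R partials [b] (u \<epsilon>) p) \<le> 3 * \<epsilon> ^ m * ?t"
        using u norm_triangle_ineq4[of "u \<epsilon> ?q" "u \<epsilon> p"]
          norm_triangle_ineq2[of "?t *\<^sub>R partials [b] (u \<epsilon>) p" "u \<epsilon> ?q - u \<epsilon> p"]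
        by (simp add: norm_minus_commute del: partials.simps)
      then show "norm (partials [b] (u \<epsilon>) p) \<le> 3 * \<epsilon> ^ m"
        using t by (simp add: mult.commute del: partials.simps)
    qed
  qed
  then show "\<exists>C. \<forall>\<^sub>F \<epsilon> in at_right 0. \<forall>x\<in>K. norm (partials [b] (u \<epsilon>) x) \<le> C * \<epsilon> ^ m" by blast
qed

text \<open>Hence, for moderate nets, smallness of the values entails smallness of all derivatives.\<close>

lemma negligible_nets_iff:
  assumes "open U" "u \<in> moderate_nets U"
  shows "u \<in> negligible_nets U \<longleftrightarrow> (\<forall>K. K \<subset>\<subset> U \<longrightarrow> negl K u)"
proof
  assume u: "u \<in> negligible_nets U"
  have "negl K (\<lambda>\<epsilon>. partials [] (u \<epsilon>))" if "K \<subset>\<subset> U" for K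
    using u that unfolding negligible_nets_negl by (elim conjE allE[of _ K] allE[of _ "[]"]) simp
  then show "\<forall>K. K \<subset>\<subset> U \<longrightarrow> negl K u" by simp
next
  assume *: "\<forall>K. K \<subset>\<subset> U \<longrightarrow> negl K u"
  have "\<forall>K. K \<subset>\<subset> U \<longrightarrow> negl K (\<lambda>\<epsilon>. partials bs (u \<epsilon>))" if "set bs \<subseteq> Basis" for bs
    using * that assms(2)
  proof (induct bs arbitrary: u rule: rev_induct)
    case (snoc b bs)
    then have "b \<in> Basis" by simp
    with snoc have "\<forall>K. K \<subset>\<subset> U \<longrightarrow> negl K (\<lambda>\<epsilon>. partials [b] (u \<epsilon>))"
      using negl_partial[OF assms(1)] by blast
    then show ?case unfolding partials_append
      by (rule snoc.hyps) (use snoc.prems in \<open>auto intro!: moderate_nets_partials simp del: partials.simps\<close>)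
  qed simp
  then show "u \<in> negligible_nets U"
    using assms(2) by (simp add: negligible_nets_negl moderate_nets_def)
qed

section \<open>Classes of nets and the operations on them\<close>

lemma colombeau_rel_iff:
  assumes "open U"
  shows "(u, v) \<in> colombeau_rel U \<longleftrightarrow> u \<in> moderate_nets U \<and> v \<in> moderate_nets U \<and>
    (\<forall>K. K \<subset>\<subset> U \<longrightarrow> negl K (\<lambda>\<epsilon> x. u \<epsilon> x - v \<epsilon> x))"
  using negligible_nets_iff[OF assms moderate_nets_diff[OF assms]]
  by (auto simp: colombeau_rel_def)

lemma equiv_colombeau_rel:
  assumes "open U"
  shows "equiv (moderate_nets U) (colombeau_rel U)"
proof (rule equivI)
  show "colombeau_rel U \<subseteq> moderate_nets U \<times> moderate_nets U"
    by (auto simp: colombeau_rel_def)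
  show "refl_on (moderate_nets U) (colombeau_rel U)"
    by (auto simp: refl_on_def colombeau_rel_iff[OF assms] negl_zero)
  show "sym (colombeau_rel U)"
  proof (rule symI)
    fix u v assume *: "(u, v) \<in> colombeau_rel U"
    have "negl K (\<lambda>\<epsilon> x. v \<epsilon> x - u \<epsilon> x)" if "K \<subset>\<subset> U" for K
      using negl_minus[of K "\<lambda>\<epsilon> x. u \<epsilon> x - v \<epsilon> x"] * that by (simp add: colombeau_rel_iff[OF assms])
    with * show "(v, u) \<in> colombeau_rel U" by (simp add: colombeau_rel_iff[OF assms])
  qed
  show "trans (colombeau_rel U)"
  proof (rule transI)
    fix u v w assume *: "(u, v) \<in> colombeau_rel U" "(v, w) \<in> colombeau_rel U"
    have "negl K (\<lambda>\<epsilon> x. u \<epsilon> x - w \<epsilon> x)" if "K \<subset>\<subset> U" for K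
      using negl_add[of K "\<lambda>\<epsilon> x. u \<epsilon> x - v \<epsilon> x" "\<lambda>\<epsilon> x. v \<epsilon> x - w \<epsilon> x"] * that
      by (simp add: colombeau_rel_iff[OF assms])
    with * show "(u, w) \<in> colombeau_rel U" by (simp add: colombeau_rel_iff[OF assms])
  qed
qed

lemma colombeau_class:
  assumes "open U" "u \<in> colombeau U" "a \<in> u"
  shows "a \<in> moderate_nets U" "u = colombeau_rel U `` {a}"
proof -
  obtain c where c: "u = colombeau_rel U `` {c}"
    using assms(2) by (auto simp: colombeau_def quotient_def)
  with assms(3) have ca: "(c, a) \<in> colombeau_rel U" by simp
  then show "a \<in> moderate_nets U" by (simp add: colombeau_rel_def)
  show "u = colombeau_rel U `` {a}"
    using equiv_class_eq[OF equiv_colombeau_rel[OF assms(1)] ca] c by simp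
qed

lemma colombeau_related:
  assumes "open U" "u \<in> colombeau U" "a \<in> u" "b \<in> u"
  shows "(a, b) \<in> colombeau_rel U"
  using colombeau_class(2)[OF assms(1-3)] assms(4) by blast

lemma colombeau_classI:
  assumes "open U" "a \<in> moderate_nets U"
  shows "colombeau_rel U `` {a} \<in> colombeau U" "a \<in> colombeau_rel U `` {a}"
  unfolding colombeau_def
  using equiv_class_self[OF equiv_colombeau_rel[OF assms(1)] assms(2)] quotientI[OF assms(2)]
  by blast+

lemma colombeau_class_eq_iff:
  assumes "open U" "a \<in> moderate_nets U" "b \<in> moderate_nets U"
  shows "colombeau_rel U `` {a} = colombeau_rel U `` {b} \<longleftrightarrow> (a, b) \<in> colombeau_rel U"
  using eq_equiv_class_iff[OF equiv_colombeau_rel[OF assms(1)] assms(2,3)] .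

lemma colombeau_ex_rep: "open U \<Longrightarrow> u \<in> colombeau U \<Longrightarrow> \<exists>a. a \<in> u"
  unfolding colombeau_def using equiv_colombeau_rel in_quotient_imp_non_empty by blast

text \<open>An operation on nets that respects the relation is computed on any representative.\<close>

lemma gfun_lift_eq:
  assumes "open U" "a \<in> u" "\<And>b. b \<in> u \<Longrightarrow> (T a, T b) \<in> colombeau_rel U"
  shows "gfun_lift U T u = colombeau_rel U `` {T a}"
proof -
  have "colombeau_rel U `` {T b} = colombeau_rel U `` {T a}" if "b \<in> u" for b
    using equiv_class_eq[OF equiv_colombeau_rel[OF assms(1)] assms(3)[OF that]] by simp
  then show ?thesis using assms(2) unfolding gfun_lift_def by blast
qed

subsection \<open>The derivative\<close>

text \<open>The rank one matrix \<open>y b\<^sup>T\<close>. It is linear in \<open>y\<close>, so that writing a Jacobian as a sum of dyads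
  reduces estimates of matrices to those of partial derivatives.\<close>

definition dyad :: "real^'n \<Rightarrow> real^'m \<Rightarrow> real^'n^'m" where
  "dyad b y = (\<chi> i. y $ i *\<^sub>R b)"

lemma dyad_mult: "dyad b y *v v = (v \<bullet> b) *\<^sub>R y"
  unfolding vec_eq_iff dyad_def matrix_vector_mult_def inner_vec_def
  by (simp add: sum_distrib_left mult_ac)

lemma bounded_linear_dyad: "bounded_linear (dyad b)"
  unfolding linear_conv_bounded_linear[symmetric]
  by (rule linearI) (simp_all add: dyad_def vec_eq_iff algebra_simps)

lemma jacobian_mult:
  fixes f :: "real^'n \<Rightarrow> real^'m"
  assumes "f differentiable at x"
  shows "jacobian f (at x) *v v = frechet_derivative f (at x) v"
proof -
  have "frechet_derivative f (at x) = (\<lambda>h. jacobian f (at x) *v h)"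
    using frechet_derivative_eq[OF iffD1[OF jacobian_works assms]] .
  then show ?thesis by (rule fun_cong[THEN sym])
qed

lemma matrix_sum_mult: "(\<Sum>b\<in>A. M b) *v v = (\<Sum>b\<in>A. M b *v (v :: real^'n))"
  by (induct A rule: infinite_finite_induct) (simp_all add: matrix_vector_mult_add_rdistrib)

lemma jacobian_expand:
  assumes "f differentiable at x"
  shows "jacobian f (at x) = (\<Sum>b\<in>Basis. dyad b (partials [b] f x))"
  unfolding matrix_eq jacobian_mult[OF assms] frechet_derivative_expand[OF assms] matrix_sum_mult dyad_mult
  by (rule allI) (rule refl)

lemma moderate_nets_jacobian:
  fixes u :: "(real^'n, real^'m) net"
  assumes "open U" "u \<in> moderate_nets U"
  shows "(\<lambda>\<epsilon> x. jacobian (u \<epsilon>) (at x)) \<in> moderate_nets U"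
proof (rule moderate_nets_cong[OF assms(1)])
  show "(\<lambda>\<epsilon> x. \<Sum>b\<in>Basis. dyad b (partials [b] (u \<epsilon>) x)) \<in> moderate_nets U"
  proof (rule moderate_nets_sum[OF assms(1)])
    fix b :: "real^'n" assume "b \<in> Basis"
    then show "(\<lambda>\<epsilon> x. dyad b (partials [b] (u \<epsilon>) x)) \<in> moderate_nets U"
      by (intro moderate_nets_bounded_linear[OF assms(1) bounded_linear_dyad]
          moderate_nets_partials assms) auto
  qed
  fix \<epsilon> :: real and x assume "\<epsilon> \<in> {0<..1}" "x \<in> U"
  then have "u \<epsilon> differentiable at x"
    using assms(2) by (auto simp: moderate_nets_def smooth_nets_def intro: smooth_on_differentiable)
  then show "jacobian (u \<epsilon>) (at x) = (\<Sum>b\<in>Basis. dyad b (partials [b] (u \<epsilon>) x))"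
    by (rule jacobian_expand)
qed

lemma negl_partial_diff:
  assumes "open U" "(a, b) \<in> colombeau_rel U" "K \<subset>\<subset> U" "c \<in> Basis"
  shows "negl K (\<lambda>\<epsilon> x. partials [c] (a \<epsilon>) x - partials [c] (b \<epsilon>) x)"
proof (rule negl_cong)
  have *: "a \<in> moderate_nets U" "b \<in> moderate_nets U"
    using assms(2) by (simp_all add: colombeau_rel_iff[OF assms(1)])
  show "negl K (\<lambda>\<epsilon>. partials [c] (\<lambda>x. a \<epsilon> x - b \<epsilon> x))"
    using assms(2) by (intro negl_partial[OF assms(1) moderate_nets_diff[OF assms(1) *] _ assms(3,4)])
      (simp add: colombeau_rel_iff[OF assms(1)])
  have KU: "K \<subseteq> U" using assms(1,3) by (simp add: compactly_contained_open)
  show "\<forall>\<^sub>F \<epsilon> in at_right 0. \<forall>x\<in>K. partials [c] (a \<epsilon>) x - partials [c] (b \<epsilon>) x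
      = partials [c] (\<lambda>x. a \<epsilon> x - b \<epsilon> x) x"
    using *[THEN moderate_nets_smooth, THEN smooth_nets_eventually]
  proof eventually_elim
    case (elim \<epsilon>)
    then show ?case
      using partials_diff[OF assms(1) elim, of "[c]"] KU assms(4) by auto
  qed
qed

lemma gderiv_eq:
  assumes "open U" "u \<in> colombeau U" "a \<in> u"
  shows "gderiv U u = colombeau_rel U `` {\<lambda>\<epsilon> x. jacobian (a \<epsilon>) (at x)}"
  unfolding gderiv_def
proof (rule gfun_lift_eq[OF assms(1,3)])
  fix b assume b: "b \<in> u"
  have ab: "(a, b) \<in> colombeau_rel U" by (rule colombeau_related[OF assms b])
  then have mod: "a \<in> moderate_nets U" "b \<in> moderate_nets U"
    by (simp_all add: colombeau_rel_iff[OF assms(1)])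
  have "negl K (\<lambda>\<epsilon> x. jacobian (a \<epsilon>) (at x) - jacobian (b \<epsilon>) (at x))" if K: "K \<subset>\<subset> U" for K
  proof (rule negl_cong)
    show "negl K (\<lambda>\<epsilon> x. \<Sum>c\<in>Basis. dyad c (partials [c] (a \<epsilon>) x - partials [c] (b \<epsilon>) x))"
      by (intro negl_sum negl_linear[OF bounded_linear_dyad] negl_partial_diff[OF assms(1) ab K])
    have KU: "K \<subseteq> U" using assms(1) K by (simp add: compactly_contained_open)
    show "\<forall>\<^sub>F \<epsilon> in at_right 0. \<forall>x\<in>K. jacobian (a \<epsilon>) (at x) - jacobian (b \<epsilon>) (at x)
        = (\<Sum>c\<in>Basis. dyad c (partials [c] (a \<epsilon>) x - partials [c] (b \<epsilon>) x))"
      using mod[THEN eventually_moderate_differentiable]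
    proof eventually_elim
      case (elim \<epsilon>)
      show ?case
      proof
        fix x assume "x \<in> K"
        then have "a \<epsilon> differentiable at x" "b \<epsilon> differentiable at x" using elim KU by auto
        then show "jacobian (a \<epsilon>) (at x) - jacobian (b \<epsilon>) (at x)
            = (\<Sum>c\<in>Basis. dyad c (partials [c] (a \<epsilon>) x - partials [c] (b \<epsilon>) x))"
          by (simp only: jacobian_expand sum_subtractf linear_diff[OF bounded_linear.linear[OF bounded_linear_dyad]])
      qed
    qed
  qed
  then show "(\<lambda>\<epsilon> x. jacobian (a \<epsilon>) (at x), \<lambda>\<epsilon> x. jacobian (b \<epsilon>) (at x)) \<in> colombeau_rel U"
    unfolding colombeau_rel_iff[OF assms(1)]
    using mod[THEN moderate_nets_jacobian[OF assms(1)]] by blast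
qed

subsection \<open>Composition\<close>

lemma c_bounded_iff:
  "c_bounded U V u \<longleftrightarrow> u \<in> moderate_nets U \<and> (\<forall>\<^sub>F \<epsilon> in at_right 0. u \<epsilon> ` U \<subseteq> V) \<and>
     (\<forall>K. K \<subset>\<subset> U \<longrightarrow> (\<exists>L. L \<subset>\<subset> V \<and> (\<forall>\<^sub>F \<epsilon> in at_right 0. u \<epsilon> ` K \<subseteq> L)))"
  unfolding c_bounded_def eventually_small_iff ..

lemma c_boundedD:
  assumes "c_bounded U V u"
  shows "u \<in> moderate_nets U" "\<forall>\<^sub>F \<epsilon> in at_right 0. u \<epsilon> ` U \<subseteq> V"
  using assms by (simp_all add: c_bounded_iff)

lemma c_bounded_compactE:
  assumes "c_bounded U V u" "K \<subset>\<subset> U"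
  obtains L where "L \<subset>\<subset> V" "\<forall>\<^sub>F \<epsilon> in at_right 0. u \<epsilon> ` K \<subseteq> L"
  using assms by (auto simp: c_bounded_iff)

text \<open>The representative used in the definition of composition.\<close>

definition comp_net :: "'a set \<Rightarrow> 'b set \<Rightarrow> ('b, 'c::real_normed_vector) net \<Rightarrow> ('a, 'b) net \<Rightarrow> ('a, 'c) net" where
  "comp_net U V v p = (\<lambda>\<epsilon>. if p \<epsilon> ` U \<subseteq> V then v \<epsilon> \<circ> p \<epsilon> else (\<lambda>x. 0))"

lemma comp_net_eventually:
  assumes "c_bounded U V p"
  shows "\<forall>\<^sub>F \<epsilon> in at_right 0. \<forall>x. comp_net U V v p \<epsilon> x = v \<epsilon> (p \<epsilon> x)"
  using c_boundedD(2)[OF assms] by eventually_elim (simp add: comp_net_def)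

lemma moderate_comp_net:
  assumes "open U" "open V" "v \<in> moderate_nets V" "c_bounded U V p"
  shows "comp_net U V v p \<in> moderate_nets U"
  unfolding moderate_nets_tame
proof (intro conjI allI impI)
  have p: "p \<in> moderate_nets U" using assms(4) by (rule c_boundedD)
  show "comp_net U V v p \<in> smooth_nets U"
    unfolding smooth_nets_def
  proof (standard, standard)
    fix \<epsilon> :: real assume "\<epsilon> \<in> {0<..1}"
    then have "smooth_on V (v \<epsilon>)" "smooth_on U (p \<epsilon>)"
      using assms(3) p by (auto simp: moderate_nets_def smooth_nets_def)
    then show "smooth_on U (comp_net U V v p \<epsilon>)"
      using smooth_on_compose[OF assms(1,2)] by (auto simp: comp_net_def o_def smooth_on_const)
  qed
  fix K :: "'a set" and k assume K: "K \<subset>\<subset> U"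
  then have KU: "K \<subseteq> U" using assms(1) by (simp add: compactly_contained_open)
  obtain L where L: "L \<subset>\<subset> V" "\<forall>\<^sub>F \<epsilon> in at_right 0. p \<epsilon> ` K \<subseteq> L"
    using assms(4) K by (rule c_bounded_compactE)
  have "ep.tame U K k (\<lambda>\<epsilon> x. v \<epsilon> (p \<epsilon> x))"
    using ep.tame_compose[OF assms(1) KU assms(2), of L k v p] L K assms(3) p c_boundedD(2)[OF assms(4)]
    by (simp add: moderate_nets_tame)
  moreover have "\<forall>\<^sub>F \<epsilon> in at_right 0. \<forall>x\<in>U. comp_net U V v p \<epsilon> x = v \<epsilon> (p \<epsilon> x)"
    using comp_net_eventually[OF assms(4), of v] by eventually_elim simp
  ultimately show "ep.tame U K k (comp_net U V v p)"
    using ep.tame_cong[OF assms(1) KU, of "comp_net U V v p" "\<lambda>\<epsilon> x. v \<epsilon> (p \<epsilon> x)" k] by simp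
qed

text \<open>Negligible changes of the argument change the values of a moderate net negligibly. The
  index set \<open>K\<close> is arbitrary, so that this applies to generalized points, too.\<close>

lemma moderate_perturb:
  assumes "open V" "L \<subset>\<subset> V" "v \<in> moderate_nets V" "\<forall>\<^sub>F \<epsilon> in at_right 0. p \<epsilon> ` K \<subseteq> L"
    and "negl K (\<lambda>\<epsilon> x. q \<epsilon> x - p \<epsilon> x)"
  shows "negl K (\<lambda>\<epsilon> x. v \<epsilon> (q \<epsilon> x) - v \<epsilon> (p \<epsilon> x))"
proof -
  have L: "compact L" "L \<subseteq> V" using assms(1,2) by (simp_all add: compactly_contained_open)
  obtain \<delta> where \<delta>: "\<delta> > 0" "(\<Union>x\<in>L. cball x \<delta>) \<subseteq> V"
    using compact_neighbourhood[OF L(1) assms(1) L(2)] .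
  obtain M where M: "\<forall>\<^sub>F \<epsilon> in at_right 0. \<forall>p\<in>L. \<forall>q\<in>cball p \<delta>.
      norm (v \<epsilon> q - v \<epsilon> p) \<le> inverse \<epsilon> ^ M * norm (q - p)"
    using moderate_lipschitzE[OF assms(1) L(1) \<delta>(2) assms(3)] .
  have "negl K (\<lambda>\<epsilon> x. norm (q \<epsilon> x - p \<epsilon> x) * inverse \<epsilon> ^ M)"
  proof (rule negl_bilinear[OF bounded_bilinear_mult])
    show "ep.mod_bdd K (\<lambda>\<epsilon> x. inverse \<epsilon> ^ M)"
      by (rule ep.mod_bddI[where C=1 and M=M])
         (use eventually_unit in eventually_elim, simp)
  qed (use assms(5) in \<open>simp add: negl_norm\<close>)
  moreover have "\<forall>\<^sub>F \<epsilon> in at_right 0. \<forall>x\<in>K.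
      norm (v \<epsilon> (q \<epsilon> x) - v \<epsilon> (p \<epsilon> x)) \<le> norm (norm (q \<epsilon> x - p \<epsilon> x) * inverse \<epsilon> ^ M)"
  proof -
    have "\<forall>\<^sub>F \<epsilon> in at_right 0. \<forall>x\<in>K. norm (q \<epsilon> x - p \<epsilon> x) \<le> \<epsilon> ^ 1"
      using assms(5) unfolding negl_def by blast
    with M assms(4) eventually_le_small[OF \<delta>(1)] show ?thesis
    proof eventually_elim
      case (elim \<epsilon>)
      show ?case
      proof
        fix x assume x: "x \<in> K"
        then have "norm (q \<epsilon> x - p \<epsilon> x) \<le> \<delta>" using elim by force
        then have "q \<epsilon> x \<in> cball (p \<epsilon> x) \<delta>" by (simp add: dist_norm norm_minus_commute)
        moreover have "p \<epsilon> x \<in> L" using elim x by blast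
        ultimately have "norm (v \<epsilon> (q \<epsilon> x) - v \<epsilon> (p \<epsilon> x)) \<le> inverse \<epsilon> ^ M * norm (q \<epsilon> x - p \<epsilon> x)"
          using elim(1) by blast
        also have "\<dots> = norm (norm (q \<epsilon> x - p \<epsilon> x) * inverse \<epsilon> ^ M)"
          using elim by (simp add: abs_mult)
        finally show "norm (v \<epsilon> (q \<epsilon> x) - v \<epsilon> (p \<epsilon> x)) \<le> norm (norm (q \<epsilon> x - p \<epsilon> x) * inverse \<epsilon> ^ M)" .
      qed
    qed
  qed
  ultimately show ?thesis by (rule negl_mono_pointwise)
qed

text \<open>Composition respects the relation: replacing the outer net changes the values negligibly since
  the inner net stays in a compact set, and for the inner net this is the previous lemma.\<close>

lemma comp_net_rel:
  assumes "open U" "open V" "(v, w) \<in> colombeau_rel V" "(p, q) \<in> colombeau_rel U"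
    and "c_bounded U V p" "c_bounded U V q"
  shows "(comp_net U V v p, comp_net U V w q) \<in> colombeau_rel U"
  unfolding colombeau_rel_iff[OF assms(1)]
proof (intro conjI allI impI)
  have vw: "v \<in> moderate_nets V" "w \<in> moderate_nets V"
    using assms(3) by (simp_all add: colombeau_rel_iff[OF assms(2)])
  then show "comp_net U V v p \<in> moderate_nets U" "comp_net U V w q \<in> moderate_nets U"
    using moderate_comp_net[OF assms(1,2)] assms(5,6) by blast+
  fix K assume K: "K \<subset>\<subset> U"
  obtain L where L: "L \<subset>\<subset> V" "\<forall>\<^sub>F \<epsilon> in at_right 0. p \<epsilon> ` K \<subseteq> L"
    using assms(5) K by (rule c_bounded_compactE)
  have "negl L (\<lambda>\<epsilon> y. v \<epsilon> y - w \<epsilon> y)"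
    using assms(3) L by (simp add: colombeau_rel_iff[OF assms(2)])
  then have 1: "negl K (\<lambda>\<epsilon> x. v \<epsilon> (p \<epsilon> x) - w \<epsilon> (p \<epsilon> x))"
    using negl_compose[OF _ L(2)] by blast
  have "negl K (\<lambda>\<epsilon> x. - (p \<epsilon> x - q \<epsilon> x))"
    using assms(4) K by (intro negl_minus) (simp add: colombeau_rel_iff[OF assms(1)])
  then have 2: "negl K (\<lambda>\<epsilon> x. w \<epsilon> (q \<epsilon> x) - w \<epsilon> (p \<epsilon> x))"
    by (intro moderate_perturb[OF assms(2) L(1) vw(2) L(2)]) simp
  show "negl K (\<lambda>\<epsilon> x. comp_net U V v p \<epsilon> x - comp_net U V w q \<epsilon> x)"
  proof (rule negl_cong[OF negl_diff[OF 1 2]])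
    show "\<forall>\<^sub>F \<epsilon> in at_right 0. \<forall>x\<in>K. comp_net U V v p \<epsilon> x - comp_net U V w q \<epsilon> x
        = v \<epsilon> (p \<epsilon> x) - w \<epsilon> (p \<epsilon> x) - (w \<epsilon> (q \<epsilon> x) - w \<epsilon> (p \<epsilon> x))"
      using comp_net_eventually[OF assms(5), of v] comp_net_eventually[OF assms(6), of w]
      by eventually_elim simp
  qed
qed

lemma gcompose_eq:
  assumes "open U" "open V" "v \<in> colombeau V" "a \<in> v" "u \<in> colombeau U" "p \<in> u" "c_bounded U V p"
  shows "gcompose U V v u = colombeau_rel U `` {comp_net U V a p}"
proof -
  have eq: "gfun_lift U (\<lambda>v' \<epsilon>. if q \<epsilon> ` U \<subseteq> V then v' \<epsilon> \<circ> q \<epsilon> else (\<lambda>x. 0)) v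
      = colombeau_rel U `` {comp_net U V a p}" if q: "q \<in> u" "c_bounded U V q" for q
  proof -
    have T: "(\<lambda>v' \<epsilon>. if q \<epsilon> ` U \<subseteq> V then v' \<epsilon> \<circ> q \<epsilon> else (\<lambda>x. 0)) = (\<lambda>v'. comp_net U V v' q)"
      by (simp add: comp_net_def fun_eq_iff)
    have qq: "(q, q) \<in> colombeau_rel U" "(q, p) \<in> colombeau_rel U"
      using colombeau_related[OF assms(1,5)] assms(6) q by blast+
    have "gfun_lift U (\<lambda>v'. comp_net U V v' q) v = colombeau_rel U `` {comp_net U V a q}"
      using colombeau_related[OF assms(2,3,4)]
      by (intro gfun_lift_eq[OF assms(1,4)] comp_net_rel[OF assms(1,2) _ qq(1) q(2) q(2)])
    also have "\<dots> = colombeau_rel U `` {comp_net U V a p}"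
      using colombeau_related[OF assms(2,3,4,4)]
      by (intro equiv_class_eq[OF equiv_colombeau_rel[OF assms(1)]]
          comp_net_rel[OF assms(1,2) _ qq(2) q(2) assms(7)])
    finally show ?thesis unfolding T .
  qed
  show ?thesis unfolding gcompose_def using eq assms(6,7) by blast
qed

lemma gpair_id_eq:
  assumes "open U" "u \<in> colombeau U" "a \<in> u"
  shows "gpair_id U u = colombeau_rel U `` {\<lambda>\<epsilon> x. (x, a \<epsilon> x)}"
  unfolding gpair_id_def
proof (rule gfun_lift_eq[OF assms(1,3)])
  fix b assume "b \<in> u"
  then have ab: "(a, b) \<in> colombeau_rel U" by (rule colombeau_related[OF assms])
  have "negl K (\<lambda>\<epsilon> x. (x, a \<epsilon> x) - (x, b \<epsilon> x))" if "K \<subset>\<subset> U" for K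
  proof (rule negl_mono_pointwise)
    show "negl K (\<lambda>\<epsilon> x. a \<epsilon> x - b \<epsilon> x)" using ab that by (simp add: colombeau_rel_iff[OF assms(1)])
  qed simp
  then show "(\<lambda>\<epsilon> x. (x, a \<epsilon> x), \<lambda>\<epsilon> x. (x, b \<epsilon> x)) \<in> colombeau_rel U"
    using ab moderate_nets_Pair[OF assms(1) moderate_nets_id[OF assms(1)]]
    unfolding colombeau_rel_iff[OF assms(1)] by blast
qed

lemma compactly_contained_Times:
  "open U \<Longrightarrow> open V \<Longrightarrow> K \<subset>\<subset> U \<Longrightarrow> L \<subset>\<subset> V \<Longrightarrow> K \<times> L \<subset>\<subset> U \<times> V"
  by (auto simp: compactly_contained_open open_Times compact_Times)

lemma c_bounded_Pair_id:
  assumes "open U" "open V" "open U'" "open W" "U' \<subseteq> U" "W \<subseteq> V" "c_bounded U' W a"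
  shows "c_bounded U' (U \<times> V) (\<lambda>\<epsilon> x. (x, a \<epsilon> x))"
  unfolding c_bounded_iff
proof (intro conjI allI impI)
  show "(\<lambda>\<epsilon> x. (x, a \<epsilon> x)) \<in> moderate_nets U'"
    by (intro moderate_nets_Pair moderate_nets_id assms(3) c_boundedD(1)[OF assms(7)])
  show "\<forall>\<^sub>F \<epsilon> in at_right 0. (\<lambda>x. (x, a \<epsilon> x)) ` U' \<subseteq> U \<times> V"
    using c_boundedD(2)[OF assms(7)] by eventually_elim (use assms(5,6) in auto)
  fix K assume K: "K \<subset>\<subset> U'"
  obtain L where L: "L \<subset>\<subset> W" "\<forall>\<^sub>F \<epsilon> in at_right 0. a \<epsilon> ` K \<subseteq> L"
    using assms(7) K by (rule c_bounded_compactE)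
  have "K \<times> L \<subset>\<subset> U \<times> V"
    using K L(1) assms(1-6) by (intro compactly_contained_Times) (auto simp: compactly_contained_open)
  moreover have "\<forall>\<^sub>F \<epsilon> in at_right 0. (\<lambda>x. (x, a \<epsilon> x)) ` K \<subseteq> K \<times> L"
    using L(2) by eventually_elim auto
  ultimately show "\<exists>L. L \<subset>\<subset> U \<times> V \<and> (\<forall>\<^sub>F \<epsilon> in at_right 0. (\<lambda>x. (x, a \<epsilon> x)) ` K \<subseteq> L)" by blast
qed

lemma gderiv_eq_gcompose_iff:
  assumes "open U" "open V" "open U'" "open W" "U' \<subseteq> U" "W \<subseteq> V"
    and "F \<in> colombeau (U \<times> V)" "f \<in> F" "u \<in> colombeau U'" "a \<in> u" "c_bounded U' W a"
  shows "gderiv U' u = gcompose U' (U \<times> V) F (gpair_id U' u) \<longleftrightarrow>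
    (\<lambda>\<epsilon> x. jacobian (a \<epsilon>) (at x), comp_net U' (U \<times> V) f (\<lambda>\<epsilon> x. (x, a \<epsilon> x))) \<in> colombeau_rel U'"
proof -
  let ?p = "\<lambda>\<epsilon> x. (x, a \<epsilon> x)"
  have UV: "open (U \<times> V)" using assms by (simp add: open_Times)
  have cb: "c_bounded U' (U \<times> V) ?p" using assms by (intro c_bounded_Pair_id)
  note p = colombeau_classI[OF assms(3) c_boundedD(1)[OF cb]]
  have a: "a \<in> moderate_nets U'" by (rule colombeau_class(1)[OF assms(3,9,10)])
  have "gcompose U' (U \<times> V) F (gpair_id U' u) = colombeau_rel U' `` {comp_net U' (U \<times> V) f ?p}"
    unfolding gpair_id_eq[OF assms(3,9,10)]
    by (rule gcompose_eq[OF assms(3) UV assms(7,8) p cb])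
  moreover have "comp_net U' (U \<times> V) f ?p \<in> moderate_nets U'"
    by (rule moderate_comp_net[OF assms(3) UV colombeau_class(1)[OF UV assms(7,8)] cb])
  ultimately show ?thesis
    using colombeau_class_eq_iff[OF assms(3) moderate_nets_jacobian[OF assms(3) a]]
    by (simp add: gderiv_eq[OF assms(3,9,10)])
qed

text \<open>In terms of values only, by the characterization of negligible nets.\<close>

lemma ode_residual_iff:
  assumes "open U" "open V" "open U'" "open W" "U' \<subseteq> U" "W \<subseteq> V"
    and "F \<in> colombeau (U \<times> V)" "f \<in> F" "u \<in> colombeau U'" "a \<in> u" "c_bounded U' W a"
  shows "gderiv U' u = gcompose U' (U \<times> V) F (gpair_id U' u) \<longleftrightarrow>
    (\<forall>K. K \<subset>\<subset> U' \<longrightarrow> negl K (\<lambda>\<epsilon> x. jacobian (a \<epsilon>) (at x) - f \<epsilon> (x, a \<epsilon> x)))"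
proof -
  let ?p = "\<lambda>\<epsilon> x. (x, a \<epsilon> x)"
  have UV: "open (U \<times> V)" using assms by (simp add: open_Times)
  have cb: "c_bounded U' (U \<times> V) ?p" using assms by (intro c_bounded_Pair_id)
  have a: "a \<in> moderate_nets U'" by (rule colombeau_class(1)[OF assms(3,9,10)])
  have mod: "comp_net U' (U \<times> V) f ?p \<in> moderate_nets U'"
    by (rule moderate_comp_net[OF assms(3) UV colombeau_class(1)[OF UV assms(7,8)] cb])
  have eq: "\<forall>\<^sub>F \<epsilon> in at_right 0. \<forall>x\<in>K. jacobian (a \<epsilon>) (at x) - comp_net U' (U \<times> V) f ?p \<epsilon> x
      = jacobian (a \<epsilon>) (at x) - f \<epsilon> (x, a \<epsilon> x)" for K
    using comp_net_eventually[OF cb, of f] by eventually_elim simp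
  have eq': "\<forall>\<^sub>F \<epsilon> in at_right 0. \<forall>x\<in>K. jacobian (a \<epsilon>) (at x) - f \<epsilon> (x, a \<epsilon> x)
      = jacobian (a \<epsilon>) (at x) - comp_net U' (U \<times> V) f ?p \<epsilon> x" for K
    using comp_net_eventually[OF cb, of f] by eventually_elim simp
  have "negl K (\<lambda>\<epsilon> x. jacobian (a \<epsilon>) (at x) - comp_net U' (U \<times> V) f ?p \<epsilon> x) \<longleftrightarrow>
      negl K (\<lambda>\<epsilon> x. jacobian (a \<epsilon>) (at x) - f \<epsilon> (x, a \<epsilon> x))" for K
    using negl_cong[OF _ eq] negl_cong[OF _ eq'] by blast
  then show ?thesis
    using moderate_nets_jacobian[OF assms(3) a] mod
    unfolding gderiv_eq_gcompose_iff[OF assms] colombeau_rel_iff[OF assms(3)] by simp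
qed

subsection \<open>Generalized points\<close>

lemma pnet_equiv_iff: "pnet_equiv x y \<longleftrightarrow> negl {()} (\<lambda>\<epsilon> _. x \<epsilon> - y \<epsilon>)"
proof -
  have "(\<lambda>\<epsilon>. norm (x \<epsilon> - y \<epsilon>)) \<in> O[at_right 0](g) \<longleftrightarrow> sup_bigo {()} (\<lambda>\<epsilon> _. x \<epsilon> - y \<epsilon>) g"
    for g :: "real \<Rightarrow> real"
    unfolding sup_bigo_def using bigoI[of "\<lambda>\<epsilon>. norm (x \<epsilon> - y \<epsilon>)" _ g "at_right 0"]
    by (auto elim!: landau_o.bigE)
  then show ?thesis unfolding pnet_equiv_def sup_bigo_power_iff[symmetric] by simp
qed

lemma moderate_points_iff:
  "x \<in> moderate_points U \<longleftrightarrow> (\<forall>\<epsilon>\<in>{0<..1}. x \<epsilon> \<in> U) \<and> ep.mod_bdd {()} (\<lambda>\<epsilon> _. x \<epsilon>)"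
proof -
  have "(\<lambda>\<epsilon>. norm (x \<epsilon>)) \<in> O[at_right 0](g) \<longleftrightarrow> sup_bigo {()} (\<lambda>\<epsilon> _. x \<epsilon>) g"
    for g :: "real \<Rightarrow> real"
    unfolding sup_bigo_def using bigoI[of "\<lambda>\<epsilon>. norm (x \<epsilon>)" _ g "at_right 0"]
    by (auto elim!: landau_o.bigE)
  then show ?thesis unfolding moderate_points_def sup_bigo_inverse_iff[symmetric] by simp
qed

lemma pnet_equiv_refl: "pnet_equiv x x"
  by (simp add: pnet_equiv_iff negl_zero)

lemma pnet_equiv_sym: "pnet_equiv x y \<Longrightarrow> pnet_equiv y x"
  by (simp add: pnet_equiv_def norm_minus_commute)

lemma pnet_equiv_trans: "pnet_equiv x y \<Longrightarrow> pnet_equiv y z \<Longrightarrow> pnet_equiv x z"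
  unfolding pnet_equiv_iff using negl_add[of "{()}" "\<lambda>\<epsilon> _. x \<epsilon> - y \<epsilon>" "\<lambda>\<epsilon> _. y \<epsilon> - z \<epsilon>"] by simp

lemma pnet_equiv_eventually_eq:
  "\<forall>\<^sub>F \<epsilon> in at_right 0. x \<epsilon> = y \<epsilon> \<Longrightarrow> pnet_equiv x y"
  unfolding pnet_equiv_iff by (rule negl_cong[OF negl_zero]) (erule eventually_mono, simp)

lemma gpoints_class:
  assumes "X \<in> gpoints U" "x \<in> X"
  shows "x \<in> moderate_points U" "z \<in> X \<longleftrightarrow> z \<in> moderate_points U \<and> pnet_equiv x z"
proof -
  obtain c where c: "c \<in> moderate_points U" "X = gpoint_rel U `` {c}"
    using assms(1) by (auto simp: gpoints_def quotient_def)
  then have cx: "x \<in> moderate_points U" "pnet_equiv c x" using assms(2) by (auto simp: gpoint_rel_def)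
  then show "x \<in> moderate_points U" by simp
  show "z \<in> X \<longleftrightarrow> z \<in> moderate_points U \<and> pnet_equiv x z"
    using c cx pnet_equiv_trans[of c x z] pnet_equiv_trans[OF pnet_equiv_sym, of c x z]
    by (auto simp: gpoint_rel_def)
qed

lemma gpoint_classI:
  assumes "x \<in> moderate_points U"
  shows "gpoint_rel U `` {x} \<in> gpoints U" "x \<in> gpoint_rel U `` {x}"
  using assms by (auto simp: gpoints_def quotient_def gpoint_rel_def pnet_equiv_refl)

lemma moderate_points_UNIV: "x \<in> moderate_points U \<Longrightarrow> x \<in> moderate_points UNIV"
  by (simp add: moderate_points_iff)

lemma gpoint_in_UNIV:
  assumes "Y \<in> gpoints V" "y \<in> Y"
  shows "gpoint_in UNIV Y = gpoint_rel UNIV `` {y}"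
proof -
  have "(\<exists>x\<in>Y. pnet_equiv x z) \<longleftrightarrow> pnet_equiv y z" for z
    using gpoints_class(2)[OF assms] assms(2) pnet_equiv_trans by blast
  then show ?thesis
    using moderate_points_UNIV[OF gpoints_class(1)[OF assms]]
    by (auto simp: gpoint_in_def gpoint_rel_def)
qed

lemma pnet_equiv_tendsto:
  assumes "pnet_equiv x y" "(x \<longlongrightarrow> l) (at_right 0)"
  shows "(y \<longlongrightarrow> l) (at_right 0)"
proof -
  have "negl {()} (\<lambda>\<epsilon> _. x \<epsilon> - y \<epsilon>)" using assms(1) by (simp only: pnet_equiv_iff)
  from this[unfolded negl_def, rule_format, of 1]
  have "\<forall>\<^sub>F \<epsilon> in at_right 0. norm (x \<epsilon> - y \<epsilon>) \<le> \<epsilon> ^ 1" by simp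
  then have "((\<lambda>\<epsilon>. x \<epsilon> - y \<epsilon>) \<longlongrightarrow> 0) (at_right 0)"
    by (rule Lim_null_comparison) (auto intro!: tendsto_eq_intros)
  from tendsto_diff[OF assms(2) this] show ?thesis by simp
qed

lemma tendsto_eventually_in_cball:
  fixes x :: "real \<Rightarrow> 'a::metric_space"
  assumes "(x \<longlongrightarrow> x0) (at_right 0)" "r > 0"
  shows "\<forall>\<^sub>F \<epsilon> in at_right 0. x \<epsilon> \<in> cball x0 r"
  using tendstoD[OF assms] by eventually_elim (simp add: dist_commute)

text \<open>All representatives of the point stay in a compact ball around \<open>x0\<close>, where negligible changes of
  the point or of the function do not matter. The net \<open>x\<close> may leave \<open>U'\<close> for large
  \<open>\<epsilon>\<close>; the nets \<open>z\<close> represent the same point with values in \<open>U'\<close>.\<close>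

lemma initial_condition_iff:
  fixes a :: "('a::euclidean_space, 'b::real_normed_vector) net"
  assumes "open U'" "U' \<subseteq> U" "x0 \<in> U'" "X \<in> gpoints U" "x \<in> X" "(x \<longlongrightarrow> x0) (at_right 0)"
    and "u \<in> colombeau U'" "a \<in> u" "Y \<in> gpoints V" "y \<in> Y"
  shows "point_value u (gpoint_in U' X) = gpoint_in UNIV Y \<longleftrightarrow> pnet_equiv (\<lambda>\<epsilon>. a \<epsilon> (x \<epsilon>)) y"
proof -
  obtain r where r: "r > 0" "cball x0 r \<subseteq> U'"
    using assms(1,3) open_contains_cball by blast
  then have K: "cball x0 r \<subset>\<subset> U'" by (simp add: compactly_contained_open assms(1))
  have a: "a \<in> moderate_nets U'" by (rule colombeau_class(1)[OF assms(1,7,8)])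
  have xK: "\<forall>\<^sub>F \<epsilon> in at_right 0. (\<lambda>_. x \<epsilon>) ` {()} \<subseteq> cball x0 r"
    using tendsto_eventually_in_cball[OF assms(6) r(1)] by simp
  have ax: "(\<lambda>\<epsilon>. a \<epsilon> (x \<epsilon>)) \<in> moderate_points UNIV"
    using ep.mod_bdd_compose[OF moderate_mod_bdd[OF a K] xK] by (simp add: moderate_points_iff)
  have rel: "(\<lambda>\<epsilon>. a \<epsilon> (x \<epsilon>), \<lambda>\<epsilon>. b \<epsilon> (z \<epsilon>)) \<in> gpoint_rel UNIV"
    if b: "b \<in> u" and z: "z \<in> gpoint_in U' X" for b z
  proof -
    have xz: "pnet_equiv x z"
      using z gpoints_class(2)[OF assms(4,5)] pnet_equiv_trans by (auto simp: gpoint_in_def)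
    have zK: "\<forall>\<^sub>F \<epsilon> in at_right 0. (\<lambda>_. z \<epsilon>) ` {()} \<subseteq> cball x0 r"
      using tendsto_eventually_in_cball[OF pnet_equiv_tendsto[OF xz assms(6)] r(1)] by simp
    have ab: "(a, b) \<in> colombeau_rel U'" by (rule colombeau_related[OF assms(1,7,8) b])
    have "negl (cball x0 r) (\<lambda>\<epsilon> x. a \<epsilon> x - b \<epsilon> x)"
      using ab K by (simp add: colombeau_rel_iff[OF assms(1)])
    from negl_compose[OF this zK]
    have 1: "negl {()} (\<lambda>\<epsilon> _. a \<epsilon> (z \<epsilon>) - b \<epsilon> (z \<epsilon>))" .
    have "negl {()} (\<lambda>\<epsilon> _. a \<epsilon> (x \<epsilon>) - a \<epsilon> (z \<epsilon>))"
      using moderate_perturb[OF assms(1) K a zK, of "\<lambda>\<epsilon> _. x \<epsilon>"] xz by (simp add: pnet_equiv_iff)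
    from negl_add[OF this 1] have "pnet_equiv (\<lambda>\<epsilon>. a \<epsilon> (x \<epsilon>)) (\<lambda>\<epsilon>. b \<epsilon> (z \<epsilon>))"
      by (simp add: pnet_equiv_iff)
    moreover have "(\<lambda>\<epsilon>. b \<epsilon> (z \<epsilon>)) \<in> moderate_points UNIV"
      using ep.mod_bdd_compose[OF moderate_mod_bdd[OF colombeau_class(1)[OF assms(1,7) b] K] zK]
      by (simp add: moderate_points_iff)
    ultimately show ?thesis using ax by (simp add: gpoint_rel_def)
  qed
  define z where "z \<epsilon> = (if x \<epsilon> \<in> U' then x \<epsilon> else x0)" for \<epsilon>
  have xz: "pnet_equiv x z"
    by (rule pnet_equiv_eventually_eq)
       (rule eventually_mono[OF xK], use r in \<open>auto simp: z_def\<close>)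
  have "z \<in> gpoint_in U' X"
  proof -
    have "ep.mod_bdd {()} (\<lambda>\<epsilon> _. z \<epsilon>)"
    proof (rule ep.mod_bdd_cong)
      show "ep.mod_bdd {()} (\<lambda>\<epsilon> _. x \<epsilon>)"
        using gpoints_class(1)[OF assms(4,5)] by (simp add: moderate_points_iff)
      show "\<forall>\<^sub>F \<epsilon> in at_right 0. \<forall>_\<in>{()}. z \<epsilon> = x \<epsilon>"
        by (rule eventually_mono[OF xK]) (use r in \<open>auto simp: z_def\<close>)
    qed
    then show ?thesis using xz assms(3,5) by (auto simp: gpoint_in_def moderate_points_iff z_def)
  qed
  moreover have "gpoint_rel UNIV `` {\<lambda>\<epsilon>. b \<epsilon> (z \<epsilon>)} = gpoint_rel UNIV `` {\<lambda>\<epsilon>. a \<epsilon> (x \<epsilon>)}"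
    if "b \<in> u" "z \<in> gpoint_in U' X" for b z
  proof -
    have "pnet_equiv (\<lambda>\<epsilon>. a \<epsilon> (x \<epsilon>)) (\<lambda>\<epsilon>. b \<epsilon> (z \<epsilon>))" "(\<lambda>\<epsilon>. b \<epsilon> (z \<epsilon>)) \<in> moderate_points UNIV"
      using rel[OF that] by (simp_all add: gpoint_rel_def)
    then show ?thesis
      using ax pnet_equiv_trans pnet_equiv_sym unfolding gpoint_rel_def by blast
  qed
  ultimately have "point_value u (gpoint_in U' X) = gpoint_rel UNIV `` {\<lambda>\<epsilon>. a \<epsilon> (x \<epsilon>)}"
    using assms(8) unfolding point_value_def by blast
  moreover have "gpoint_in UNIV Y = gpoint_rel UNIV `` {y}" by (rule gpoint_in_UNIV[OF assms(9,10)])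
  moreover have "y \<in> moderate_points UNIV"
    using gpoints_class(1)[OF assms(9,10)] by (rule moderate_points_UNIV)
  ultimately show ?thesis
    using ax by (auto simp: gpoint_rel_def set_eq_iff intro: pnet_equiv_refl pnet_equiv_trans pnet_equiv_sym)
qed

section \<open>Symmetry of second derivatives\<close>

lemma smooth_on_continuous_on: "smooth_on U f \<Longrightarrow> continuous_on U f"
  by (intro continuous_at_imp_continuous_on ballI differentiable_imp_continuous_within)
     (rule smooth_on_differentiable)

text \<open>Regarding a smooth function as a constant net makes the Taylor estimate for moderate nets
  available for it.\<close>

lemma constant_net_moderate:
  assumes "open U" "smooth_on U f"
  shows "(\<lambda>\<epsilon>. f) \<in> moderate_nets U"
  unfolding moderate_nets_mod_bdd
proof (intro conjI allI impI)
  show "(\<lambda>\<epsilon>. f) \<in> smooth_nets U" using assms by (simp add: smooth_nets_def)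
  fix K and bs :: "'a list" assume K: "K \<subset>\<subset> U" and bs: "set bs \<subseteq> Basis"
  then have "compact K" "continuous_on K (partials bs f)"
    using assms smooth_on_continuous_on[OF smooth_on_partials[OF assms(2) bs]]
    by (auto simp: compactly_contained_open intro: continuous_on_subset)
  then have "bounded (partials bs f ` K)"
    by (intro compact_imp_bounded compact_continuous_image)
  then obtain C where C: "\<And>x. x \<in> K \<Longrightarrow> norm (partials bs f x) \<le> C" unfolding bounded_iff by blast
  show "ep.mod_bdd K (\<lambda>\<epsilon>. partials bs f)"
    by (rule ep.mod_bddI[where C=C and M=0]) (simp add: C)
qed

lemma smooth_on_directional_derivative:
  assumes "open U" "smooth_on U f"
  shows "smooth_on U (\<lambda>x. frechet_derivative f (at x) v)"
proof (rule smooth_on_cong[OF assms(1)])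
  show "smooth_on U (\<lambda>x. \<Sum>b\<in>Basis. (v \<bullet> b) *\<^sub>R partials [b] f x)"
  proof (rule smooth_on_sum[OF assms(1)])
    fix b :: 'a assume "b \<in> Basis"
    then show "smooth_on U (\<lambda>x. (v \<bullet> b) *\<^sub>R partials [b] f x)"
      by (intro smooth_on_bounded_linear[OF assms(1) bounded_linear_scaleR_right]
          smooth_on_partials assms) auto
  qed
  show "frechet_derivative f (at x) v = (\<Sum>b\<in>Basis. (v \<bullet> b) *\<^sub>R partials [b] f x)" if "x \<in> U" for x
    by (rule frechet_derivative_expand[OF smooth_on_differentiable[OF assms(2) that]])
qed

text \<open>The Taylor estimate for moderate nets, applied to the constant net and read off at one
  sufficiently small \<open>\<epsilon>\<close>.\<close>

lemma smooth_taylor: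
  assumes "open U" "smooth_on U f" "x \<in> U"
  obtains \<delta> C where "\<delta> > 0" "cball x \<delta> \<subseteq> U" "C \<ge> 0"
    "\<And>q. q \<in> cball x \<delta> \<Longrightarrow> norm (f q - f x - frechet_derivative f (at x) (q - x)) \<le> C * (norm (q - x))\<^sup>2"
proof -
  obtain \<delta> where \<delta>: "\<delta> > 0" "(\<Union>y\<in>{x}. cball y \<delta>) \<subseteq> U"
    using compact_neighbourhood[of "{x}" U] assms by auto
  obtain M where "\<forall>\<^sub>F \<epsilon> in at_right (0::real). \<forall>p\<in>{x}. \<forall>q\<in>cball p \<delta>.
      norm (f q - f p - frechet_derivative f (at p) (q - p)) \<le> inverse \<epsilon> ^ M * (norm (q - p))\<^sup>2"
    by (rule moderate_taylor[OF assms(1) _ \<delta>(2) constant_net_moderate[OF assms(1,2)]]) auto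
  then have "\<forall>\<^sub>F \<epsilon> in at_right (0::real). 0 < \<epsilon> \<and> (\<forall>q\<in>cball x \<delta>.
      norm (f q - f x - frechet_derivative f (at x) (q - x)) \<le> inverse \<epsilon> ^ M * (norm (q - x))\<^sup>2)"
    using eventually_unit by eventually_elim simp
  then obtain e :: real where e: "0 < e" and
    *: "\<forall>q\<in>cball x \<delta>. norm (f q - f x - frechet_derivative f (at x) (q - x)) \<le> inverse e ^ M * (norm (q - x))\<^sup>2"
    using eventually_happens'[OF trivial_limit_at_right_real] by blast
  show ?thesis
    by (rule that[of \<delta> "inverse e ^ M"]) (use \<delta> * e in auto)
qed

text \<open>By the mean value inequality in the direction \<open>v\<close>, the second difference is governed by increments
  of \<open>Df(\<cdot>)v\<close> in the direction \<open>w\<close>. It is symmetric in \<open>v\<close> and \<open>w\<close>, hence so is the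
  limit of its quotient by \<open>h\<^sup>2\<close>.\<close>

lemma second_difference:
  fixes f :: "'a::euclidean_space \<Rightarrow> 'b::real_normed_vector"
  assumes "open U" "smooth_on U f" "x \<in> U"
  obtains h0 B where "h0 > 0" "\<And>h. 0 < h \<Longrightarrow> h \<le> h0 \<Longrightarrow>
    norm (f (x + h *\<^sub>R v + h *\<^sub>R w) - f (x + h *\<^sub>R v) - f (x + h *\<^sub>R w) + f x
      - h\<^sup>2 *\<^sub>R frechet_derivative (\<lambda>y. frechet_derivative f (at y) v) (at x) w) \<le> B * h ^ 3"
proof -
  define g where "g = (\<lambda>y. frechet_derivative f (at y) v)"
  define G where "G = frechet_derivative g (at x)"
  have sg: "smooth_on U g" unfolding g_def by (rule smooth_on_directional_derivative[OF assms(1,2)])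
  have lin: "linear G"
    unfolding G_def by (rule linear_frechet_derivative[OF smooth_on_differentiable[OF sg assms(3)]])
  obtain \<delta> C where \<delta>: "\<delta> > 0" "cball x \<delta> \<subseteq> U" and C: "C \<ge> 0"
    "\<And>q. q \<in> cball x \<delta> \<Longrightarrow> norm (g q - g x - G (q - x)) \<le> C * (norm (q - x))\<^sup>2"
    unfolding G_def by (rule smooth_taylor[OF assms(1) sg assms(3)]) blast
  define N where "N = norm v + norm w + 1"
  have N: "N > 0" "norm v + norm w \<le> N" by (simp_all add: N_def add_nonneg_pos)
  show ?thesis
  proof (rule that[of "\<delta> / N" "2 * (C * N\<^sup>2)"])
    show "\<delta> / N > 0" using \<delta> N by simp
    fix h assume h: "0 < h" "h \<le> \<delta> / N"
    then have hN: "h * N \<le> \<delta>" using N by (simp add: pos_le_divide_eq)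
    have small: "norm (t *\<^sub>R v + s *\<^sub>R w) \<le> h * N" if "0 \<le> t" "t \<le> h" "0 \<le> s" "s \<le> h" for t s
    proof -
      have "norm (t *\<^sub>R v + s *\<^sub>R w) \<le> t * norm v + s * norm w"
        using norm_triangle_ineq[of "t *\<^sub>R v" "s *\<^sub>R w"] that by simp
      also have "\<dots> \<le> h * norm v + h * norm w" using that by (intro add_mono mult_right_mono) auto
      also have "\<dots> \<le> h * N" using N h by (simp add: distrib_left[symmetric])
      finally show ?thesis .
    qed
    have inball: "x + t *\<^sub>R v + s *\<^sub>R w \<in> cball x \<delta>" if "0 \<le> t" "t \<le> h" "0 \<le> s" "s \<le> h" for t s
    proof -
      have "x + t *\<^sub>R v + s *\<^sub>R w - x = t *\<^sub>R v + s *\<^sub>R w" by simp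
      then show ?thesis
        using small[OF that] hN by (simp only: mem_cball dist_norm norm_minus_commute[of x])
    qed
    have gT: "norm (g (x + t *\<^sub>R v + s *\<^sub>R w) - g x - (t *\<^sub>R G v + s *\<^sub>R G w)) \<le> C * (h * N)\<^sup>2"
      if "0 \<le> t" "t \<le> h" "0 \<le> s" "s \<le> h" for t s
    proof -
      have "norm (g (x + t *\<^sub>R v + s *\<^sub>R w) - g x - G (t *\<^sub>R v + s *\<^sub>R w)) \<le> C * (norm (t *\<^sub>R v + s *\<^sub>R w))\<^sup>2"
        using C(2)[OF inball[OF that]] by (simp add: add.assoc)
      also have "\<dots> \<le> C * (h * N)\<^sup>2"
        using small[OF that] C(1) by (intro mult_left_mono power_mono) auto
      finally show ?thesis by (simp add: linear_add[OF lin] linear_cmul[OF lin])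
    qed
    define \<phi> where "\<phi> t = f (x + t *\<^sub>R v + h *\<^sub>R w) - f (x + t *\<^sub>R v + 0 *\<^sub>R w) - (t * h) *\<^sub>R G w" for t
    define \<phi>' where "\<phi>' t = g (x + t *\<^sub>R v + h *\<^sub>R w) - g (x + t *\<^sub>R v + 0 *\<^sub>R w) - h *\<^sub>R G w" for t
    have fd: "((\<lambda>t. f (x + t *\<^sub>R v + s *\<^sub>R w)) has_vector_derivative g (x + t *\<^sub>R v + s *\<^sub>R w)) (at t within S)"
      if "t \<in> {0..h}" "0 \<le> s" "s \<le> h" for t s S
    proof -
      have "f differentiable at (x + t *\<^sub>R v + s *\<^sub>R w)"
        using inball[of t s] that \<delta>(2) smooth_on_differentiable[OF assms(2)] by auto
      then have f: "(f has_derivative frechet_derivative f (at (x + t *\<^sub>R v + s *\<^sub>R w)))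
          (at (x + t *\<^sub>R v + s *\<^sub>R w))"
        by (simp add: frechet_derivative_works)
      have "((\<lambda>t. x + t *\<^sub>R v + s *\<^sub>R w) has_derivative (\<lambda>d. d *\<^sub>R v)) (at t within S)"
        by (auto intro!: derivative_eq_intros)
      from has_derivative_compose[OF this f]
      show ?thesis
        using linear_cmul[OF has_derivative_linear[OF f]]
        by (simp add: has_vector_derivative_def g_def)
    qed
    have "norm (\<phi> h - \<phi> 0) \<le> (2 * (C * (h * N)\<^sup>2)) * norm (h - 0)"
    proof (rule differentiable_bound[of "{0..h}" \<phi> "\<lambda>t d. d *\<^sub>R \<phi>' t"])
      fix t assume t: "t \<in> {0..h}"
      have "(\<phi> has_vector_derivative \<phi>' t) (at t within {0..h})"
        unfolding \<phi>_def \<phi>'_def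
        by (intro has_vector_derivative_diff fd t)
           (use h in \<open>auto intro!: derivative_eq_intros simp: has_vector_derivative_def\<close>)
      then show "(\<phi> has_derivative (\<lambda>d. d *\<^sub>R \<phi>' t)) (at t within {0..h})"
        by (simp add: has_vector_derivative_def)
      have "\<phi>' t = (g (x + t *\<^sub>R v + h *\<^sub>R w) - g x - (t *\<^sub>R G v + h *\<^sub>R G w))
          - (g (x + t *\<^sub>R v + 0 *\<^sub>R w) - g x - (t *\<^sub>R G v + 0 *\<^sub>R G w))"
        by (simp add: \<phi>'_def)
      then have "norm (\<phi>' t) \<le> 2 * (C * (h * N)\<^sup>2)"
        using gT[of t h] gT[of t 0] t h norm_triangle_ineq4 by (smt (verit) atLeastAtMost_iff)
      then have "norm (d *\<^sub>R \<phi>' t) \<le> 2 * (C * (h * N)\<^sup>2) * norm d" for d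
        using mult_right_mono[of "norm (\<phi>' t)" _ "norm d"] by (simp only: norm_scaleR real_norm_def mult.commute[of "\<bar>d\<bar>"])
      then show "onorm (\<lambda>d. d *\<^sub>R \<phi>' t) \<le> 2 * (C * (h * N)\<^sup>2)"
        by (rule onorm_le)
    qed (use h in auto)
    moreover have "\<phi> h - \<phi> 0 = f (x + h *\<^sub>R v + h *\<^sub>R w) - f (x + h *\<^sub>R v) - f (x + h *\<^sub>R w) + f x - h\<^sup>2 *\<^sub>R G w"
      by (simp add: \<phi>_def power2_eq_square)
    ultimately show "norm (f (x + h *\<^sub>R v + h *\<^sub>R w) - f (x + h *\<^sub>R v) - f (x + h *\<^sub>R w) + f x
        - h\<^sup>2 *\<^sub>R frechet_derivative (\<lambda>y. frechet_derivative f (at y) v) (at x) w) \<le> 2 * (C * N\<^sup>2) * h ^ 3"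
      using h by (simp add: G_def g_def power_mult_distrib power2_eq_square power3_eq_cube mult_ac)
  qed
qed

lemma second_derivative_symmetric:
  fixes f :: "'a::euclidean_space \<Rightarrow> 'b::real_normed_vector"
  assumes "open U" "smooth_on U f" "x \<in> U"
  shows "frechet_derivative (\<lambda>y. frechet_derivative f (at y) v) (at x) w
    = frechet_derivative (\<lambda>y. frechet_derivative f (at y) w) (at x) v" (is "?A = ?B")
proof -
  let ?D = "\<lambda>h. f (x + h *\<^sub>R v + h *\<^sub>R w) - f (x + h *\<^sub>R v) - f (x + h *\<^sub>R w) + f x"
  obtain h1 B1 where 1: "h1 > 0" "\<And>h. 0 < h \<Longrightarrow> h \<le> h1 \<Longrightarrow> norm (?D h - h\<^sup>2 *\<^sub>R ?A) \<le> B1 * h ^ 3"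
    by (rule second_difference[OF assms, of v w]) blast
  obtain h2 B2 where 2: "h2 > 0" "\<And>h. 0 < h \<Longrightarrow> h \<le> h2 \<Longrightarrow>
      norm (f (x + h *\<^sub>R w + h *\<^sub>R v) - f (x + h *\<^sub>R w) - f (x + h *\<^sub>R v) + f x - h\<^sup>2 *\<^sub>R ?B) \<le> B2 * h ^ 3"
    by (rule second_difference[OF assms, of w v]) blast
  have *: "norm (?A - ?B) \<le> (B1 + B2) * h" if h: "0 < h" "h \<le> min h1 h2" for h
  proof -
    have eq: "f (x + h *\<^sub>R w + h *\<^sub>R v) - f (x + h *\<^sub>R w) - f (x + h *\<^sub>R v) + f x = ?D h"
      by (simp add: add_ac)
    have "norm (h\<^sup>2 *\<^sub>R (?A - ?B)) = norm ((?D h - h\<^sup>2 *\<^sub>R ?B) - (?D h - h\<^sup>2 *\<^sub>R ?A))"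
      by (simp add: algebra_simps)
    also have "\<dots> \<le> B2 * h ^ 3 + B1 * h ^ 3"
      using norm_triangle_ineq4[of "?D h - h\<^sup>2 *\<^sub>R ?B" "?D h - h\<^sup>2 *\<^sub>R ?A"] 1(2)[of h] 2(2)[of h] h
      unfolding eq by linarith
    also have "\<dots> = ((B1 + B2) * h) * h\<^sup>2" by (simp add: algebra_simps power2_eq_square power3_eq_cube)
    finally show ?thesis using h by (simp add: mult.commute)
  qed
  have "((\<lambda>h. (B1 + B2) * h) \<longlongrightarrow> 0) (at_right 0)" by (auto intro!: tendsto_eq_intros)
  moreover have "\<forall>\<^sub>F h in at_right 0. norm (?A - ?B) \<le> (B1 + B2) * h"
  proof -
    have "\<forall>\<^sub>F h in at_right 0. 0 < h \<and> h \<le> min h1 h2"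
      by (rule eventually_le_small) (use 1(1) 2(1) in simp)
    then show ?thesis by eventually_elim (use * in blast)
  qed
  ultimately have "norm (?A - ?B) \<le> 0"
    by (intro tendsto_lowerbound[of _ 0 "at_right 0"]) (auto simp: trivial_limit_at_right_real)
  then show ?thesis by simp
qed

section \<open>The integrability condition on representatives\<close>

lemma norm_matrix_vector_mult_le:
  fixes A :: "real^'n^'m"
  shows "norm (A *v x) \<le> norm A * norm x"
proof -
  have "norm (A *v x) \<le> L2_set (\<lambda>i. norm (A $ i) * norm x) UNIV"
    unfolding norm_vec_def[of "A *v x"]
  proof (rule L2_set_mono)
    fix i
    have "(A *v x) $ i = A $ i \<bullet> x" by (simp add: matrix_vector_mult_def inner_vec_def)
    then show "norm ((A *v x) $ i) \<le> norm (A $ i) * norm x"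
      using Cauchy_Schwarz_ineq2[of "A $ i" x] by simp
  qed simp
  also have "\<dots> = norm A * norm x"
    unfolding norm_vec_def[of A] by (simp add: L2_set_left_distrib)
  finally show ?thesis .
qed

lemma bounded_bilinear_matrix_vector_mult:
  "bounded_bilinear (\<lambda>(A :: real^'n^'m) x. A *v x)"
proof
  show "\<exists>K. \<forall>a b. norm ((a :: real^'n^'m) *v b) \<le> norm a * norm b * K"
    by (rule exI[of _ 1]) (simp add: norm_matrix_vector_mult_le)
qed (simp_all add: matrix_vector_mult_add_rdistrib matrix_vector_right_distrib
      scaleR_matrix_vector_assoc matrix_vector_mult_scaleR)

text \<open>The net in the integrability condition; \<open>defect\<close> is its antisymmetric part, up to a factor.\<close>

definition integrand where
  "integrand f = (\<lambda>\<epsilon> (x, y, v1, v2).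
     frechet_derivative (f \<epsilon>) (at (x, y)) (v1, f \<epsilon> (x, y) *v v1) *v v2)"

definition swap_vectors :: "'a \<times> 'b \<times> 'c \<times> 'c \<Rightarrow> 'a \<times> 'b \<times> 'c \<times> 'c" where
  "swap_vectors = (\<lambda>(x, y, v1, v2). (x, y, v2, v1))"

definition defect where
  "defect f \<epsilon> z = integrand f \<epsilon> z - integrand f \<epsilon> (swap_vectors z)"

lemma bounded_linear_swap_vectors:
  "bounded_linear (swap_vectors :: ('a::real_normed_vector \<times> 'b::real_normed_vector \<times> 'c::real_normed_vector \<times> 'c) \<Rightarrow> _)"
  unfolding swap_vectors_def case_prod_beta
  by (intro bounded_linear_Pair bounded_linear_fst_comp bounded_linear_snd_comp
      bounded_linear_ident bounded_linear_compose[OF bounded_linear_fst] bounded_linear_compose[OF bounded_linear_snd])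

text \<open>A fixed linear map from \<open>U\<close> into \<open>V\<close> is a c-bounded net, since images of compact sets are compact.\<close>

lemma moderate_nets_comp_linear:
  assumes "open U" "open V" "bounded_linear h" "h ` U \<subseteq> V" "u \<in> moderate_nets V"
  shows "(\<lambda>\<epsilon> x. u \<epsilon> (h x)) \<in> moderate_nets U"
proof -
  have "c_bounded U V (\<lambda>\<epsilon>. h)"
    unfolding c_bounded_iff
  proof (intro conjI allI impI)
    show "(\<lambda>\<epsilon>. h) \<in> moderate_nets U"
      by (rule moderate_nets_bounded_linear[OF assms(1,3) moderate_nets_id[OF assms(1)]])
    show "\<forall>\<^sub>F \<epsilon> in at_right (0::real). h ` U \<subseteq> V" using assms(4) by simp
    fix K assume "K \<subset>\<subset> U"
    then have K: "compact K" "K \<subseteq> U" by (simp_all add: compactly_contained_open[OF assms(1)])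
    have "compact (h ` K)"
      by (intro compact_continuous_image[OF _ K(1)] bounded_linear.continuous_on[OF assms(3)] continuous_on_id)
    then have "h ` K \<subset>\<subset> V"
      unfolding compactly_contained_open[OF assms(2)] using K(2) assms(4) by blast
    then show "\<exists>L. L \<subset>\<subset> V \<and> (\<forall>\<^sub>F \<epsilon> in at_right (0::real). h ` K \<subseteq> L)" by auto
  qed
  from moderate_comp_net[OF assms(1,2,5) this] show ?thesis
    using assms(4) by (simp add: comp_net_def o_def)
qed

lemma negl_bilinear_diff:
  assumes "bounded_bilinear h" "negl K (\<lambda>\<epsilon> x. f \<epsilon> x - f' \<epsilon> x)" "negl K (\<lambda>\<epsilon> x. g \<epsilon> x - g' \<epsilon> x)"
    and "ep.mod_bdd K g" "ep.mod_bdd K f'"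
  shows "negl K (\<lambda>\<epsilon> x. h (f \<epsilon> x) (g \<epsilon> x) - h (f' \<epsilon> x) (g' \<epsilon> x))"
proof -
  have "negl K (\<lambda>\<epsilon> x. h (f \<epsilon> x - f' \<epsilon> x) (g \<epsilon> x) + h (f' \<epsilon> x) (g \<epsilon> x - g' \<epsilon> x))"
    by (intro negl_add negl_bilinear[OF assms(1,2,4)]
        negl_bilinear[OF bounded_bilinear.flip[OF assms(1)] assms(3,5)])
  then show ?thesis
    by (rule negl_cong) (simp add: bounded_bilinear.diff_left[OF assms(1)] bounded_bilinear.diff_right[OF assms(1)])
qed

context
  fixes U :: "(real^'n) set" and V :: "(real^'m) set"
  assumes U: "open U" and V: "open V"
begin

\<comment> \<open>keeps the product below in the shape in which it occurs in the integrability condition\<close>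
declare UNIV_Times_UNIV [simp del]

definition base :: "(real^'n) \<times> (real^'m) \<times> (real^'n) \<times> (real^'n) \<Rightarrow> (real^'n) \<times> (real^'m)" where
  "base = (\<lambda>(x, y, v1, v2). (x, y))"

abbreviation "\<Omega> \<equiv> U \<times> V \<times> (UNIV :: (real^'n) set) \<times> (UNIV :: (real^'n) set)"

lemma open_UV: "open (U \<times> V)" and open_\<Omega>: "open \<Omega>"
  using U V by (simp_all add: open_Times)

lemma bounded_linear_base: "bounded_linear base"
  unfolding base_def case_prod_beta
  by (intro bounded_linear_Pair bounded_linear_fst bounded_linear_compose[OF bounded_linear_fst bounded_linear_snd])

lemma base_image: "base ` \<Omega> \<subseteq> U \<times> V"
  by (auto simp: base_def)

lemma base_compact:
  assumes "K \<subset>\<subset> \<Omega>"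
  shows "base ` K \<subset>\<subset> U \<times> V"
proof -
  have K: "compact K" "K \<subseteq> \<Omega>" using assms unfolding compactly_contained_open[OF open_\<Omega>] by blast+
  have "compact (base ` K)"
    by (intro compact_continuous_image[OF _ K(1)] bounded_linear.continuous_on[OF bounded_linear_base] continuous_on_id)
  moreover have "base ` K \<subseteq> U \<times> V" using K(2) base_image by blast
  ultimately show ?thesis by (simp add: compactly_contained_open[OF open_UV])
qed

text \<open>The vector in which \<open>f\<close> is differentiated. It depends on \<open>f\<close>, which makes the integrand
  quadratic in \<open>f\<close>; the expansion below exhibits it as a sum of products of moderate nets.\<close>

definition direction where
  "direction f \<epsilon> z = (fst (snd (snd z)), f \<epsilon> (base z) *v fst (snd (snd z)))"

lemma integrand_expand:
  assumes "f \<epsilon> differentiable at (base z)"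
  shows "integrand f \<epsilon> z
    = (\<Sum>b\<in>Basis. (direction f \<epsilon> z \<bullet> b) *\<^sub>R (partials [b] (f \<epsilon>) (base z) *v snd (snd (snd z))))"
proof -
  obtain x y v1 v2 where z: "z = (x, y, v1, v2)" by (cases z)
  have "integrand f \<epsilon> z = frechet_derivative (f \<epsilon>) (at (base z)) (direction f \<epsilon> z) *v snd (snd (snd z))"
    by (simp add: z integrand_def base_def direction_def)
  then show ?thesis
    unfolding frechet_derivative_expand[OF assms] matrix_sum_mult
    by (simp only: scaleR_matrix_vector_assoc)
qed

lemma moderate_last_vectors:
  "(\<lambda>\<epsilon> z. fst (snd (snd z))) \<in> moderate_nets \<Omega>" "(\<lambda>\<epsilon> z. snd (snd (snd z))) \<in> moderate_nets \<Omega>"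
  by (rule moderate_nets_bounded_linear[OF open_\<Omega> _ moderate_nets_id[OF open_\<Omega>]];
      intro bounded_linear_compose[OF bounded_linear_fst] bounded_linear_compose[OF bounded_linear_snd]
        bounded_linear_snd)+

lemma moderate_direction:
  assumes "f \<in> moderate_nets (U \<times> V)"
  shows "direction f \<in> moderate_nets \<Omega>"
  unfolding direction_def[abs_def]
  by (intro moderate_nets_Pair[OF open_\<Omega>] moderate_last_vectors
      moderate_nets_bilinear[OF open_\<Omega> bounded_bilinear_matrix_vector_mult]
      moderate_nets_comp_linear[OF open_\<Omega> open_UV bounded_linear_base base_image assms])

lemma moderate_integrand:
  fixes f :: "((real^'n) \<times> (real^'m), real^'n^'m) net"
  assumes "f \<in> moderate_nets (U \<times> V)"
  shows "integrand f \<in> moderate_nets \<Omega>"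
proof (rule moderate_nets_cong[OF open_\<Omega>])
  show "(\<lambda>\<epsilon> z. \<Sum>b\<in>Basis. (direction f \<epsilon> z \<bullet> b) *\<^sub>R (partials [b] (f \<epsilon>) (base z) *v snd (snd (snd z))))
      \<in> moderate_nets \<Omega>"
  proof (rule moderate_nets_sum[OF open_\<Omega>])
    fix b :: "(real^'n) \<times> (real^'m)" assume "b \<in> Basis"
    then have p: "(\<lambda>\<epsilon>. partials [b] (f \<epsilon>)) \<in> moderate_nets (U \<times> V)"
      by (intro moderate_nets_partials assms) auto
    show "(\<lambda>\<epsilon> z. (direction f \<epsilon> z \<bullet> b) *\<^sub>R (partials [b] (f \<epsilon>) (base z) *v snd (snd (snd z))))
        \<in> moderate_nets \<Omega>"
      by (intro moderate_nets_bilinear[OF open_\<Omega> bounded_bilinear_scaleR]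
          moderate_nets_bounded_linear[OF open_\<Omega> bounded_linear_inner_left] moderate_direction assms
          moderate_nets_bilinear[OF open_\<Omega> bounded_bilinear_matrix_vector_mult] moderate_last_vectors
          moderate_nets_comp_linear[OF open_\<Omega> open_UV bounded_linear_base base_image p])
  qed
  fix \<epsilon> :: real and z :: "(real^'n) \<times> (real^'m) \<times> (real^'n) \<times> (real^'n)"
  assume "\<epsilon> \<in> {0<..1}" "z \<in> \<Omega>"
  then have "f \<epsilon> differentiable at (base z)"
    using assms base_image by (auto simp: moderate_nets_def smooth_nets_def intro!: smooth_on_differentiable)
  then show "integrand f \<epsilon> z
    = (\<Sum>b\<in>Basis. (direction f \<epsilon> z \<bullet> b) *\<^sub>R (partials [b] (f \<epsilon>) (base z) *v snd (snd (snd z))))"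
    by (rule integrand_expand)
qed

lemma integrand_rel:
  fixes f :: "((real^'n) \<times> (real^'m), real^'n^'m) net"
  assumes "(f, g) \<in> colombeau_rel (U \<times> V)"
  shows "(integrand f, integrand g) \<in> colombeau_rel \<Omega>"
  unfolding colombeau_rel_iff[OF open_\<Omega>]
proof (intro conjI allI impI)
  have fg: "f \<in> moderate_nets (U \<times> V)" "g \<in> moderate_nets (U \<times> V)"
    using assms by (simp_all add: colombeau_rel_iff[OF open_UV])
  then show "integrand f \<in> moderate_nets \<Omega>" "integrand g \<in> moderate_nets \<Omega>"
    by (simp_all add: moderate_integrand)
  fix K assume K: "K \<subset>\<subset> \<Omega>"
  note bK = base_compact[OF K]
  have KU: "K \<subseteq> \<Omega>" using K by (simp add: compactly_contained_open open_\<Omega>)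
  have img: "\<forall>\<^sub>F \<epsilon> in at_right (0::real). base ` K \<subseteq> base ` K" by simp
  have negl_base: "negl K (\<lambda>\<epsilon> z. h \<epsilon> (base z))" if "negl (base ` K) h" for h :: "(_, 'c::real_normed_vector) net"
    using negl_compose[OF that img] .
  have fgn: "negl K (\<lambda>\<epsilon> z. f \<epsilon> (base z) - g \<epsilon> (base z))"
    using assms bK by (intro negl_base) (simp add: colombeau_rel_iff[OF open_UV])
  have md: "ep.mod_bdd K (direction f)" "ep.mod_bdd K (direction g)"
    using moderate_mod_bdd[OF moderate_direction K] fg by blast+
  note ml = moderate_mod_bdd[OF moderate_last_vectors(1) K] moderate_mod_bdd[OF moderate_last_vectors(2) K]
  have dn: "negl K (\<lambda>\<epsilon> z. direction f \<epsilon> z - direction g \<epsilon> z)"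
  proof (rule negl_mono_pointwise)
    show "negl K (\<lambda>\<epsilon> z. (f \<epsilon> (base z) - g \<epsilon> (base z)) *v fst (snd (snd z)))"
      by (rule negl_bilinear[OF bounded_bilinear_matrix_vector_mult fgn ml(1)])
    show "\<forall>\<^sub>F \<epsilon> in at_right 0. \<forall>z\<in>K. norm (direction f \<epsilon> z - direction g \<epsilon> z)
        \<le> norm ((f \<epsilon> (base z) - g \<epsilon> (base z)) *v fst (snd (snd z)))"
      by (simp add: direction_def norm_Pair matrix_vector_mult_diff_rdistrib)
  qed
  let ?t = "\<lambda>f \<epsilon> z b. (direction f \<epsilon> z \<bullet> b) *\<^sub>R (partials [b] (f \<epsilon>) (base z) *v snd (snd (snd z)))"
  have "negl K (\<lambda>\<epsilon> z. ?t f \<epsilon> z b - ?t g \<epsilon> z b)" if b: "b \<in> Basis" for b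
  proof (rule negl_bilinear_diff[OF bounded_bilinear_scaleR])
    show "negl K (\<lambda>\<epsilon> z. direction f \<epsilon> z \<bullet> b - direction g \<epsilon> z \<bullet> b)"
      using negl_linear[OF bounded_linear_inner_left dn, of b] by (simp add: inner_diff_left)
    show "ep.mod_bdd K (\<lambda>\<epsilon> z. direction g \<epsilon> z \<bullet> b)"
      by (rule ep.mod_bdd_linear[OF bounded_linear_inner_left md(2)])
    have pn: "negl K (\<lambda>\<epsilon> z. partials [b] (f \<epsilon>) (base z) - partials [b] (g \<epsilon>) (base z))"
      using negl_base[OF negl_partial_diff[OF open_UV assms bK b]] .
    show "negl K (\<lambda>\<epsilon> z. partials [b] (f \<epsilon>) (base z) *v snd (snd (snd z)) - partials [b] (g \<epsilon>) (base z) *v snd (snd (snd z)))"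
      using negl_bilinear[OF bounded_bilinear_matrix_vector_mult pn ml(2)]
      by (simp add: matrix_vector_mult_diff_rdistrib del: partials.simps)
    have "ep.mod_bdd (base ` K) (\<lambda>\<epsilon>. partials [b] (f \<epsilon>))"
      using b by (intro moderate_partial_mod_bdd[OF fg(1) bK]) auto
    from ep.mod_bdd_compose[OF this img]
    show "ep.mod_bdd K (\<lambda>\<epsilon> z. partials [b] (f \<epsilon>) (base z) *v snd (snd (snd z)))"
      by (rule ep.mod_bdd_bilinear[OF bounded_bilinear_matrix_vector_mult _ ml(2)])
  qed
  then have "negl K (\<lambda>\<epsilon> z. \<Sum>b\<in>Basis. ?t f \<epsilon> z b - ?t g \<epsilon> z b)" by (rule negl_sum)
  moreover have "\<forall>\<^sub>F \<epsilon> in at_right 0. \<forall>z\<in>K. integrand f \<epsilon> z - integrand g \<epsilon> z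
      = (\<Sum>b\<in>Basis. ?t f \<epsilon> z b - ?t g \<epsilon> z b)"
    using fg[THEN eventually_moderate_differentiable]
  proof eventually_elim
    case (elim \<epsilon>)
    show ?case
    proof
      fix z assume "z \<in> K"
      then have "base z \<in> U \<times> V" using KU base_image by blast
      then have "f \<epsilon> differentiable at (base z)" "g \<epsilon> differentiable at (base z)" using elim by auto
      then show "integrand f \<epsilon> z - integrand g \<epsilon> z = (\<Sum>b\<in>Basis. ?t f \<epsilon> z b - ?t g \<epsilon> z b)"
        by (simp only: integrand_expand sum_subtractf)
    qed
  qed
  ultimately show "negl K (\<lambda>\<epsilon> z. integrand f \<epsilon> z - integrand g \<epsilon> z)" by (rule negl_cong)
qed

lemma integrability_condition_iff:
  fixes F :: "((real^'n) \<times> (real^'m), real^'n^'m) net set"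
  assumes "F \<in> colombeau (U \<times> V)" "f \<in> F"
  shows "integrability_condition U V F \<longleftrightarrow> (\<forall>K. K \<subset>\<subset> \<Omega> \<longrightarrow> negl K (defect f))"
proof -
  have f: "f \<in> moderate_nets (U \<times> V)" by (rule colombeau_class(1)[OF open_UV assms])
  let ?I = "integrand f"
  have I: "?I \<in> moderate_nets \<Omega>" by (rule moderate_integrand[OF f])
  have T: "(\<lambda>F \<epsilon> (x, y, v1, v2). frechet_derivative (F \<epsilon>) (at (x, y)) (v1, F \<epsilon> (x, y) *v v1) *v v2)
      = (integrand :: ((real^'n) \<times> (real^'m), real^'n^'m) net \<Rightarrow> _)"
    by (simp add: integrand_def fun_eq_iff)
  have 1: "integrability_gfun U V F = colombeau_rel \<Omega> `` {?I}"
    unfolding integrability_gfun_def T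
    by (rule gfun_lift_eq[OF open_\<Omega> assms(2)]) (rule integrand_rel[OF colombeau_related[OF open_UV assms]])
  have S: "(\<lambda>G \<epsilon> (x, y, v1, v2). G \<epsilon> (x, y, v2, v1)) = (\<lambda>G \<epsilon> z. (G :: (_, real^'m) net) \<epsilon> (swap_vectors z))"
    by (simp add: fun_eq_iff swap_vectors_def)
  have sO: "swap_vectors ` \<Omega> \<subseteq> \<Omega>" by (auto simp: swap_vectors_def)
  have sm: "(\<lambda>\<epsilon> z. G \<epsilon> (swap_vectors z)) \<in> moderate_nets \<Omega>" if "G \<in> moderate_nets \<Omega>" for G :: "(_, real^'m) net"
    by (rule moderate_nets_comp_linear[OF open_\<Omega> open_\<Omega> bounded_linear_swap_vectors sO that])
  have sK: "swap_vectors ` K \<subset>\<subset> \<Omega>" if "K \<subset>\<subset> \<Omega>" for K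
    using compact_continuous_image[OF bounded_linear.continuous_on[OF bounded_linear_swap_vectors continuous_on_id], of K]
      sO that by (auto simp: compactly_contained_open open_\<Omega>)
  have 2: "gswap \<Omega> (colombeau_rel \<Omega> `` {?I}) = colombeau_rel \<Omega> `` {\<lambda>\<epsilon> z. ?I \<epsilon> (swap_vectors z)}"
    unfolding gswap_def S
  proof (rule gfun_lift_eq[OF open_\<Omega> colombeau_classI(2)[OF open_\<Omega> I]])
    fix G assume "G \<in> colombeau_rel \<Omega> `` {?I}"
    then have G: "G \<in> moderate_nets \<Omega>" "\<And>K. K \<subset>\<subset> \<Omega> \<Longrightarrow> negl K (\<lambda>\<epsilon> z. ?I \<epsilon> z - G \<epsilon> z)"
      by (simp_all add: colombeau_rel_iff[OF open_\<Omega>])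
    have "negl K (\<lambda>\<epsilon> z. ?I \<epsilon> (swap_vectors z) - G \<epsilon> (swap_vectors z))" if "K \<subset>\<subset> \<Omega>" for K
      using negl_compose[OF G(2)[OF sK[OF that]], of "\<lambda>_. swap_vectors" K] by simp
    then show "(\<lambda>\<epsilon> z. ?I \<epsilon> (swap_vectors z), \<lambda>\<epsilon> z. G \<epsilon> (swap_vectors z)) \<in> colombeau_rel \<Omega>"
      unfolding colombeau_rel_iff[OF open_\<Omega>] using sm[OF I] sm[OF G(1)] by blast
  qed
  have "integrability_condition U V F \<longleftrightarrow> ((\<lambda>\<epsilon> z. ?I \<epsilon> (swap_vectors z)), ?I) \<in> colombeau_rel \<Omega>"
    unfolding integrability_condition_def 1 2 by (rule colombeau_class_eq_iff[OF open_\<Omega> sm[OF I] I])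
  also have "\<dots> \<longleftrightarrow> (\<forall>K. K \<subset>\<subset> \<Omega> \<longrightarrow> negl K (\<lambda>\<epsilon> z. ?I \<epsilon> (swap_vectors z) - ?I \<epsilon> z))"
    unfolding colombeau_rel_iff[OF open_\<Omega>] using sm[OF I] I by blast
  also have "\<dots> \<longleftrightarrow> (\<forall>K. K \<subset>\<subset> \<Omega> \<longrightarrow> negl K (defect f))"
    by (simp add: negl_def defect_def norm_minus_commute)
  finally show ?thesis .
qed

lemma moderate_defect:
  assumes "f \<in> moderate_nets (U \<times> V)"
  shows "(defect f :: (_, real^'m) net) \<in> moderate_nets \<Omega>"
proof -
  have I: "integrand f \<in> moderate_nets \<Omega>" by (rule moderate_integrand[OF assms])
  have "(\<lambda>\<epsilon> z. integrand f \<epsilon> (swap_vectors z)) \<in> moderate_nets \<Omega>"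
    by (rule moderate_nets_comp_linear[OF open_\<Omega> open_\<Omega> bounded_linear_swap_vectors _ I])
       (auto simp: swap_vectors_def)
  from moderate_nets_diff[OF open_\<Omega> I this] show ?thesis
    by (simp add: defect_def[abs_def])
qed

end

section \<open>Solvability implies integrability\<close>

text \<open>If a net were not negligible on \<open>K\<close>, the points violating some estimate would, along a
  sequence \<open>\<epsilon>\<^sub>k \<rightarrow> 0\<close>, accumulate at some point of \<open>K\<close>; a net through them converges to that
  point. Hence convergent nets, i.e. near-standard points, suffice to test negligibility.\<close>

lemma negl_if_negl_on_convergent_nets:
  fixes G :: "('a::metric_space, 'b::real_normed_vector) net"
  assumes "compact K"
    and nets: "\<And>\<zeta> z. (\<And>\<epsilon>. \<zeta> \<epsilon> \<in> K) \<Longrightarrow> z \<in> K \<Longrightarrow> (\<zeta> \<longlongrightarrow> z) (at_right 0) \<Longrightarrow> negl {()} (\<lambda>\<epsilon> _. G \<epsilon> (\<zeta> \<epsilon>))"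
  shows "negl K G"
proof (rule ccontr)
  assume "\<not> negl K G"
  then obtain m where m: "\<not> (\<forall>\<^sub>F \<epsilon> in at_right 0. \<forall>x\<in>K. norm (G \<epsilon> x) \<le> \<epsilon> ^ m)"
    unfolding negl_def by blast
  have "\<exists>\<epsilon> x. 0 < \<epsilon> \<and> \<epsilon> \<le> inverse (real (Suc k)) \<and> x \<in> K \<and> \<epsilon> ^ m < norm (G \<epsilon> x)" for k
  proof (rule ccontr)
    assume n: "\<nexists>\<epsilon> x. 0 < \<epsilon> \<and> \<epsilon> \<le> inverse (real (Suc k)) \<and> x \<in> K \<and> \<epsilon> ^ m < norm (G \<epsilon> x)"
    have "\<forall>\<^sub>F \<epsilon> in at_right 0. 0 < \<epsilon> \<and> \<epsilon> \<le> inverse (real (Suc k))"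
      by (rule eventually_le_small) simp
    then have "\<forall>\<^sub>F \<epsilon> in at_right 0. \<forall>x\<in>K. norm (G \<epsilon> x) \<le> \<epsilon> ^ m"
      by eventually_elim (use n not_less in blast)
    with m show False by blast
  qed
  then have "\<forall>k. \<exists>p. 0 < fst p \<and> fst p \<le> inverse (real (Suc k)) \<and> snd p \<in> K \<and> fst p ^ m < norm (G (fst p) (snd p))"
    by simp
  from choice[OF this] obtain p where
    p: "\<And>k. 0 < fst (p k) \<and> fst (p k) \<le> inverse (real (Suc k)) \<and> snd (p k) \<in> K
      \<and> fst (p k) ^ m < norm (G (fst (p k)) (snd (p k)))"
    by blast
  define e where "e k = fst (p k)" for k
  define x where "x k = snd (p k)" for k
  have e: "0 < e k" "e k \<le> inverse (real (Suc k))" "x k \<in> K" "e k ^ m < norm (G (e k) (x k))" for k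
    using p by (simp_all add: e_def x_def)
  obtain z r where z: "z \<in> K" and r: "strict_mono r" and lim: "(x \<circ> r) \<longlonglongrightarrow> z"
    using assms(1) e(3) unfolding compact_eq_seq_compact_metric seq_compact_def by blast
  \<comment> \<open>different \<open>k\<close> may share the same \<open>e (r k)\<close>; any of them will do\<close>
  define \<zeta> where "\<zeta> \<epsilon> = (if \<exists>k. \<epsilon> = e (r k) then x (r (SOME k. \<epsilon> = e (r k))) else z)" for \<epsilon>
  have \<zeta>K: "\<zeta> \<epsilon> \<in> K" for \<epsilon> using e(3) z by (simp add: \<zeta>_def)
  have \<zeta>: "\<exists>k. \<epsilon> = e (r k) \<and> \<zeta> \<epsilon> = x (r k)" if "\<exists>k. \<epsilon> = e (r k)" for \<epsilon>
    using someI_ex[OF that] that by (auto simp: \<zeta>_def)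
  have "(\<zeta> \<longlongrightarrow> z) (at_right 0)"
  proof (rule tendstoI)
    fix \<eta> :: real assume "\<eta> > 0"
    then obtain N where N: "\<And>k. k \<ge> N \<Longrightarrow> dist (x (r k)) z < \<eta>"
      using lim unfolding lim_sequentially by auto
    define c where "c = Min (insert 1 ((\<lambda>k. e (r k)) ` {..<N}))"
    have c: "c > 0" "\<And>k. k < N \<Longrightarrow> c \<le> e (r k)" using e(1) by (auto simp: c_def)
    have "\<forall>\<^sub>F \<epsilon> in at_right 0. 0 < \<epsilon> \<and> \<epsilon> \<le> c / 2"
      by (rule eventually_le_small) (use c in simp)
    then show "\<forall>\<^sub>F \<epsilon> in at_right 0. dist (\<zeta> \<epsilon>) z < \<eta>"
    proof eventually_elim
      case (elim \<epsilon>)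
      show ?case
      proof (cases "\<exists>k. \<epsilon> = e (r k)")
        case True
        then obtain k where k: "\<epsilon> = e (r k)" "\<zeta> \<epsilon> = x (r k)" using \<zeta> by blast
        have "e (r k) < c" using k(1) elim c(1) by simp
        then have "k \<ge> N" using c(2) by (meson not_less)
        then show ?thesis using N k by simp
      next
        case False
        then show ?thesis using \<open>\<eta> > 0\<close> by (simp add: \<zeta>_def)
      qed
    qed
  qed
  then have "negl {()} (\<lambda>\<epsilon> _. G \<epsilon> (\<zeta> \<epsilon>))" by (rule nets[OF \<zeta>K z])
  then have "\<forall>\<^sub>F \<epsilon> in at_right 0. norm (G \<epsilon> (\<zeta> \<epsilon>)) \<le> \<epsilon> ^ m" unfolding negl_def by auto
  then obtain b where b: "b > 0" "\<And>\<epsilon>. 0 < \<epsilon> \<Longrightarrow> \<epsilon> < b \<Longrightarrow> norm (G \<epsilon> (\<zeta> \<epsilon>)) \<le> \<epsilon> ^ m"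
    unfolding eventually_at_right_field by auto
  obtain k where k: "inverse (real (Suc k)) < b" using reals_Archimedean[OF b(1)] by auto
  have "e (r k) < b"
  proof -
    have "k \<le> r k" using r by (rule seq_suble)
    then have "inverse (real (Suc (r k))) \<le> inverse (real (Suc k))" by (simp add: divide_simps)
    then show ?thesis using e(2)[of "r k"] k by linarith
  qed
  then have "norm (G (e (r k)) (\<zeta> (e (r k)))) \<le> e (r k) ^ m" using b(2) e(1) by blast
  moreover obtain j where "e (r k) = e (r j)" "\<zeta> (e (r k)) = x (r j)" using \<zeta>[of "e (r k)"] by blast
  ultimately show False using e(4)[of "r j"] by simp
qed

text \<open>For a solution of \<open>Da = f(\<cdot>, a) + R\<close> the symmetric second derivative of \<open>a\<close> is, up to terms
  containing \<open>R\<close> or its derivative, the expression in the integrability condition along the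
  graph of \<open>a\<close>.\<close>

lemma defect_bound:
  fixes a :: "real^'n \<Rightarrow> real^'m" and f :: "((real^'n) \<times> (real^'m), real^'n^'m) net"
  assumes "open U'" "smooth_on U' a" "smooth_on U' R" "x \<in> U'"
    and "\<And>y. y \<in> U' \<Longrightarrow> f \<epsilon> differentiable at (y, a y)"
    and eq: "\<And>y. y \<in> U' \<Longrightarrow> jacobian a (at y) = f \<epsilon> (y, a y) + R y"
  shows "norm (defect f \<epsilon> (x, a x, v, w)) \<le> 2 * norm v * norm w *
    ((\<Sum>b\<in>Basis. norm (partials [b] R x)) + (\<Sum>b\<in>Basis. norm (partials [b] (f \<epsilon>) (x, a x))) * norm (R x))"
proof -
  let ?Df = "frechet_derivative (f \<epsilon>) (at (x, a x))"
  let ?DR = "frechet_derivative R (at x)"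
  let ?E = "\<lambda>v. ?Df (0, R x *v v) + ?DR v"
  define S where "S = (\<Sum>b\<in>Basis. norm (partials [b] R x))
    + (\<Sum>b\<in>Basis. norm (partials [b] (f \<epsilon>) (x, a x))) * norm (R x)"
  have a: "a differentiable at x" and R: "R differentiable at x" and f: "f \<epsilon> differentiable at (x, a x)"
    using assms smooth_on_differentiable by blast+
  have linf: "linear ?Df" using f by (rule linear_frechet_derivative)
  have Da: "frechet_derivative a (at x) v = f \<epsilon> (x, a x) *v v + R x *v v" for v
    unfolding jacobian_mult[OF a, symmetric] eq[OF assms(4)] by (rule matrix_vector_mult_add_rdistrib)
  have second: "frechet_derivative (\<lambda>y. frechet_derivative a (at y) w) (at x) v
      = ?Df (v, f \<epsilon> (x, a x) *v v) *v w + ?E v *v w" for v w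
  proof -
    have pair: "((\<lambda>y. (y, a y)) has_derivative (\<lambda>v. (v, frechet_derivative a (at x) v))) (at x)"
      using a by (auto simp: frechet_derivative_works intro!: has_derivative_Pair)
    have "((\<lambda>y. f \<epsilon> (y, a y)) has_derivative (\<lambda>v. ?Df (v, frechet_derivative a (at x) v))) (at x)"
      using has_derivative_compose[OF pair] f by (simp add: frechet_derivative_works)
    moreover have "(R has_derivative ?DR) (at x)" using R by (simp add: frechet_derivative_works)
    ultimately have "((\<lambda>y. f \<epsilon> (y, a y) + R y) has_derivative
        (\<lambda>v. ?Df (v, frechet_derivative a (at x) v) + ?DR v)) (at x)"
      by (rule has_derivative_add)
    then have "((\<lambda>y. (f \<epsilon> (y, a y) + R y) *v w) has_derivative
        (\<lambda>v. (?Df (v, frechet_derivative a (at x) v) + ?DR v) *v w)) (at x)"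
      by (rule bounded_linear.has_derivative[OF bounded_bilinear.bounded_linear_left[OF bounded_bilinear_matrix_vector_mult]])
    moreover have "frechet_derivative (\<lambda>y. frechet_derivative a (at y) w) (at x)
        = frechet_derivative (\<lambda>y. (f \<epsilon> (y, a y) + R y) *v w) (at x)"
      by (rule frechet_derivative_cong_open[OF assms(1,4)])
         (use eq jacobian_mult smooth_on_differentiable[OF assms(2)] in metis)
    ultimately have "frechet_derivative (\<lambda>y. frechet_derivative a (at y) w) (at x) v
        = (?Df (v, frechet_derivative a (at x) v) + ?DR v) *v w"
      by (simp add: frechet_derivative_eq)
    moreover have "?Df (v, frechet_derivative a (at x) v) = ?Df (v, f \<epsilon> (x, a x) *v v) + ?Df (0, R x *v v)"
      unfolding Da using linear_add[OF linf, of "(v, f \<epsilon> (x, a x) *v v)" "(0, R x *v v)"] by simp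
    ultimately show ?thesis by (simp add: matrix_vector_mult_add_rdistrib)
  qed
  have defect: "defect f \<epsilon> (x, a x, v, w) = ?E w *v v - ?E v *v w"
    using second_derivative_symmetric[OF assms(1,2,4), of w v] second[of v w] second[of w v]
    by (simp add: defect_def integrand_def swap_vectors_def algebra_simps)
  have E: "norm (?E v *v w) \<le> norm v * norm w * S" for v w
  proof -
    have "norm (?Df (0, R x *v v)) \<le> (\<Sum>b\<in>Basis. norm (partials [b] (f \<epsilon>) (x, a x))) * norm (R x *v v)"
      using norm_frechet_derivative_le[OF f, of "(0, R x *v v)"] by (simp add: norm_Pair)
    also have "\<dots> \<le> (\<Sum>b\<in>Basis. norm (partials [b] (f \<epsilon>) (x, a x))) * (norm (R x) * norm v)"
      by (intro mult_left_mono norm_matrix_vector_mult_le sum_nonneg) simp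
    finally have 1: "norm (?Df (0, R x *v v)) \<le> (\<Sum>b\<in>Basis. norm (partials [b] (f \<epsilon>) (x, a x))) * (norm (R x) * norm v)" .
    have 2: "norm (?DR v) \<le> (\<Sum>b\<in>Basis. norm (partials [b] R x)) * norm v"
      by (rule norm_frechet_derivative_le[OF R])
    have "norm (?E v) \<le> S * norm v"
      using norm_triangle_ineq[of "?Df (0, R x *v v)" "?DR v"] 1 2
      by (simp add: S_def algebra_simps del: partials.simps)
    then have "norm (?E v) * norm w \<le> S * norm v * norm w"
      by (rule mult_right_mono) simp
    then show ?thesis
      using norm_matrix_vector_mult_le[of "?E v" w] by (simp only: mult_ac)
  qed
  have "norm (defect f \<epsilon> (x, a x, v, w)) \<le> norm w * norm v * S + norm v * norm w * S"
    unfolding defect by (rule order_trans[OF norm_triangle_ineq4 add_mono[OF E E]])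
  also have "\<dots> = 2 * norm v * norm w * S" by simp
  finally show ?thesis unfolding S_def .
qed

lemma compact_point_in_gpoints_c:
  fixes x :: "'a::euclidean_space pnet"
  assumes "open U" "compact K" "K \<subseteq> U" "\<And>\<epsilon>. x \<epsilon> \<in> K"
  shows "x \<in> moderate_points U" "gpoint_rel U `` {x} \<in> gpoints_c U"
proof -
  obtain C where "\<And>y. y \<in> K \<Longrightarrow> norm y \<le> C"
    using compact_imp_bounded[OF assms(2)] by (auto simp: bounded_iff)
  then have "ep.mod_bdd {()} (\<lambda>\<epsilon> _. x \<epsilon>)"
    using assms(4) by (intro ep.mod_bddI[where C=C and M=0]) simp
  then show x: "x \<in> moderate_points U"
    using assms(3,4) by (auto simp: moderate_points_iff)
  have K: "K \<subset>\<subset> U" using assms by (simp add: compactly_contained_open)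
  have "\<exists>\<epsilon>0\<in>{0<..1::real}. \<forall>\<epsilon>\<in>{0<..\<epsilon>0}. x \<epsilon> \<in> K"
    using assms(4) by (intro bexI[of _ 1]) auto
  then show "gpoint_rel U `` {x} \<in> gpoints_c U"
    using gpoint_classI[OF x] K unfolding gpoints_c_def by blast
qed

text \<open>A convergent net of points \<open>(x, y, v, w)\<close> provides an initial condition \<open>u(x) = y\<close>. Along the
  graph of the solution the defect is negligible, and the graph passes through \<open>(x, y)\<close> up to a
  negligible error.\<close>

lemma integrable_if_solvable:
  fixes U :: "(real^'n) set" and V :: "(real^'m) set"
    and F :: "((real^'n) \<times> (real^'m), real^'n^'m) net set"
  assumes U: "open U" and V: "open V" and F: "F \<in> colombeau (U \<times> V)"
    and solvable: "\<And>X Y x0. X \<in> gpoints_c U \<Longrightarrow> Y \<in> gpoints_c V \<Longrightarrow> x0 \<in> U \<Longrightarrow> near_standard X x0 \<Longrightarrow>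
      \<exists>U' W u. open U' \<and> x0 \<in> U' \<and> U' \<subseteq> U \<and> open W \<and> W \<subseteq> V \<and> is_solution U V F X Y U' W u"
  shows "integrability_condition U V F"
proof -
  let ?\<Omega> = "U \<times> V \<times> (UNIV :: (real^'n) set) \<times> (UNIV :: (real^'n) set)"
  have UV: "open (U \<times> V)" and \<Omega>: "open ?\<Omega>" using U V by (simp_all add: open_Times)
  obtain f where f: "f \<in> F" using colombeau_ex_rep[OF UV F] by blast
  have fm: "f \<in> moderate_nets (U \<times> V)" by (rule colombeau_class(1)[OF UV F f])
  have "negl K (defect f)" if K: "K \<subset>\<subset> ?\<Omega>" for K
  proof (rule negl_if_negl_on_convergent_nets)
    show cK: "compact K" using K unfolding compactly_contained_open[OF \<Omega>] by blast
    have KO: "K \<subseteq> ?\<Omega>" using K unfolding compactly_contained_open[OF \<Omega>] by blast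
    fix \<zeta> :: "real \<Rightarrow> (real^'n) \<times> (real^'m) \<times> (real^'n) \<times> (real^'n)" and z
    assume \<zeta>: "\<And>\<epsilon>. \<zeta> \<epsilon> \<in> K" and z: "z \<in> K" and lim: "(\<zeta> \<longlongrightarrow> z) (at_right 0)"
    define x where "x \<epsilon> = fst (\<zeta> \<epsilon>)" for \<epsilon>
    define y where "y \<epsilon> = fst (snd (\<zeta> \<epsilon>))" for \<epsilon>
    define v where "v \<epsilon> = fst (snd (snd (\<zeta> \<epsilon>)))" for \<epsilon>
    define w where "w \<epsilon> = snd (snd (snd (\<zeta> \<epsilon>)))" for \<epsilon>
    define x0 where "x0 = fst z"
    have \<zeta>eq: "\<zeta> \<epsilon> = (x \<epsilon>, y \<epsilon>, v \<epsilon>, w \<epsilon>)" for \<epsilon> by (simp add: x_def y_def v_def w_def)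
    have limx: "(x \<longlongrightarrow> x0) (at_right 0)" unfolding x_def[abs_def] x0_def by (rule tendsto_fst[OF lim])
    have x0: "x0 \<in> U" using z KO by (auto simp: x0_def)
    have cx: "compact (fst ` K)" "fst ` K \<subseteq> U" "\<And>\<epsilon>. x \<epsilon> \<in> fst ` K"
      using cK KO \<zeta> by (auto simp: x_def intro!: compact_continuous_image continuous_on_fst continuous_on_id)
    have cy: "compact ((\<lambda>z. fst (snd z)) ` K)" "(\<lambda>z. fst (snd z)) ` K \<subseteq> V" "\<And>\<epsilon>. y \<epsilon> \<in> (\<lambda>z. fst (snd z)) ` K"
      using cK KO \<zeta> by (auto simp: y_def intro!: compact_continuous_image continuous_on_fst continuous_on_snd continuous_on_id)
    define X where "X = gpoint_rel U `` {x}"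
    define Y where "Y = gpoint_rel V `` {y}"
    have X: "X \<in> gpoints_c U" "x \<in> X"
      using compact_point_in_gpoints_c[where x=x, OF U cx] gpoint_classI(2)[of x U] by (simp_all add: X_def)
    have Y: "Y \<in> gpoints_c V" "y \<in> Y"
      using compact_point_in_gpoints_c[where x=y, OF V cy] gpoint_classI(2)[of y V] by (simp_all add: Y_def)
    have "near_standard X x0" using X(2) limx by (auto simp: near_standard_def)
    then obtain U' W u where U': "open U'" "x0 \<in> U'" "U' \<subseteq> U" and W: "open W" "W \<subseteq> V"
      and sol: "is_solution U V F X Y U' W u"
      using solvable[OF X(1) Y(1) x0] by blast
    obtain a where u: "u \<in> colombeau U'" "a \<in> u" and cb: "c_bounded U' W a"
      using sol by (auto simp: is_solution_def colombeau_cb_def)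
    have am: "a \<in> moderate_nets U'" by (rule c_boundedD(1)[OF cb])
    let ?p = "\<lambda>\<epsilon> x. (x, a \<epsilon> x)"
    let ?fa = "comp_net U' (U \<times> V) f ?p"
    have cbp: "c_bounded U' (U \<times> V) ?p" by (rule c_bounded_Pair_id[OF U V U'(1) W(1) U'(3) W(2) cb])
    define R where "R \<epsilon> x = jacobian (a \<epsilon>) (at x) - ?fa \<epsilon> x" for \<epsilon> x
    have rel: "(\<lambda>\<epsilon> x. jacobian (a \<epsilon>) (at x), ?fa) \<in> colombeau_rel U'"
      using sol gderiv_eq_gcompose_iff[OF U V U'(1) W(1) U'(3) W(2) F f u cb] by (simp add: is_solution_def)
    then have Rm: "R \<in> moderate_nets U'" and Rn: "\<And>K. K \<subset>\<subset> U' \<Longrightarrow> negl K R"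
      using moderate_nets_diff[OF U'(1)] unfolding colombeau_rel_iff[OF U'(1)] R_def[abs_def] by blast+
    have init: "pnet_equiv (\<lambda>\<epsilon>. a \<epsilon> (x \<epsilon>)) y"
      using sol initial_condition_iff[OF U'(1,3,2) _ X(2) limx u _ Y(2)] X(1) Y(1)
      by (auto simp: is_solution_def gpoints_c_def)
    define q where "q \<epsilon> = (x \<epsilon>, a \<epsilon> (x \<epsilon>), v \<epsilon>, w \<epsilon>)" for \<epsilon>
    have qz: "negl {()} (\<lambda>\<epsilon> _. q \<epsilon> - \<zeta> \<epsilon>)"
      using init unfolding pnet_equiv_iff
      by (rule negl_mono_pointwise) (simp add: q_def \<zeta>eq norm_Pair)
    have 1: "negl {()} (\<lambda>\<epsilon> _. defect f \<epsilon> (q \<epsilon>) - defect f \<epsilon> (\<zeta> \<epsilon>))"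
      by (rule moderate_perturb[OF \<Omega> K moderate_defect[OF U V fm] _ qz]) (use \<zeta> in simp)
    obtain r where r: "r > 0" "cball x0 r \<subseteq> U'" using U' open_contains_cball by blast
    let ?K = "cball x0 r"
    have K0: "?K \<subset>\<subset> U'" using r by (simp add: compactly_contained_open[OF U'(1)])
    obtain L where L: "L \<subset>\<subset> U \<times> V" "\<forall>\<^sub>F \<epsilon> in at_right 0. ?p \<epsilon> ` ?K \<subseteq> L"
      using c_bounded_compactE[OF cbp K0] .
    define E where "E \<epsilon> x = (\<Sum>b\<in>Basis. norm (partials [b] (R \<epsilon>) x))
      + (\<Sum>b\<in>Basis. norm (partials [b] (f \<epsilon>) (x, a \<epsilon> x))) * norm (R \<epsilon> x)" for \<epsilon> x
    have En: "negl ?K E"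
      unfolding E_def[abs_def]
    proof (intro negl_add negl_sum)
      show "negl ?K (\<lambda>\<epsilon> x. norm (partials [b] (R \<epsilon>) x))" if "b \<in> Basis" for b
        unfolding negl_norm by (rule negl_partial[OF U'(1) Rm Rn K0 that])
      have "ep.mod_bdd ?K (\<lambda>\<epsilon> x. \<Sum>b\<in>Basis. norm (partials [b] (f \<epsilon>) (x, a \<epsilon> x)))"
      proof (rule ep.mod_bdd_sum)
        fix b :: "(real^'n) \<times> (real^'m)" assume "b \<in> Basis"
        then have "ep.mod_bdd L (\<lambda>\<epsilon>. partials [b] (f \<epsilon>))"
          by (intro moderate_partial_mod_bdd[OF fm L(1)]) auto
        from ep.mod_bdd_compose[OF this L(2)]
        show "ep.mod_bdd ?K (\<lambda>\<epsilon> x. norm (partials [b] (f \<epsilon>) (x, a \<epsilon> x)))"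
          by (rule ep.mod_bdd_mono) simp
      qed
      moreover have "negl ?K (\<lambda>\<epsilon> x. norm (R \<epsilon> x))" unfolding negl_norm by (rule Rn[OF K0])
      ultimately show "negl ?K (\<lambda>\<epsilon> x. (\<Sum>b\<in>Basis. norm (partials [b] (f \<epsilon>) (x, a \<epsilon> x))) * norm (R \<epsilon> x))"
        by (intro negl_bilinear[OF bounded_bilinear.flip[OF bounded_bilinear_mult]])
    qed
    have xK: "\<forall>\<^sub>F \<epsilon> in at_right 0. x \<epsilon> \<in> ?K" by (rule tendsto_eventually_in_cball[OF limx r(1)])
    have "negl {()} (\<lambda>\<epsilon> _. E \<epsilon> (x \<epsilon>))"
      by (rule negl_compose[OF En]) (use xK in simp)
    obtain C where C: "\<And>z. z \<in> K \<Longrightarrow> norm z \<le> C"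
      using compact_imp_bounded[OF cK] by (auto simp: bounded_iff)
    have CE: "negl {()} (\<lambda>\<epsilon> _. 2 * C * C * E \<epsilon> (x \<epsilon>))"
      by (rule negl_linear[OF bounded_linear_mult_right]) fact
    have le: "\<forall>\<^sub>F \<epsilon> in at_right 0. norm (defect f \<epsilon> (q \<epsilon>)) \<le> norm (2 * C * C * E \<epsilon> (x \<epsilon>))"
      using xK comp_net_eventually[OF cbp, of f] c_boundedD(2)[OF cbp]
        smooth_nets_eventually[OF moderate_nets_smooth[OF am]]
        smooth_nets_eventually[OF moderate_nets_smooth[OF Rm]]
        eventually_moderate_differentiable[OF fm]
    proof eventually_elim
      case (elim \<epsilon>)
      have "norm (defect f \<epsilon> (q \<epsilon>)) \<le> 2 * norm (v \<epsilon>) * norm (w \<epsilon>) * E \<epsilon> (x \<epsilon>)"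
        unfolding q_def E_def
      proof (rule defect_bound[OF U'(1) elim(4,5)])
        show "x \<epsilon> \<in> U'" using elim(1) r by blast
        show "f \<epsilon> differentiable at (y, a \<epsilon> y)" if "y \<in> U'" for y
          using elim(3,6) that by blast
        show "jacobian (a \<epsilon>) (at y) = f \<epsilon> (y, a \<epsilon> y) + R \<epsilon> y" for y
          using elim(2) by (simp add: R_def)
      qed
      also have "\<dots> \<le> 2 * C * C * E \<epsilon> (x \<epsilon>)"
      proof (rule mult_right_mono)
        have "norm (v \<epsilon>, w \<epsilon>) \<le> norm (\<zeta> \<epsilon>)"
          unfolding \<zeta>eq using norm_snd_le[of "(v \<epsilon>, w \<epsilon>)" "y \<epsilon>"] norm_snd_le[of "(y \<epsilon>, v \<epsilon>, w \<epsilon>)" "x \<epsilon>"]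
          by linarith
        then have "norm (v \<epsilon>) \<le> norm (\<zeta> \<epsilon>)" "norm (w \<epsilon>) \<le> norm (\<zeta> \<epsilon>)"
          using norm_fst_le[of "v \<epsilon>" "w \<epsilon>"] norm_snd_le[of "w \<epsilon>" "v \<epsilon>"] by linarith+
        then have "norm (v \<epsilon>) \<le> C" "norm (w \<epsilon>) \<le> C" using C[OF \<zeta>[of \<epsilon>]] by linarith+
        then show "2 * norm (v \<epsilon>) * norm (w \<epsilon>) \<le> 2 * C * C" by (intro mult_mono) (simp_all add: order_trans[OF norm_ge_zero])
        show "0 \<le> E \<epsilon> (x \<epsilon>)" unfolding E_def by (intro add_nonneg_nonneg sum_nonneg mult_nonneg_nonneg) auto
      qed
      also have "\<dots> \<le> norm (2 * C * C * E \<epsilon> (x \<epsilon>))" by simp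
      finally show ?case .
    qed
    have 2: "negl {()} (\<lambda>\<epsilon> _. defect f \<epsilon> (q \<epsilon>))"
      by (rule negl_mono_pointwise[OF CE]) (rule eventually_mono[OF le], simp)
    from negl_diff[OF 2 1] show "negl {()} (\<lambda>\<epsilon> _. defect f \<epsilon> (\<zeta> \<epsilon>))" by simp
  qed
  then show ?thesis using integrability_condition_iff[OF U V F f] by blast
qed

section \<open>Uniqueness\<close>

text \<open>Gronwall's inequality, proved by showing that \<open>(\<bar>f\<bar>\<^sup>2 + d\<^sup>2) e\<^bsup>-(2\<Lambda>+1)t\<^esup>\<close> is not increasing.\<close>

lemma gronwall_norm:
  fixes f :: "real \<Rightarrow> 'a::real_inner"
  assumes deriv: "\<And>t. t \<in> {0..1} \<Longrightarrow> (f has_vector_derivative f' t) (at t)"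
    and bound: "\<And>t. t \<in> {0..1} \<Longrightarrow> norm (f' t) \<le> \<Lambda> * norm (f t) + d"
    and "\<Lambda> \<ge> 0" "d \<ge> 0"
  shows "norm (f 1) \<le> (norm (f 0) + d) * exp (\<Lambda> + 1)"
proof -
  define c where "c = 2 * \<Lambda> + 1"
  define \<phi> where "\<phi> t = (f t \<bullet> f t + d\<^sup>2) * exp (- c * t)" for t
  have "\<phi> 1 \<le> \<phi> 0"
  proof (rule DERIV_nonpos_imp_nonincreasing[of 0 1])
    fix t :: real assume t: "0 \<le> t" "t \<le> 1"
    then have "(f has_vector_derivative f' t) (at t)" using deriv by simp
    then have "((\<lambda>t. f t \<bullet> f t) has_real_derivative 2 * (f t \<bullet> f' t)) (at t)"
      unfolding has_vector_derivative_def has_field_derivative_def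
      by (auto intro!: derivative_eq_intros simp: inner_commute fun_eq_iff)
    then have "(\<phi> has_real_derivative (2 * (f t \<bullet> f' t) - c * (f t \<bullet> f t + d\<^sup>2)) * exp (- c * t)) (at t)"
      unfolding \<phi>_def by (auto intro!: derivative_eq_intros simp: algebra_simps)
    moreover have "(2 * (f t \<bullet> f' t) - c * (f t \<bullet> f t + d\<^sup>2)) * exp (- c * t) \<le> 0"
    proof (rule mult_nonpos_nonneg)
      have "f t \<bullet> f' t \<le> norm (f t) * norm (f' t)" by (rule norm_cauchy_schwarz)
      also have "\<dots> \<le> norm (f t) * (\<Lambda> * norm (f t) + d)"
        using bound t by (intro mult_left_mono) auto
      finally have "2 * (f t \<bullet> f' t) \<le> 2 * \<Lambda> * (norm (f t))\<^sup>2 + 2 * norm (f t) * d"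
        by (simp add: power2_eq_square algebra_simps)
      moreover have "2 * norm (f t) * d \<le> (norm (f t))\<^sup>2 + d\<^sup>2"
        using sum_squares_bound[of "norm (f t)" d] by simp
      moreover have "0 \<le> 2 * \<Lambda> * d\<^sup>2" using assms(3) by simp
      moreover have "c * (f t \<bullet> f t + d\<^sup>2) = 2 * \<Lambda> * (norm (f t))\<^sup>2 + 2 * \<Lambda> * d\<^sup>2 + (norm (f t))\<^sup>2 + d\<^sup>2"
        by (simp add: c_def power2_norm_eq_inner algebra_simps)
      ultimately show "2 * (f t \<bullet> f' t) - c * (f t \<bullet> f t + d\<^sup>2) \<le> 0" by linarith
    qed simp
    ultimately show "\<exists>y. (\<phi> has_real_derivative y) (at t) \<and> y \<le> 0" by blast
  qed simp
  then have "(norm (f 1))\<^sup>2 + d\<^sup>2 \<le> ((norm (f 0))\<^sup>2 + d\<^sup>2) * exp c"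
    by (simp add: \<phi>_def power2_norm_eq_inner exp_minus field_simps)
  moreover have "((norm (f 0))\<^sup>2 + d\<^sup>2) * exp c \<le> (norm (f 0) + d)\<^sup>2 * (exp (\<Lambda> + 1))\<^sup>2"
  proof (rule mult_mono)
    show "(norm (f 0))\<^sup>2 + d\<^sup>2 \<le> (norm (f 0) + d)\<^sup>2" using assms(4) by (simp add: power2_sum)
    show "exp c \<le> (exp (\<Lambda> + 1))\<^sup>2" by (simp add: c_def power2_eq_square exp_add[symmetric])
  qed simp_all
  ultimately have "(norm (f 1))\<^sup>2 \<le> ((norm (f 0) + d) * exp (\<Lambda> + 1))\<^sup>2"
    using zero_le_power2[of d] by (simp only: power_mult_distrib)
  then show ?thesis by (rule power2_le_imp_le) (use assms(4) in simp)
qed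

text \<open>This is where the logarithmic growth of \<open>\<partial>\<^sub>2F\<close> enters: the factors produced by Gronwall's
  inequality are bounded by a power of \<open>1/\<epsilon>\<close>.\<close>

lemma exp_log_moderate:
  assumes "C \<ge> 0"
  obtains N where "\<forall>\<^sub>F \<epsilon> in at_right (0::real). exp (A + C * \<bar>ln \<epsilon>\<bar>) \<le> inverse \<epsilon> ^ N"
proof -
  obtain p where p: "\<forall>\<^sub>F \<epsilon> in at_right 0. exp A \<le> inverse \<epsilon> ^ p" by (rule ep.const_le_scale_power)
  define n where "n = nat \<lceil>C\<rceil>"
  have n: "C \<le> real n" unfolding n_def by linarith
  have "\<forall>\<^sub>F \<epsilon> in at_right (0::real). exp (A + C * \<bar>ln \<epsilon>\<bar>) \<le> inverse \<epsilon> ^ (p + n)"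
    using p eventually_unit
  proof eventually_elim
    case (elim \<epsilon>)
    have "exp (C * \<bar>ln \<epsilon>\<bar>) \<le> exp (real n * \<bar>ln \<epsilon>\<bar>)" using n by (simp add: mult_right_mono)
    also have "\<dots> = inverse \<epsilon> ^ n"
      using elim by (simp add: exp_of_nat_mult abs_of_nonpos exp_minus power_inverse)
    finally show ?case using elim unfolding exp_add power_add by (intro mult_mono) auto
  qed
  then show ?thesis by (rule that)
qed

lemma compact_in_ballE:
  assumes "compact K" "K \<subseteq> ball x0 r" "r > 0"
  obtains \<rho> where "0 < \<rho>" "\<rho> < r" "K \<subseteq> cball x0 \<rho>"
proof (cases "K = {}")
  case True
  then show ?thesis using that[of "r/2"] assms(3) by simp
next
  case False
  have "continuous_on K (dist x0)" by (intro continuous_intros)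
  then obtain y where y: "y \<in> K" "\<And>z. z \<in> K \<Longrightarrow> dist x0 z \<le> dist x0 y"
    using continuous_attains_sup[OF assms(1) False, of "dist x0"] by blast
  show ?thesis
  proof (rule that[of "max (dist x0 y) (r/2)"])
    show "K \<subseteq> cball x0 (max (dist x0 y) (r/2))" using y(2) by (auto simp: le_max_iff_disj)
  qed (use y(1) assms in auto)
qed

text \<open>For points closer than \<open>\<delta>\<close> the segment between them lies in \<open>W\<close> and the bound on the derivative
  applies. A segment between distant points may leave \<open>W\<close>; there the bound on the values suffices.\<close>

lemma lipschitz_from_bounds:
  fixes g :: "'a::euclidean_space \<Rightarrow> 'b::real_normed_vector"
  assumes "\<And>y. y \<in> W \<Longrightarrow> (g has_derivative g' y) (at y)" "\<And>y k. y \<in> W \<Longrightarrow> norm (g' y k) \<le> B * norm k"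
    and "\<And>y. y \<in> W \<Longrightarrow> norm (g y) \<le> A" "\<delta> > 0" "(\<Union>y\<in>L. cball y \<delta>) \<subseteq> W" "B \<ge> 0" "A \<ge> 0" "y1 \<in> L" "y2 \<in> L"
  shows "norm (g y1 - g y2) \<le> (B + 2 * A / \<delta>) * norm (y1 - y2)"
proof (cases "norm (y1 - y2) \<le> \<delta>")
  case True
  have sub: "cball y2 \<delta> \<subseteq> W" using assms by blast
  have "norm (g y1 - g y2) \<le> B * norm (y1 - y2)"
  proof (rule differentiable_bound[OF convex_cball])
    show "(g has_derivative g' y) (at y within cball y2 \<delta>)" if "y \<in> cball y2 \<delta>" for y
      by (rule has_derivative_at_withinI[OF assms(1)]) (use sub that in blast)
    show "onorm (g' y) \<le> B" if "y \<in> cball y2 \<delta>" for y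
      by (rule onorm_le, rule assms(2)) (use sub that in blast)
  qed (use True assms in \<open>auto simp: dist_norm norm_minus_commute\<close>)
  also have "\<dots> \<le> (B + 2 * A / \<delta>) * norm (y1 - y2)" using assms by (intro mult_right_mono) auto
  finally show ?thesis .
next
  case False
  have "y1 \<in> W" "y2 \<in> W" using assms(4,5,8,9) by (auto intro!: subsetD[OF assms(5)])
  then have "norm (g y1 - g y2) \<le> 2 * A"
    using assms(3)[of y1] assms(3)[of y2] norm_triangle_ineq4[of "g y1" "g y2"] by linarith
  also have "\<dots> = (2 * A / \<delta>) * \<delta>" using assms(4) by simp
  also have "\<dots> \<le> (B + 2 * A / \<delta>) * norm (y1 - y2)"
    using False assms by (intro mult_mono) auto
  finally show ?thesis .
qed

text \<open>Along the segment from \<open>\<xi>\<^sub>\<epsilon>\<close> to a point \<open>x\<close> the difference of two solutions has a derivative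
  bounded by \<open>O(\<bar>log \<epsilon>\<bar>)\<close> times the difference plus the residuals. Gronwall's inequality applies.\<close>

lemma solutions_agree:
  fixes f :: "((real^'n) \<times> (real^'m), real^'n^'m) net" and a1 a2 :: "(real^'n, real^'m) net"
  assumes U: "open U" and V: "open V" and W: "open W" "W \<subseteq> V" and r: "r > 0" "ball x0 r \<subseteq> U"
    and f: "f \<in> moderate_nets (U \<times> V)" and A: "A \<ge> 0" and C: "C \<ge> 0"
    and bound: "\<forall>\<^sub>F \<epsilon> in at_right 0. \<forall>x\<in>ball x0 r. \<forall>y\<in>W. norm (f \<epsilon> (x, y)) \<le> A"
    and lip: "\<forall>\<^sub>F \<epsilon> in at_right 0. \<forall>x\<in>ball x0 r. \<forall>y\<in>W. \<forall>k.
      norm (frechet_derivative (f \<epsilon>) (at (x, y)) (0, k)) \<le> C * \<bar>ln \<epsilon>\<bar> * norm k"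
    and cb: "c_bounded (ball x0 r) W a1" "c_bounded (ball x0 r) W a2"
    and res: "\<And>K. K \<subset>\<subset> ball x0 r \<Longrightarrow> negl K (\<lambda>\<epsilon> x. jacobian (a1 \<epsilon>) (at x) - f \<epsilon> (x, a1 \<epsilon> x))"
      "\<And>K. K \<subset>\<subset> ball x0 r \<Longrightarrow> negl K (\<lambda>\<epsilon> x. jacobian (a2 \<epsilon>) (at x) - f \<epsilon> (x, a2 \<epsilon> x))"
    and \<xi>: "(\<xi> \<longlongrightarrow> x0) (at_right 0)" and init: "pnet_equiv (\<lambda>\<epsilon>. a1 \<epsilon> (\<xi> \<epsilon>)) (\<lambda>\<epsilon>. a2 \<epsilon> (\<xi> \<epsilon>))"
    and K: "K \<subset>\<subset> ball x0 r"
  shows "negl K (\<lambda>\<epsilon> x. a1 \<epsilon> x - a2 \<epsilon> x)"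
proof (rule neglI)
  fix m :: nat
  have "compact K" "K \<subseteq> ball x0 r" using K by (simp_all add: compactly_contained_open)
  then obtain \<rho> where \<rho>: "0 < \<rho>" "\<rho> < r" "K \<subseteq> cball x0 \<rho>" using compact_in_ballE r(1) by blast
  let ?K = "cball x0 \<rho>"
  have K': "?K \<subset>\<subset> ball x0 r" using \<rho> by (auto simp: compactly_contained_open)
  have Kb: "?K \<subseteq> ball x0 r" using \<rho> by auto
  obtain L1 where L1: "L1 \<subset>\<subset> W" "\<forall>\<^sub>F \<epsilon> in at_right 0. a1 \<epsilon> ` ?K \<subseteq> L1" using c_bounded_compactE[OF cb(1) K'] .
  obtain L2 where L2: "L2 \<subset>\<subset> W" "\<forall>\<^sub>F \<epsilon> in at_right 0. a2 \<epsilon> ` ?K \<subseteq> L2" using c_bounded_compactE[OF cb(2) K'] .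
  have "compact (L1 \<union> L2)" "L1 \<union> L2 \<subseteq> W" using L1 L2 by (auto simp: compactly_contained_open W compact_Un)
  then obtain \<delta> where \<delta>: "\<delta> > 0" "(\<Union>y\<in>L1 \<union> L2. cball y \<delta>) \<subseteq> W" using compact_neighbourhood[OF _ W(1)] by blast
  obtain N where N: "\<forall>\<^sub>F \<epsilon> in at_right 0. exp ((2 * A / \<delta> * (2 * \<rho>) + 1) + (2 * \<rho> * C) * \<bar>ln \<epsilon>\<bar>) \<le> inverse \<epsilon> ^ N"
    using exp_log_moderate[of "2 * \<rho> * C"] \<rho> C by auto
  \<comment> \<open>Gronwall's factor costs \<open>N\<close> powers of \<open>\<epsilon>\<close>, so the residuals are estimated by \<open>\<epsilon>\<^bsup>m+N\<^esup>\<close>\<close>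
  have d1: "\<forall>\<^sub>F \<epsilon> in at_right 0. \<forall>x\<in>ball x0 r. a1 \<epsilon> differentiable at x"
    and d2: "\<forall>\<^sub>F \<epsilon> in at_right 0. \<forall>x\<in>ball x0 r. a2 \<epsilon> differentiable at x"
    using cb[THEN c_boundedD(1), THEN eventually_moderate_differentiable] .
  have n1: "\<forall>\<^sub>F \<epsilon> in at_right 0. \<forall>x\<in>?K. norm (jacobian (a1 \<epsilon>) (at x) - f \<epsilon> (x, a1 \<epsilon> x)) \<le> \<epsilon> ^ (m + N)"
    and n2: "\<forall>\<^sub>F \<epsilon> in at_right 0. \<forall>x\<in>?K. norm (jacobian (a2 \<epsilon>) (at x) - f \<epsilon> (x, a2 \<epsilon> x)) \<le> \<epsilon> ^ (m + N)"
    using res[OF K'] unfolding negl_def by blast+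
  have n0: "\<forall>\<^sub>F \<epsilon> in at_right 0. norm (a1 \<epsilon> (\<xi> \<epsilon>) - a2 \<epsilon> (\<xi> \<epsilon>)) \<le> \<epsilon> ^ (m + N)"
    using init unfolding pnet_equiv_iff negl_def by auto
  have \<xi>K: "\<forall>\<^sub>F \<epsilon> in at_right 0. \<xi> \<epsilon> \<in> ?K" by (rule tendsto_eventually_in_cball[OF \<xi> \<rho>(1)])
  have "\<forall>\<^sub>F \<epsilon> in at_right 0. \<forall>x\<in>K. norm (a1 \<epsilon> x - a2 \<epsilon> x) \<le> (1 + 4 * \<rho>) * \<epsilon> ^ m"
    using bound lip L1(2) L2(2) N d1 d2 n1 n2 n0 \<xi>K eventually_unit eventually_moderate_differentiable[OF f]
  proof eventually_elim
    case (elim \<epsilon>)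
    show ?case
    proof
      fix x assume "x \<in> K"
      then have x: "x \<in> ?K" using \<rho> by blast
      let ?d = "x - \<xi> \<epsilon>" and ?B = "C * \<bar>ln \<epsilon>\<bar>"
      define \<gamma> where "\<gamma> t = \<xi> \<epsilon> + t *\<^sub>R ?d" for t
      have \<gamma>: "\<gamma> t \<in> ?K" if "t \<in> {0..1}" for t
      proof -
        have "\<gamma> t = (1 - t) *\<^sub>R \<xi> \<epsilon> + t *\<^sub>R x" by (simp add: \<gamma>_def algebra_simps)
        then show ?thesis using convexD[OF convex_cball elim(11) x, of "1 - t" t] that by simp
      qed
      have nd: "norm ?d \<le> 2 * \<rho>"
        using x elim(11) dist_triangle3[of x "\<xi> \<epsilon>" x0] by (simp add: dist_norm[symmetric])
      have B: "0 \<le> ?B + 2 * A / \<delta>"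
        using A C \<delta>(1) by (intro add_nonneg_nonneg mult_nonneg_nonneg divide_nonneg_nonneg) auto
      have fL: "norm (f \<epsilon> (y, y1) - f \<epsilon> (y, y2)) \<le> (?B + 2 * A / \<delta>) * norm (y1 - y2)"
        if y: "y \<in> ?K" and y12: "y1 \<in> L1 \<union> L2" "y2 \<in> L1 \<union> L2" for y y1 y2
      proof (rule lipschitz_from_bounds[OF _ _ _ \<delta> _ A y12])
        have yb: "y \<in> ball x0 r" using y Kb by blast
        fix y' assume y': "y' \<in> W"
        then have "f \<epsilon> differentiable at (y, y')" using elim(13) yb r W by blast
        moreover have "((\<lambda>y'. (y, y')) has_derivative (\<lambda>k. (0, k))) (at y')"
          by (auto intro!: derivative_eq_intros)
        ultimately show "((\<lambda>y'. f \<epsilon> (y, y')) has_derivative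
            (\<lambda>k. frechet_derivative (f \<epsilon>) (at (y, y')) (0, k))) (at y')"
          using has_derivative_compose by (fastforce simp: frechet_derivative_works)
        show "norm (frechet_derivative (f \<epsilon>) (at (y, y')) (0, k)) \<le> ?B * norm k" for k
          using elim(2) yb y' by blast
        show "norm (f \<epsilon> (y, y')) \<le> A" using elim(1) yb y' by blast
      qed (use C in simp)
      define \<phi> where "\<phi> t = a1 \<epsilon> (\<gamma> t) - a2 \<epsilon> (\<gamma> t)" for t
      define \<phi>' where "\<phi>' t = jacobian (a1 \<epsilon>) (at (\<gamma> t)) *v ?d - jacobian (a2 \<epsilon>) (at (\<gamma> t)) *v ?d" for t
      have \<gamma>': "(\<gamma> has_derivative (\<lambda>s. s *\<^sub>R ?d)) (at t)" for t
        unfolding \<gamma>_def by (auto intro!: derivative_eq_intros)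
      have comp: "((\<lambda>t. a (\<gamma> t)) has_vector_derivative jacobian a (at (\<gamma> t)) *v ?d) (at t)"
        if "a differentiable at (\<gamma> t)" for a :: "real^'n \<Rightarrow> real^'m" and t
      proof -
        have "(a has_derivative (\<lambda>h. jacobian a (at (\<gamma> t)) *v h)) (at (\<gamma> t))"
          using that by (simp only: jacobian_works)
        from has_derivative_compose[OF \<gamma>' this] show ?thesis
          by (simp add: has_vector_derivative_def matrix_vector_mult_scaleR)
      qed
      have "norm (\<phi> 1) \<le> (norm (\<phi> 0) + 4 * \<rho> * \<epsilon> ^ (m + N)) * exp ((?B + 2 * A / \<delta>) * (2 * \<rho>) + 1)"
      proof (rule gronwall_norm[where f'=\<phi>'])
        fix t :: real assume t: "t \<in> {0..1}"
        let ?y = "\<gamma> t"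
        have y: "?y \<in> ?K" "?y \<in> ball x0 r" using \<gamma>[OF t] Kb by auto
        show "(\<phi> has_vector_derivative \<phi>' t) (at t)"
          unfolding \<phi>_def \<phi>'_def using elim(6,7) y(2)
          by (intro has_vector_derivative_diff comp) blast+
        let ?R1 = "jacobian (a1 \<epsilon>) (at ?y) - f \<epsilon> (?y, a1 \<epsilon> ?y)" and ?R2 = "jacobian (a2 \<epsilon>) (at ?y) - f \<epsilon> (?y, a2 \<epsilon> ?y)"
        let ?D = "f \<epsilon> (?y, a1 \<epsilon> ?y) - f \<epsilon> (?y, a2 \<epsilon> ?y)"
        have "\<phi>' t = (?D + (?R1 - ?R2)) *v ?d" by (simp add: \<phi>'_def matrix_vector_mult_diff_rdistrib)
        then have "norm (\<phi>' t) \<le> norm (?D + (?R1 - ?R2)) * norm ?d" using norm_matrix_vector_mult_le by metis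
        also have "\<dots> \<le> ((?B + 2 * A / \<delta>) * norm (\<phi> t) + 2 * \<epsilon> ^ (m + N)) * (2 * \<rho>)"
        proof (rule mult_mono[OF _ nd])
          have "norm ?D \<le> (?B + 2 * A / \<delta>) * norm (\<phi> t)"
            unfolding \<phi>_def by (rule fL[OF y(1)]) (use elim(3,4) y(1) in blast)+
          moreover have "norm ?R1 \<le> \<epsilon> ^ (m + N)" "norm ?R2 \<le> \<epsilon> ^ (m + N)" using elim(8,9) y(1) by blast+
          ultimately show "norm (?D + (?R1 - ?R2)) \<le> (?B + 2 * A / \<delta>) * norm (\<phi> t) + 2 * \<epsilon> ^ (m + N)"
            using norm_triangle_ineq[of ?D "?R1 - ?R2"] norm_triangle_ineq4[of ?R1 ?R2] by linarith
          show "0 \<le> (?B + 2 * A / \<delta>) * norm (\<phi> t) + 2 * \<epsilon> ^ (m + N)"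
            by (rule add_nonneg_nonneg[OF mult_nonneg_nonneg[OF B]]) (use elim(12) in simp_all)
        qed simp
        also have "\<dots> = (?B + 2 * A / \<delta>) * (2 * \<rho>) * norm (\<phi> t) + 4 * \<rho> * \<epsilon> ^ (m + N)"
          by (simp add: algebra_simps)
        finally show "norm (\<phi>' t) \<le> (?B + 2 * A / \<delta>) * (2 * \<rho>) * norm (\<phi> t) + 4 * \<rho> * \<epsilon> ^ (m + N)" .
      next
        show "0 \<le> (?B + 2 * A / \<delta>) * (2 * \<rho>)" by (rule mult_nonneg_nonneg[OF B]) (use \<rho> in simp)
      qed (use \<rho> elim(12) in simp)
      also have "\<dots> \<le> ((1 + 4 * \<rho>) * \<epsilon> ^ (m + N)) * inverse \<epsilon> ^ N"
      proof (rule mult_mono)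
        have "norm (\<phi> 0) \<le> \<epsilon> ^ (m + N)" using elim(10) by (simp add: \<phi>_def \<gamma>_def)
        then show "norm (\<phi> 0) + 4 * \<rho> * \<epsilon> ^ (m + N) \<le> (1 + 4 * \<rho>) * \<epsilon> ^ (m + N)" by (simp add: algebra_simps)
        show "exp ((?B + 2 * A / \<delta>) * (2 * \<rho>) + 1) \<le> inverse \<epsilon> ^ N"
          using elim(5) by (simp add: algebra_simps)
      qed (use \<rho> elim(12) in auto)
      also have "\<dots> = (1 + 4 * \<rho>) * \<epsilon> ^ m" using elim(12) by (simp add: power_add power_inverse)
      finally show "norm (a1 \<epsilon> x - a2 \<epsilon> x) \<le> (1 + 4 * \<rho>) * \<epsilon> ^ m" by (simp add: \<phi>_def \<gamma>_def)
    qed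
  qed
  then show "\<exists>C. \<forall>\<^sub>F \<epsilon> in at_right 0. \<forall>x\<in>K. norm (a1 \<epsilon> x - a2 \<epsilon> x) \<le> C * \<epsilon> ^ m" by blast
qed

section \<open>Existence: the Euler polygon\<close>

text \<open>Induction shows \<open>e\<^sub>j \<le> (j/N) q (1 + \<Lambda>/N)\<^sup>j\<close>.\<close>

lemma discrete_gronwall:
  fixes e :: "nat \<Rightarrow> real" and N j :: nat
  assumes "e 0 = 0" "\<And>j. j < N \<Longrightarrow> e (Suc j) \<le> (1 + \<Lambda> / real N) * e j + q / real N"
    and "0 \<le> \<Lambda>" "0 \<le> q" "j \<le> N" "0 < N"
  shows "e j \<le> q * exp \<Lambda>"
proof -
  define p where "p = 1 + \<Lambda> / real N"
  have p: "1 \<le> p" using assms by (simp add: p_def)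
  have "e j \<le> (real j / real N) * q * p ^ j" if "j \<le> N" for j
    using that
  proof (induct j)
    case (Suc j)
    have "e (Suc j) \<le> p * e j + q / real N" using assms(2)[of j] Suc by (simp add: p_def)
    also have "\<dots> \<le> p * ((real j / real N) * q * p ^ j) + q / real N * p ^ Suc j"
    proof (rule add_mono)
      show "p * e j \<le> p * ((real j / real N) * q * p ^ j)" using Suc p by (intro mult_left_mono) auto
      have "q / real N * 1 \<le> q / real N * p ^ Suc j"
        using assms one_le_power[OF p, of "Suc j"] by (intro mult_left_mono) auto
      then show "q / real N \<le> q / real N * p ^ Suc j" by simp
    qed
    also have "\<dots> = (real (Suc j) / real N) * q * p ^ Suc j"
      by (simp add: add_divide_distrib algebra_simps)
    finally show ?case .
  qed (use assms in simp)
  then have "e j \<le> (real j / real N) * q * p ^ j" using assms(5) by blast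
  also have "\<dots> \<le> 1 * q * exp \<Lambda>"
  proof (intro mult_mono)
    have "p ^ j \<le> exp (\<Lambda> / real N) ^ j" using p unfolding p_def by (intro power_mono exp_ge_add_one_self) auto
    also have "\<dots> = exp (real j * (\<Lambda> / real N))" by (rule exp_of_nat_mult[symmetric])
    also have "\<dots> \<le> exp \<Lambda>" using assms mult_right_mono[of "real j" "real N" \<Lambda>] by (simp add: field_simps)
    finally show "p ^ j \<le> exp \<Lambda>" .
  qed (use assms p in auto)
  finally show ?thesis by simp
qed

text \<open>The errors of the Euler scheme are moderate constants divided by the number of steps, so this
  number has to exceed every power of \<open>1/\<epsilon>\<close>.\<close>

definition steps :: "real \<Rightarrow> nat" where
  "steps \<epsilon> = nat \<lceil>exp (inverse \<epsilon>)\<rceil>"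

lemma steps_ge: "exp (inverse \<epsilon>) \<le> real (steps \<epsilon>)"
  unfolding steps_def by linarith

lemma steps_pos: "0 < steps \<epsilon>"
  using steps_ge[of \<epsilon>] exp_gt_zero[of "inverse \<epsilon>"] by linarith

text \<open>Here \<open>exp (1/\<epsilon>) \<ge> (1/(n\<epsilon>))\<^sup>n\<close> is used with \<open>n = m + 1\<close>.\<close>

lemma negl_inverse_steps: "negl K (\<lambda>\<epsilon> x. inverse (real (steps \<epsilon>)))"
proof (rule neglI)
  fix m :: nat
  define n where "n = real (Suc m)"
  have n: "n > 0" by (simp add: n_def)
  have "\<forall>\<^sub>F \<epsilon> in at_right 0. \<forall>x\<in>K. norm (inverse (real (steps \<epsilon>))) \<le> n ^ Suc m * \<epsilon> ^ m"
    using eventually_unit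
  proof eventually_elim
    case (elim \<epsilon>)
    have pos: "0 < inverse (n * \<epsilon>)" using elim n by simp
    have "inverse (n * \<epsilon>) \<le> exp (inverse (n * \<epsilon>))"
      using exp_ge_add_one_self[of "inverse (n * \<epsilon>)"] by linarith
    then have "inverse (n * \<epsilon>) ^ Suc m \<le> exp (inverse (n * \<epsilon>)) ^ Suc m"
      by (rule power_mono) (use pos in simp)
    also have "\<dots> = exp (inverse \<epsilon>)"
    proof -
      have "n * inverse (n * \<epsilon>) = inverse \<epsilon>" using n by simp
      then show ?thesis unfolding exp_of_nat_mult[symmetric] n_def[symmetric] by simp
    qed
    also have "\<dots> \<le> real (steps \<epsilon>)" by (rule steps_ge)
    finally have "inverse (real (steps \<epsilon>)) \<le> inverse (inverse (n * \<epsilon>) ^ Suc m)"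
      using pos by (intro le_imp_inverse_le zero_less_power)
    also have "\<dots> = n ^ Suc m * \<epsilon> ^ Suc m" by (simp add: power_inverse power_mult_distrib)
    also have "\<dots> \<le> n ^ Suc m * \<epsilon> ^ m"
      using elim n by (intro mult_left_mono power_decreasing) auto
    finally show ?case by simp
  qed
  then show "\<exists>C. \<forall>\<^sub>F \<epsilon> in at_right 0. \<forall>x\<in>K. norm (inverse (real (steps \<epsilon>))) \<le> C * \<epsilon> ^ m" by blast
qed

text \<open>The filter of pairs \<open>(\<epsilon>, j)\<close> with \<open>\<epsilon> \<rightarrow> 0\<close> and \<open>j \<le> N\<close>: estimates along it are uniform over
  the vertices of the polygon.\<close>

definition step_filter :: "(real \<times> nat) filter" where
  "step_filter = inf (filtercomap fst (at_right 0)) (principal {i. snd i \<le> steps (fst i)})"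

lemma eventually_step_filter:
  "(\<forall>\<^sub>F i in step_filter. P i) \<longleftrightarrow> (\<forall>\<^sub>F \<epsilon> in at_right 0. \<forall>j\<le>steps \<epsilon>. P (\<epsilon>, j))"
proof
  assume "\<forall>\<^sub>F i in step_filter. P i"
  then obtain Q where Q: "\<forall>\<^sub>F \<epsilon> in at_right 0. Q \<epsilon>" "\<And>i. Q (fst i) \<Longrightarrow> snd i \<le> steps (fst i) \<Longrightarrow> P i"
    unfolding step_filter_def eventually_inf_principal eventually_filtercomap by auto
  from Q(1) show "\<forall>\<^sub>F \<epsilon> in at_right 0. \<forall>j\<le>steps \<epsilon>. P (\<epsilon>, j)"
    by eventually_elim (use Q(2) in force)
next
  assume *: "\<forall>\<^sub>F \<epsilon> in at_right 0. \<forall>j\<le>steps \<epsilon>. P (\<epsilon>, j)"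
  show "\<forall>\<^sub>F i in step_filter. P i"
    unfolding step_filter_def eventually_inf_principal eventually_filtercomap
    by (rule exI[of _ "\<lambda>\<epsilon>. \<forall>j\<le>steps \<epsilon>. P (\<epsilon>, j)"]) (use * in auto)
qed

lemma eventually_step_filter_fst: "\<forall>\<^sub>F \<epsilon> in at_right 0. P \<epsilon> \<Longrightarrow> \<forall>\<^sub>F i in step_filter. P (fst i)"
  unfolding eventually_step_filter by (erule eventually_mono) simp

interpretation eu: scale step_filter "\<lambda>i. inverse (fst i)"
  by unfold_locales (rule eventually_step_filter_fst[OF ep.scale_ge_2])

lemma mod_bdd_fst: "ep.mod_bdd K u \<Longrightarrow> eu.mod_bdd K (\<lambda>i. u (fst i))"
  unfolding ep.mod_bdd_def eu.mod_bdd_def using eventually_step_filter_fst by blast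

lemma tame_fst:
  assumes "u \<in> moderate_nets U" "K \<subset>\<subset> U"
  shows "eu.tame U K k (\<lambda>i. u (fst i))"
proof (rule eu.tame_smoothI)
  show "\<forall>\<^sub>F i in step_filter. smooth_on U (u (fst i))"
    by (rule eventually_step_filter_fst[OF smooth_nets_eventually[OF moderate_nets_smooth[OF assms(1)]]])
  show "eu.mod_bdd K (\<lambda>i. partials bs (u (fst i)))" if "set bs \<subseteq> Basis" for bs
    by (rule mod_bdd_fst[OF moderate_partial_mod_bdd[OF assms that]])
qed

lemma smooth_on_Pair:
  assumes "open U" "smooth_on U f" "smooth_on U g"
  shows "smooth_on U (\<lambda>x. (f x, g x))"
proof -
  have "bounded_linear (\<lambda>x. (x, 0))" "bounded_linear (\<lambda>x. (0, x))"
    by (auto intro!: bounded_linear_Pair bounded_linear_ident bounded_linear_zero)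
  from smooth_on_add[OF assms(1) smooth_on_bounded_linear[OF assms(1) this(1) assms(2)]
      smooth_on_bounded_linear[OF assms(1) this(2) assms(3)]]
  show ?thesis by simp
qed

text \<open>The data of one initial value problem on a ball. A solution with \<open>\<bar>Du\<bar> \<le> A\<close> moves by at most
  \<open>2Ar\<close> inside the ball of radius \<open>r\<close>, so the tube of this width around \<open>L\<close> is required to lie in
  \<open>W\<close>.\<close>

locale initial_value_problem =
  fixes U :: "(real^'n) set" and V W L :: "(real^'m) set"
    and f :: "((real^'n) \<times> (real^'m), real^'n^'m) net"
    and x0 :: "real^'n" and r A C :: real and \<xi> :: "(real^'n) pnet" and \<eta> :: "(real^'m) pnet"
  assumes open_U: "open U" and open_V: "open V" and f: "f \<in> moderate_nets (U \<times> V)"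
    and r: "r > 0" "cball x0 r \<subseteq> U" and A: "A \<ge> 0" and C: "C \<ge> 0"
    and W: "open W" "W \<subseteq> V" and L: "compact L" "(\<Union>y\<in>L. cball y (2 * A * r)) \<subseteq> W"
    and bound: "\<forall>\<^sub>F \<epsilon> in at_right 0. \<forall>x\<in>ball x0 r. \<forall>y\<in>W. norm (f \<epsilon> (x, y)) \<le> A"
    and lip: "\<forall>\<^sub>F \<epsilon> in at_right 0. \<forall>x\<in>ball x0 r. \<forall>y\<in>W. \<forall>k.
      norm (frechet_derivative (f \<epsilon>) (at (x, y)) (0, k)) \<le> C * \<bar>ln \<epsilon>\<bar> * norm k"
    and \<xi>: "(\<xi> \<longlongrightarrow> x0) (at_right 0)" and \<eta>: "\<forall>\<^sub>F \<epsilon> in at_right 0. \<eta> \<epsilon> \<in> L"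
begin

abbreviation "B \<equiv> ball x0 r"
abbreviation "P \<equiv> (\<Union>y\<in>L. cball y (2 * A * r))"

text \<open>Those \<open>\<epsilon>\<close> for which the polygon stays where \<open>f\<close> is smooth and bounded. A net has to be smooth
  for every \<open>\<epsilon> \<in> (0, 1]\<close>; for the others the solution is set to \<open>0\<close>.\<close>

definition good :: "real \<Rightarrow> bool" where
  "good \<epsilon> \<longleftrightarrow> \<epsilon> \<in> {0<..1} \<and> \<xi> \<epsilon> \<in> B \<and> \<eta> \<epsilon> \<in> L \<and> (\<forall>x\<in>B. \<forall>y\<in>W. norm (f \<epsilon> (x, y)) \<le> A)"

definition node :: "real \<Rightarrow> nat \<Rightarrow> real^'n \<Rightarrow> real^'n" where
  "node \<epsilon> j x = \<xi> \<epsilon> + (real j / steps \<epsilon>) *\<^sub>R (x - \<xi> \<epsilon>)"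

primrec polygon :: "real \<Rightarrow> nat \<Rightarrow> real^'n \<Rightarrow> real^'m" where
  "polygon \<epsilon> 0 = (\<lambda>x. \<eta> \<epsilon>)"
| "polygon \<epsilon> (Suc j) = (\<lambda>x. polygon \<epsilon> j x
     + (1 / real (steps \<epsilon>)) *\<^sub>R (f \<epsilon> (node \<epsilon> j x, polygon \<epsilon> j x) *v (x - \<xi> \<epsilon>)))"

lemma eventually_good: "\<forall>\<^sub>F \<epsilon> in at_right 0. good \<epsilon>"
  using eventually_unit tendstoD[OF \<xi> r(1)] \<eta> bound
  by eventually_elim (simp add: good_def dist_commute)

lemma open_UV: "open (U \<times> V)"
  using open_U open_V by (rule open_Times)

lemma compact_P: "compact P"
  by (rule compact_cball_sum[OF L(1)])

lemma BP: "cball x0 r \<times> P \<subset>\<subset> U \<times> V"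
  by (rule compactly_contained_Times[OF open_U open_V])
     (use r L W compact_P open_U open_V in \<open>auto simp: compactly_contained_open\<close>)

lemma f_smooth: "good \<epsilon> \<Longrightarrow> smooth_on (U \<times> V) (f \<epsilon>)"
  using f by (simp add: good_def moderate_nets_def smooth_nets_def)

lemma BU: "B \<subseteq> U"
  using r(2) ball_subset_cball by blast

context
  fixes \<epsilon> :: real
  assumes good: "good \<epsilon>"
begin

lemma node_in: "x \<in> B \<Longrightarrow> j \<le> steps \<epsilon> \<Longrightarrow> node \<epsilon> j x \<in> B"
proof -
  assume x: "x \<in> B" and j: "j \<le> steps \<epsilon>"
  let ?t = "real j / steps \<epsilon>"
  have t: "0 \<le> ?t" "?t \<le> 1" using j steps_pos[of \<epsilon>] by simp_all
  have "node \<epsilon> j x = (1 - ?t) *\<^sub>R \<xi> \<epsilon> + ?t *\<^sub>R x" by (simp add: node_def algebra_simps)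
  moreover have "\<xi> \<epsilon> \<in> B" using good by (simp add: good_def)
  ultimately show "node \<epsilon> j x \<in> B"
    using convexD[OF convex_ball, of "\<xi> \<epsilon>" x0 r x "1 - ?t" ?t] x t by simp
qed

lemma increment: "x \<in> B \<Longrightarrow> norm (x - \<xi> \<epsilon>) \<le> 2 * r"
  using good dist_triangle3[of x "\<xi> \<epsilon>" x0] by (simp add: good_def dist_norm[symmetric])

lemma polygon_near:
  assumes "x \<in> B" "j \<le> steps \<epsilon>"
  shows "norm (polygon \<epsilon> j x - \<eta> \<epsilon>) \<le> 2 * A * r * (real j / steps \<epsilon>)" "polygon \<epsilon> j x \<in> P"
proof -
  have P: "y \<in> P" if "norm (y - \<eta> \<epsilon>) \<le> 2 * A * r * (real j / steps \<epsilon>)" "j \<le> steps \<epsilon>" for y j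
  proof -
    have "2 * A * r * (real j / steps \<epsilon>) \<le> 2 * A * r * 1"
      using that(2) steps_pos[of \<epsilon>] A r by (intro mult_left_mono) auto
    then have "y \<in> cball (\<eta> \<epsilon>) (2 * A * r)" using that(1) by (simp add: dist_norm norm_minus_commute)
    then show ?thesis using good by (auto simp: good_def)
  qed
  show "norm (polygon \<epsilon> j x - \<eta> \<epsilon>) \<le> 2 * A * r * (real j / steps \<epsilon>)"
    using assms(2)
  proof (induct j)
    case (Suc j)
    let ?y = "polygon \<epsilon> j x" and ?N = "real (steps \<epsilon>)"
    have IH: "norm (?y - \<eta> \<epsilon>) \<le> 2 * A * r * (real j / ?N)" using Suc by simp
    have "?y \<in> P" by (rule P[OF IH]) (use Suc.prems in simp)
    then have "?y \<in> W" using L(2) by blast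
    then have "norm (f \<epsilon> (node \<epsilon> j x, ?y)) \<le> A"
      using good node_in[OF assms(1), of j] Suc by (simp add: good_def)
    then have "norm (f \<epsilon> (node \<epsilon> j x, ?y) *v (x - \<xi> \<epsilon>)) \<le> A * (2 * r)"
      by (intro order_trans[OF norm_matrix_vector_mult_le] mult_mono increment assms(1) A) auto
    then have "norm ((1 / ?N) *\<^sub>R (f \<epsilon> (node \<epsilon> j x, ?y) *v (x - \<xi> \<epsilon>))) \<le> (1 / ?N) * (A * (2 * r))"
      by (simp add: divide_right_mono)
    then have "norm (polygon \<epsilon> (Suc j) x - \<eta> \<epsilon>) \<le> 2 * A * r * (real j / ?N) + (1 / ?N) * (A * (2 * r))"
      using IH norm_triangle_ineq[of "?y - \<eta> \<epsilon>" "(1 / ?N) *\<^sub>R (f \<epsilon> (node \<epsilon> j x, ?y) *v (x - \<xi> \<epsilon>))"]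
      by (simp add: algebra_simps)
    also have "\<dots> = 2 * A * r * (real (Suc j) / ?N)" by (simp add: field_simps add_divide_distrib)
    finally show ?case .
  qed simp
  from P[OF this assms(2)] show "polygon \<epsilon> j x \<in> P" .
qed

lemma polygon_in_W: "x \<in> B \<Longrightarrow> j \<le> steps \<epsilon> \<Longrightarrow> polygon \<epsilon> j x \<in> W"
  using polygon_near(2) L(2) by blast

lemma smooth_on_node: "smooth_on B (node \<epsilon> j)"
proof -
  have "smooth_on B (\<lambda>x. \<xi> \<epsilon> + (real j / steps \<epsilon>) *\<^sub>R (x - \<xi> \<epsilon>))"
    by (intro smooth_on_add[OF open_ball] smooth_on_const
        smooth_on_bounded_linear[OF open_ball bounded_linear_scaleR_right]
        smooth_on_diff[OF open_ball] smooth_on_id)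
  then show ?thesis by (simp add: node_def[abs_def])
qed

lemma smooth_on_polygon: "j \<le> steps \<epsilon> \<Longrightarrow> smooth_on B (polygon \<epsilon> j)"
proof (induct j)
  case 0
  then show ?case by (simp add: smooth_on_const)
next
  case (Suc j)
  then have IH: "smooth_on B (polygon \<epsilon> j)" and j: "j \<le> steps \<epsilon>" by simp_all
  have "smooth_on B (\<lambda>x. f \<epsilon> (node \<epsilon> j x, polygon \<epsilon> j x))"
  proof (rule smooth_on_compose[OF open_ball open_UV f_smooth[OF good]])
    show "smooth_on B (\<lambda>x. (node \<epsilon> j x, polygon \<epsilon> j x))"
      by (rule smooth_on_Pair[OF open_ball smooth_on_node IH])
    show "(\<lambda>x. (node \<epsilon> j x, polygon \<epsilon> j x)) ` B \<subseteq> U \<times> V"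
      using node_in[OF _ j] polygon_in_W[OF _ j] BU W(2) by blast
  qed
  then show ?case
    by (auto intro!: smooth_on_add[OF open_ball IH] smooth_on_diff[OF open_ball] smooth_on_id smooth_on_const
        smooth_on_bounded_linear[OF open_ball bounded_linear_scaleR_right]
        smooth_on_bilinear[OF open_ball bounded_bilinear_matrix_vector_mult])
qed

end

subsection \<open>All derivatives are moderate, uniformly along the polygon\<close>

text \<open>The step of the polygon is a composition of the moderate net \<open>field\<close> with the family \<open>arg\<close>, which
  is affine in \<open>x\<close> except for the polygon itself. The results on compositions apply in this form.\<close>

definition field :: "real \<Rightarrow> ((real^'n) \<times> (real^'m)) \<times> (real^'n) \<Rightarrow> real^'m" where
  "field \<epsilon> w = f \<epsilon> (fst w) *v snd w"

definition arg where
  "arg \<epsilon> j x = ((node \<epsilon> j x, polygon \<epsilon> j x), x - \<xi> \<epsilon>)"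

abbreviation "D \<equiv> (U \<times> V) \<times> (UNIV :: (real^'n) set)"

lemma open_D: "open D"
  by (intro open_Times open_U open_V open_UNIV)

lemma polygon_Suc: "polygon \<epsilon> (Suc j) x = polygon \<epsilon> j x + (1 / real (steps \<epsilon>)) *\<^sub>R field \<epsilon> (arg \<epsilon> j x)"
  by (simp add: field_def arg_def)

lemma moderate_field: "field \<in> moderate_nets D"
  unfolding field_def[abs_def]
proof (rule moderate_nets_bilinear[OF open_D bounded_bilinear_matrix_vector_mult])
  show "(\<lambda>\<epsilon> x. f \<epsilon> (fst x)) \<in> moderate_nets D"
    by (rule moderate_nets_comp_linear[OF open_D open_UV bounded_linear_fst _ f]) auto
  show "(\<lambda>\<epsilon>. snd) \<in> moderate_nets D"
    using moderate_nets_bounded_linear[OF open_D bounded_linear_snd moderate_nets_id[OF open_D]] .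
qed

abbreviation "KD \<equiv> (cball x0 r \<times> P) \<times> cball 0 (2 * r)"

lemma KD: "KD \<subset>\<subset> D"
  by (rule compactly_contained_Times[OF open_UV open_UNIV BP]) (simp add: compactly_contained_open)

lemma arg_in:
  assumes "good \<epsilon>" "j \<le> steps \<epsilon>"
  shows "arg \<epsilon> j ` B \<subseteq> D" "arg \<epsilon> j ` B \<subseteq> KD"
proof -
  have *: "arg \<epsilon> j x \<in> D \<and> arg \<epsilon> j x \<in> KD" if x: "x \<in> B" for x
  proof -
    have n: "node \<epsilon> j x \<in> B" and p: "polygon \<epsilon> j x \<in> W" "polygon \<epsilon> j x \<in> P"
      using node_in[OF assms(1) x assms(2)] polygon_in_W[OF assms(1) x assms(2)]
        polygon_near(2)[OF assms(1) x assms(2)] by blast+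
    moreover have "node \<epsilon> j x \<in> U" "node \<epsilon> j x \<in> cball x0 r" "polygon \<epsilon> j x \<in> V"
      using n p(1) BU W(2) ball_subset_cball by blast+
    moreover have "x - \<xi> \<epsilon> \<in> cball 0 (2 * r)" using increment[OF assms(1) x] by simp
    ultimately show ?thesis unfolding arg_def by blast
  qed
  then show "arg \<epsilon> j ` B \<subseteq> D" "arg \<epsilon> j ` B \<subseteq> KD" by blast+
qed

lemma eventually_good_steps: "\<forall>\<^sub>F i in step_filter. good (fst i) \<and> snd i \<le> steps (fst i)"
  unfolding eventually_step_filter using eventually_good by eventually_elim simp

lemma field_derivative:
  assumes "f \<epsilon> differentiable at (fst w)"
  shows "frechet_derivative (field \<epsilon>) (at w) ((0, k), 0)
    = frechet_derivative (f \<epsilon>) (at (fst w)) (0, k) *v snd w"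
proof -
  have "((\<lambda>w. f \<epsilon> (fst w)) has_derivative (\<lambda>h. frechet_derivative (f \<epsilon>) (at (fst w)) (fst h))) (at w)"
    using has_derivative_compose[OF has_derivative_fst[OF has_derivative_ident]] assms
    by (simp add: frechet_derivative_works)
  from bounded_bilinear.FDERIV[OF bounded_bilinear_matrix_vector_mult this has_derivative_snd[OF has_derivative_ident]]
  have "(field \<epsilon> has_derivative (\<lambda>h. f \<epsilon> (fst w) *v snd h
      + frechet_derivative (f \<epsilon>) (at (fst w)) (fst h) *v snd w)) (at w)"
    by (simp add: field_def[abs_def])
  then show ?thesis by (simp add: frechet_derivative_eq)
qed

definition affine_part where
  "affine_part \<epsilon> j x = ((node \<epsilon> j x, 0 :: real^'m), x - \<xi> \<epsilon>)"

lemma arg_split: "arg \<epsilon> j x = affine_part \<epsilon> j x + ((0, polygon \<epsilon> j x), 0)"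
  by (simp add: arg_def affine_part_def)

lemma smooth_on_affine_part: "good \<epsilon> \<Longrightarrow> smooth_on B (affine_part \<epsilon> j)"
  unfolding affine_part_def[abs_def]
  by (intro smooth_on_Pair[OF open_ball] smooth_on_node smooth_on_const smooth_on_diff[OF open_ball] smooth_on_id)

lemma bounded_linear_embed: "bounded_linear (\<lambda>y :: real^'m. ((0 :: real^'n, y), 0 :: real^'n))"
  by (intro bounded_linear_Pair bounded_linear_ident bounded_linear_zero)

lemma tame_affine_part: "eu.tame B B k (\<lambda>i. affine_part (fst i) (snd i))"
proof -
  have xi: "eu.tame B B k (\<lambda>i x. \<xi> (fst i))"
  proof (rule eu.tame_const[OF eu.mod_bddI[where C="norm x0 + r" and M=0]])
    show "\<forall>\<^sub>F i in step_filter. \<forall>x\<in>B. norm (\<xi> (fst i)) \<le> (norm x0 + r) * inverse (fst i) ^ 0"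
      using eventually_good_steps
    proof eventually_elim
      case (elim i)
      then have "norm (\<xi> (fst i) - x0) \<le> r" by (simp add: good_def dist_norm norm_minus_commute)
      then show ?case using norm_triangle_ineq2[of "\<xi> (fst i)" x0] by simp
    qed
  qed
  have "eu.tame B B k (\<lambda>i x. - \<xi> (fst i))"
    using eu.tame_bounded_linear[OF open_ball order_refl bounded_linear_minus[OF bounded_linear_ident] xi] by simp
  from eu.tame_add[OF open_ball order_refl eu.tame_id[OF bounded_ball] this]
  have diff: "eu.tame B B k (\<lambda>i x. x - \<xi> (fst i))" by simp
  have t: "eu.tame B B k (\<lambda>i x. real (snd i) / steps (fst i))"
  proof (rule eu.tame_const[OF eu.mod_bddI[where C=1 and M=0]])
    show "\<forall>\<^sub>F i in step_filter. \<forall>x\<in>B. norm (real (snd i) / steps (fst i)) \<le> 1 * inverse (fst i) ^ 0"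
      using eventually_good_steps
      by eventually_elim (use steps_pos in \<open>auto simp: divide_le_eq\<close>)
  qed
  have node: "eu.tame B B k (\<lambda>i. node (fst i) (snd i))"
    using eu.tame_add[OF open_ball order_refl xi
        eu.tame_bilinear[OF open_ball order_refl bounded_bilinear_scaleR t diff]]
    by (simp add: node_def[abs_def])
  have l1: "bounded_linear (\<lambda>y :: real^'n. ((y, 0 :: real^'m), 0 :: real^'n))"
    and l2: "bounded_linear (\<lambda>y :: real^'n. ((0 :: real^'n, 0 :: real^'m), y))"
    by (intro bounded_linear_Pair bounded_linear_ident bounded_linear_zero)+
  from eu.tame_add[OF open_ball order_refl eu.tame_bounded_linear[OF open_ball order_refl l1 node]
      eu.tame_bounded_linear[OF open_ball order_refl l2 diff]]
  show ?thesis by (simp add: affine_part_def[abs_def])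
qed

lemma smooth_on_arg:
  assumes "good \<epsilon>" "j \<le> steps \<epsilon>"
  shows "smooth_on B (arg \<epsilon> j)"
  unfolding arg_def[abs_def]
  by (intro smooth_on_Pair[OF open_ball] smooth_on_node smooth_on_polygon smooth_on_const
      smooth_on_diff[OF open_ball] smooth_on_id assms)

lemma partials_arg:
  assumes "good \<epsilon>" "j \<le> steps \<epsilon>" "set bs \<subseteq> Basis" "x \<in> B"
  shows "partials bs (arg \<epsilon> j) x = partials bs (affine_part \<epsilon> j) x + ((0, partials bs (polygon \<epsilon> j) x), 0)"
proof -
  have "smooth_on B (\<lambda>x. ((0, polygon \<epsilon> j x), 0) :: ((real^'n) \<times> (real^'m)) \<times> (real^'n))"
    by (rule smooth_on_bounded_linear[OF open_ball bounded_linear_embed smooth_on_polygon[OF assms(1,2)]])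
  from partials_add[OF open_ball smooth_on_affine_part[OF assms(1)] this assms(3,4), of j]
  show ?thesis
    using partials_bounded_linear[OF bounded_linear_embed open_ball smooth_on_polygon[OF assms(1,2)] assms(3,4)]
    by (simp add: arg_split[abs_def])
qed

lemma partials_const: "bs \<noteq> [] \<Longrightarrow> partials bs (\<lambda>x. c) = (\<lambda>x. 0)"
proof (induct bs)
  case (Cons b bs)
  then show ?case
    by (cases "bs = []") (auto simp: frechet_derivative_eq[OF has_derivative_const])
qed simp

text \<open>Induction on the order of the derivative. The derivative of top order satisfies a linear
  recursion with factor \<open>1 + O(\<bar>log \<epsilon>\<bar>)/N\<close> whose inhomogeneity contains only derivatives of
  lower order, because by the lemma on compositions the top order enters linearly through \<open>\<partial>\<^sub>2f\<close>.\<close>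

lemma polygon_moderate:
  "set bs \<subseteq> Basis \<Longrightarrow> eu.mod_bdd B (\<lambda>i. partials bs (polygon (fst i) (snd i)))"
proof (induct "length bs" arbitrary: bs rule: less_induct)
  case less
  have polygon: "eu.mod_bdd B (\<lambda>i. partials cs (polygon (fst i) (snd i)))"
    if "set cs \<subseteq> Basis" "length cs < length bs" for cs
    using less.hyps[OF that(2,1)] .
  show ?case
  proof (cases "bs = []")
    case True
    obtain c where c: "\<And>y. y \<in> P \<Longrightarrow> norm y \<le> c"
      using compact_imp_bounded[OF compact_P] unfolding bounded_iff by blast
    have "\<forall>\<^sub>F i in step_filter. \<forall>x\<in>B. norm (polygon (fst i) (snd i) x) \<le> c * inverse (fst i) ^ 0"
      using eventually_good_steps
      by eventually_elim (use c polygon_near(2) in simp)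
    then show ?thesis unfolding True partials.simps by (rule eu.mod_bddI)
  next
    case False
    define k where "k = length bs - 1"
    have k: "length bs = Suc k" using False by (simp add: k_def)
    have smooth_polygon: "\<forall>\<^sub>F i in step_filter. smooth_on B (polygon (fst i) (snd i))"
      using eventually_good_steps by eventually_elim (simp add: smooth_on_polygon)
    have smooth_arg: "\<forall>\<^sub>F i in step_filter. smooth_on B (arg (fst i) (snd i))"
      using eventually_good_steps by eventually_elim (simp add: smooth_on_arg)
    have smooth_field: "\<forall>\<^sub>F i in step_filter. smooth_on D (field (fst i))"
      by (rule eventually_step_filter_fst[OF smooth_nets_eventually[OF moderate_nets_smooth[OF moderate_field]]])
    \<comment> \<open>only derivatives of order at most \<open>k\<close>, by induction, are known to be moderate\<close>
    have "eu.tame B B k (\<lambda>i. polygon (fst i) (snd i))"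
      by (rule eu.tame_smoothI[OF smooth_polygon]) (use polygon k in auto)
    from eu.tame_add[OF open_ball order_refl tame_affine_part
        eu.tame_bounded_linear[OF open_ball order_refl bounded_linear_embed this]]
    have tame_arg: "eu.tame B B k (\<lambda>i. arg (fst i) (snd i))" by (simp add: arg_split[abs_def])
    have argD: "\<forall>\<^sub>F i in step_filter. arg (fst i) (snd i) ` B \<subseteq> D"
      and argK: "\<forall>\<^sub>F i in step_filter. arg (fst i) (snd i) ` B \<subseteq> KD"
      using eventually_good_steps by (eventually_elim, use arg_in in blast)+
    have "eu.mod_bdd B (\<lambda>i x. partials bs (\<lambda>x. field (fst i) (arg (fst i) (snd i) x)) x
        - frechet_derivative (field (fst i)) (at (arg (fst i) (snd i) x)) (partials bs (arg (fst i) (snd i)) x))"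
    proof (rule eu.partials_compose_remainder[OF open_ball order_refl open_D less.prems False smooth_field smooth_arg])
      show "eu.tame D KD (length bs) (\<lambda>i. field (fst i))" by (rule tame_fst[OF moderate_field KD])
      show "eu.mod_bdd B (\<lambda>i. partials cs (arg (fst i) (snd i)))"
        if "set cs \<subseteq> Basis" "length cs < length bs" for cs
        by (rule eu.tame_mod_bdd[OF tame_arg that(1)]) (use that(2) k in simp)
    qed (use argD argK in blast)+
    then obtain M where M: "\<forall>\<^sub>F i in step_filter. \<forall>x\<in>B.
        norm (partials bs (\<lambda>x. field (fst i) (arg (fst i) (snd i) x)) x
        - frechet_derivative (field (fst i)) (at (arg (fst i) (snd i) x)) (partials bs (arg (fst i) (snd i)) x))
        \<le> inverse (fst i) ^ M"
      by (rule eu.mod_bddE)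
    have "eu.mod_bdd B (\<lambda>i x. (\<Sum>b\<in>Basis. norm (partials [b] (field (fst i)) (arg (fst i) (snd i) x)))
        * norm (partials bs (affine_part (fst i) (snd i)) x))"
    proof (rule eu.mod_bdd_bilinear[OF bounded_bilinear_mult eu.mod_bdd_sum])
      fix b :: "((real^'n) \<times> (real^'m)) \<times> (real^'n)" assume "b \<in> Basis"
      then have "eu.mod_bdd KD (\<lambda>i. partials [b] (field (fst i)))"
        by (intro mod_bdd_fst moderate_partial_mod_bdd[OF moderate_field KD]) auto
      from eu.mod_bdd_compose[OF this argK]
      show "eu.mod_bdd B (\<lambda>i x. norm (partials [b] (field (fst i)) (arg (fst i) (snd i) x)))"
        by (rule eu.mod_bdd_mono) simp
    next
      have "eu.mod_bdd B (\<lambda>i. partials bs (affine_part (fst i) (snd i)))"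
        by (rule eu.tame_mod_bdd[OF tame_affine_part less.prems order_refl])
      then show "eu.mod_bdd B (\<lambda>i x. norm (partials bs (affine_part (fst i) (snd i)) x))"
        by (rule eu.mod_bdd_mono) simp
    qed
    then obtain M' where M': "\<forall>\<^sub>F i in step_filter. \<forall>x\<in>B.
        norm ((\<Sum>b\<in>Basis. norm (partials [b] (field (fst i)) (arg (fst i) (snd i) x)))
        * norm (partials bs (affine_part (fst i) (snd i)) x)) \<le> inverse (fst i) ^ M'"
      by (rule eu.mod_bddE)
    obtain n where n: "\<forall>\<^sub>F \<epsilon> in at_right 0. exp (0 + (2 * r * C) * \<bar>ln \<epsilon>\<bar>) \<le> inverse \<epsilon> ^ n"
      by (rule exp_log_moderate[where C="2 * r * C" and A=0]) (use r C in auto)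
    have "\<forall>\<^sub>F i in step_filter. \<forall>x\<in>B.
        norm (partials bs (polygon (fst i) (snd i)) x) \<le> 2 * inverse (fst i) ^ (M + M' + n)"
      unfolding eventually_step_filter
      using M[unfolded eventually_step_filter] M'[unfolded eventually_step_filter] n lip eventually_good
    proof eventually_elim
      case (elim \<epsilon>)
      let ?N = "steps \<epsilon>" and ?\<Lambda> = "2 * r * C * \<bar>ln \<epsilon>\<bar>"
      define q where "q = inverse \<epsilon> ^ M + inverse \<epsilon> ^ M'"
      note good = elim(5)
      have e: "0 < \<epsilon>" "\<epsilon> \<le> 1" using good by (simp_all add: good_def)
      have main: "norm (partials bs (polygon \<epsilon> j) x) \<le> q * exp ?\<Lambda>" if x: "x \<in> B" and j: "j \<le> ?N" for x j
      proof (rule discrete_gronwall[where e="\<lambda>j. norm (partials bs (polygon \<epsilon> j) x)" and N="?N"])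
        show "norm (partials bs (polygon \<epsilon> 0) x) = 0" by (simp add: partials_const[OF False])
        fix j assume "j < ?N"
        then have j: "j \<le> ?N" "Suc j \<le> ?N" by simp_all
        let ?a = "arg \<epsilon> j x" and ?k = "partials bs (polygon \<epsilon> j) x" and ?c = "partials bs (affine_part \<epsilon> j) x"
        have a: "?a \<in> D" using arg_in(1)[OF good j(1)] x by blast
        have fd: "f \<epsilon> differentiable at (fst ?a)" and Fd: "field \<epsilon> differentiable at ?a"
          using smooth_on_differentiable[OF f_smooth[OF good], of "fst ?a"] a
            smooth_on_differentiable[of D "field \<epsilon>"] moderate_field e
          by (auto simp: moderate_nets_def smooth_nets_def)
        have lin: "linear (frechet_derivative (field \<epsilon>) (at ?a))" by (rule linear_frechet_derivative[OF Fd])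
        have "smooth_on B (\<lambda>x. field \<epsilon> (arg \<epsilon> j x))"
          by (rule smooth_on_compose[OF open_ball open_D _ smooth_on_arg[OF good j(1)] arg_in(1)[OF good j(1)]])
             (use moderate_field e in \<open>auto simp: moderate_nets_def smooth_nets_def\<close>)
        note sc = this smooth_on_bounded_linear[OF open_ball bounded_linear_scaleR_right this, of "1 / real ?N"]
        have "partials bs (polygon \<epsilon> (Suc j)) x = partials bs (\<lambda>x. polygon \<epsilon> j x + (1 / real ?N) *\<^sub>R field \<epsilon> (arg \<epsilon> j x)) x"
          by (simp only: polygon_Suc[abs_def])
        also have "\<dots> = ?k + (1 / real ?N) *\<^sub>R partials bs (\<lambda>x. field \<epsilon> (arg \<epsilon> j x)) x"
          by (simp only: partials_add[OF open_ball smooth_on_polygon[OF good j(1)] sc(2) less.prems x]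
              partials_bounded_linear[OF bounded_linear_scaleR_right open_ball sc(1) less.prems x])
        finally have step: "norm (partials bs (polygon \<epsilon> (Suc j)) x)
            \<le> norm ?k + (1 / real ?N) * norm (partials bs (\<lambda>x. field \<epsilon> (arg \<epsilon> j x)) x)"
          using norm_triangle_ineq[of ?k "(1 / real ?N) *\<^sub>R partials bs (\<lambda>x. field \<epsilon> (arg \<epsilon> j x)) x"] by simp
        have "norm (partials bs (\<lambda>x. field \<epsilon> (arg \<epsilon> j x)) x) \<le> ?\<Lambda> * norm ?k + q"
        proof -
          have "frechet_derivative (field \<epsilon>) (at ?a) (partials bs (arg \<epsilon> j) x)
              = frechet_derivative (field \<epsilon>) (at ?a) ?c + frechet_derivative (f \<epsilon>) (at (fst ?a)) (0, ?k) *v snd ?a"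
            unfolding partials_arg[OF good j(1) less.prems x] linear_add[OF lin] field_derivative[OF fd] ..
          moreover have "norm (frechet_derivative (field \<epsilon>) (at ?a) ?c) \<le> inverse \<epsilon> ^ M'"
          proof -
            have "norm ((\<Sum>b\<in>Basis. norm (partials [b] (field \<epsilon>) ?a)) * norm ?c) \<le> inverse \<epsilon> ^ M'"
              using elim(2) j(1) x by (metis fst_conv snd_conv)
            then show ?thesis
              using norm_frechet_derivative_le[OF Fd, of ?c] unfolding real_norm_def by linarith
          qed
          moreover have "norm (frechet_derivative (f \<epsilon>) (at (fst ?a)) (0, ?k) *v snd ?a) \<le> ?\<Lambda> * norm ?k"
          proof -
            have "norm (frechet_derivative (f \<epsilon>) (at (fst ?a)) (0, ?k) *v snd ?a)
                \<le> (C * \<bar>ln \<epsilon>\<bar> * norm ?k) * (2 * r)"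
            proof (rule order_trans[OF norm_matrix_vector_mult_le mult_mono])
              show "norm (frechet_derivative (f \<epsilon>) (at (fst ?a)) (0, ?k)) \<le> C * \<bar>ln \<epsilon>\<bar> * norm ?k"
                using elim(4) node_in[OF good x j(1)] polygon_in_W[OF good x j(1)] by (simp add: arg_def)
              show "norm (snd ?a) \<le> 2 * r" using increment[OF good x] by (simp add: arg_def)
              show "0 \<le> C * \<bar>ln \<epsilon>\<bar> * norm ?k" by (intro mult_nonneg_nonneg C) auto
            qed simp
            then show ?thesis by (simp only: mult_ac)
          qed
          moreover have "norm (partials bs (\<lambda>x. field \<epsilon> (arg \<epsilon> j x)) x
              - frechet_derivative (field \<epsilon>) (at ?a) (partials bs (arg \<epsilon> j) x)) \<le> inverse \<epsilon> ^ M"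
            using elim(1) j(1) x by (metis fst_conv snd_conv)
          moreover have "norm X \<le> norm (X - Y) + norm Y1 + norm Y2" if "Y = Y1 + Y2" for X Y Y1 Y2 :: "real^'m"
            using norm_triangle_ineq[of "X - Y" Y] norm_triangle_ineq[of Y1 Y2] that by simp
          ultimately show ?thesis unfolding q_def by (smt (verit))
        qed
        then have "(1 / real ?N) * norm (partials bs (\<lambda>x. field \<epsilon> (arg \<epsilon> j x)) x)
            \<le> (1 / real ?N) * (?\<Lambda> * norm ?k + q)"
          by (rule mult_left_mono) simp
        note order_trans[OF step add_left_mono[OF this]]
        also have "norm ?k + (1 / real ?N) * (?\<Lambda> * norm ?k + q) = (1 + ?\<Lambda> / ?N) * norm ?k + q / ?N"
          by (simp add: add_divide_distrib distrib_left distrib_right)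
        finally show "norm (partials bs (polygon \<epsilon> (Suc j)) x) \<le> (1 + ?\<Lambda> / ?N) * norm ?k + q / ?N" .
      next
        show "0 \<le> ?\<Lambda>" using C r by (intro mult_nonneg_nonneg) auto
      qed (use j e in \<open>auto simp: q_def steps_pos\<close>)
      have "q * exp ?\<Lambda> \<le> (2 * inverse \<epsilon> ^ (M + M')) * inverse \<epsilon> ^ n"
      proof (rule mult_mono)
        have "inverse \<epsilon> ^ M \<le> inverse \<epsilon> ^ (M + M')" "inverse \<epsilon> ^ M' \<le> inverse \<epsilon> ^ (M + M')"
          using e by (auto intro!: power_increasing simp: one_le_inverse)
        then show "q \<le> 2 * inverse \<epsilon> ^ (M + M')" by (simp add: q_def)
      qed (use elim(3) e in auto)
      then have q: "q * exp ?\<Lambda> \<le> 2 * inverse \<epsilon> ^ (M + M' + n)" by (simp add: power_add mult.assoc)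
      show ?case
        unfolding fst_conv snd_conv by (intro allI impI ballI order_trans[OF main q])
    qed
    then show ?thesis by (rule eu.mod_bddI)
  qed
qed

end

subsection \<open>The residual of the Euler polygon is negligible\<close>

lemma matrix_dyad_expand: "M = (\<Sum>b\<in>Basis. dyad b (M *v b))"
  for M :: "real^'n^'m"
proof -
  have "M *v v = (\<Sum>b\<in>Basis. dyad b (M *v b)) *v v" for v
  proof -
    have lin: "linear ((*v) M)" by (rule matrix_vector_mul_linear)
    have "M *v v = M *v (\<Sum>b\<in>Basis. (v \<bullet> b) *\<^sub>R b)" by (simp add: euclidean_representation)
    then show ?thesis
      by (simp add: linear_sum[OF lin] linear_cmul[OF lin] matrix_sum_mult dyad_mult)
  qed
  then show ?thesis unfolding matrix_eq by blast
qed

context initial_value_problem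
begin

definition solution :: "(real^'n, real^'m) net" where
  "solution \<epsilon> = (if good \<epsilon> then polygon \<epsilon> (steps \<epsilon>) else (\<lambda>x. 0))"

lemma eventually_solution: "\<forall>\<^sub>F \<epsilon> in at_right 0. good \<epsilon> \<and> solution \<epsilon> = polygon \<epsilon> (steps \<epsilon>)"
  using eventually_good by eventually_elim (simp add: solution_def)

lemma moderate_solution: "solution \<in> moderate_nets B"
  unfolding moderate_nets_mod_bdd
proof (intro conjI allI impI)
  show "solution \<in> smooth_nets B"
    by (auto simp: smooth_nets_def solution_def smooth_on_const intro: smooth_on_polygon)
  fix K and bs :: "(real^'n) list" assume K: "K \<subset>\<subset> B" and bs: "set bs \<subseteq> Basis"
  obtain M where M: "\<forall>\<^sub>F i in step_filter. \<forall>x\<in>B. norm (partials bs (polygon (fst i) (snd i)) x) \<le> inverse (fst i) ^ M"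
    using polygon_moderate[OF bs] by (rule eu.mod_bddE)
  have "\<forall>\<^sub>F \<epsilon> in at_right 0. \<forall>x\<in>K. norm (partials bs (solution \<epsilon>) x) \<le> 1 * inverse \<epsilon> ^ M"
    using M[unfolded eventually_step_filter] eventually_solution
  proof eventually_elim
    case (elim \<epsilon>)
    then show ?case using K by (auto simp: compactly_contained_open)
  qed
  then show "ep.mod_bdd K (\<lambda>\<epsilon>. partials bs (solution \<epsilon>))" by (rule ep.mod_bddI)
qed

lemma c_bounded_solution: "c_bounded B W solution"
  unfolding c_bounded_iff
proof (intro conjI allI impI moderate_solution)
  show "\<forall>\<^sub>F \<epsilon> in at_right 0. solution \<epsilon> ` B \<subseteq> W"
    using eventually_solution by eventually_elim (use polygon_in_W in auto)
  fix K assume "K \<subset>\<subset> B"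
  then have K: "K \<subseteq> B" by (simp add: compactly_contained_open)
  have "\<forall>\<^sub>F \<epsilon> in at_right 0. solution \<epsilon> ` K \<subseteq> P"
    using eventually_solution
  proof eventually_elim
    case (elim \<epsilon>)
    show ?case
    proof (rule image_subsetI)
      fix x assume "x \<in> K"
      then have "polygon \<epsilon> (steps \<epsilon>) x \<in> P" using K by (intro polygon_near(2)[OF conjunct1[OF elim]]) auto
      then show "solution \<epsilon> x \<in> P" by (simp only: conjunct2[OF elim])
    qed
  qed
  moreover have "P \<subset>\<subset> W" using compact_P L(2) W(1) by (simp add: compactly_contained_open)
  ultimately show "\<exists>L. L \<subset>\<subset> W \<and> (\<forall>\<^sub>F \<epsilon> in at_right 0. solution \<epsilon> ` K \<subseteq> L)" by blast
qed

lemma solution_initial: "\<forall>\<^sub>F \<epsilon> in at_right 0. solution \<epsilon> (\<xi> \<epsilon>) = \<eta> \<epsilon>"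
  using eventually_solution
proof eventually_elim
  case (elim \<epsilon>)
  have "polygon \<epsilon> j (\<xi> \<epsilon>) = \<eta> \<epsilon>" for j by (induct j) simp_all
  then show ?case using elim by simp
qed

text \<open>The algebra of one step. Here \<open>w\<close> is \<open>Dz\<^sub>j v\<close>, \<open>G\<close> is \<open>Df(x\<^sub>j, z\<^sub>j)\<close>, \<open>t = j/N\<close>, \<open>\<nu> = 1/N\<close>,
  \<open>d = x - \<xi>\<close>, and \<open>T\<close> is the Taylor remainder of \<open>f\<close>. Splitting \<open>w\<close> into \<open>h = w - t F v\<close> and the
  value prescribed by the differential equation produces the defect from the two terms of first
  order, one from the derivative of the step and one from the increment of \<open>F\<close>.\<close>

lemma residual_step:
  fixes F F' T :: "real^'n^'m" and G :: "(real^'n) \<times> (real^'m) \<Rightarrow> real^'n^'m"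
  assumes "linear G" "F' = F + \<nu> *\<^sub>R G (d, F *v d) + T"
  shows "(w + \<nu> *\<^sub>R (F *v v + G (t *\<^sub>R v, w) *v d)) - (t + \<nu>) *\<^sub>R (F' *v v)
    = (w - t *\<^sub>R (F *v v)) + \<nu> *\<^sub>R (G (0, w - t *\<^sub>R (F *v v)) *v d)
      + (\<nu> * t) *\<^sub>R (G (v, F *v v) *v d - G (d, F *v d) *v v)
      - (\<nu> * \<nu>) *\<^sub>R (G (d, F *v d) *v v) - (t + \<nu>) *\<^sub>R (T *v v)"
proof -
  have "(t *\<^sub>R v, w) = t *\<^sub>R (v, F *v v) + (0, w - t *\<^sub>R (F *v v))" by simp
  then have G: "G (t *\<^sub>R v, w) = t *\<^sub>R G (v, F *v v) + G (0, w - t *\<^sub>R (F *v v))"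
    by (metis linear_add[OF assms(1)] linear_cmul[OF assms(1)])
  show ?thesis
    unfolding G assms(2)
    by (simp add: matrix_vector_mult_add_rdistrib scaleR_matrix_vector_assoc[symmetric] algebra_simps)
qed

abbreviation "\<Lambda> \<epsilon> \<equiv> 2 * r * C * \<bar>ln \<epsilon>\<bar>"

text \<open>With \<open>\<epsilon>\<close> fixed, the constants \<open>q\<^sub>0\<close>, \<open>q\<^sub>1\<close>, \<open>q\<^sub>2\<close> bound the defect, the derivative and the Taylor
  remainder of \<open>f\<close> near the polygon, and \<open>c/N\<close> bounds the length of one of its edges in
  \<open>\<real>\<^sup>n \<times> \<real>\<^sup>m\<close>. The discrete Gronwall inequality sums up the increments of \<open>h\<^sub>j\<close>.\<close>

lemma residual_bound:
  assumes good: "good \<epsilon>" and x: "x \<in> B" and b: "norm b = 1"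
    and lip': "\<And>x y k. x \<in> B \<Longrightarrow> y \<in> W \<Longrightarrow> norm (frechet_derivative (f \<epsilon>) (at (x, y)) (0, k)) \<le> C * \<bar>ln \<epsilon>\<bar> * norm k"
    and defect: "\<And>z. z \<in> cball x0 r \<times> P \<times> cball 0 1 \<times> cball 0 (2 * r) \<Longrightarrow> norm (defect f \<epsilon> z) \<le> q0"
    and deriv: "\<And>p h. p \<in> cball x0 r \<times> P \<Longrightarrow> norm (frechet_derivative (f \<epsilon>) (at p) h) \<le> q1 * norm h"
    and taylor: "\<And>p q. p \<in> cball x0 r \<times> P \<Longrightarrow> q \<in> cball p \<delta> \<Longrightarrow>
      norm (f \<epsilon> q - f \<epsilon> p - frechet_derivative (f \<epsilon>) (at p) (q - p)) \<le> q2 * (norm (q - p))\<^sup>2"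
    and c: "c = 2 * r * (1 + A)" "c / steps \<epsilon> \<le> \<delta>" and q: "0 \<le> q0" "0 \<le> q1" "0 \<le> q2"
  shows "norm ((jacobian (polygon \<epsilon> (steps \<epsilon>)) (at x) - f \<epsilon> (x, polygon \<epsilon> (steps \<epsilon>) x)) *v b)
    \<le> (q0 + (q1 * c + q2 * c\<^sup>2) / steps \<epsilon>) * exp (\<Lambda> \<epsilon>)"
proof -
  let ?N = "steps \<epsilon>"
  define \<nu> where "\<nu> = 1 / real ?N"
  define d where "d = x - \<xi> \<epsilon>"
  define p where "p j = (node \<epsilon> j x, polygon \<epsilon> j x)" for j
  define Fj where "Fj j = f \<epsilon> (p j)" for j
  define G where "G j = frechet_derivative (f \<epsilon>) (at (p j))" for j
  define w where "w j = frechet_derivative (polygon \<epsilon> j) (at x) b" for j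
  define t where "t j = real j / real ?N" for j
  define h where "h j = w j - t j *\<^sub>R (Fj j *v b)" for j
  define q' where "q' = q0 + (q1 * c + q2 * c\<^sup>2) * \<nu>"
  have \<nu>: "0 < \<nu>" using steps_pos by (simp add: \<nu>_def)
  have c0: "0 \<le> c" using c(1) r A by simp
  have nd: "norm d \<le> 2 * r" unfolding d_def by (rule increment[OF good x])
  have "norm (h ?N) \<le> q' * exp (\<Lambda> \<epsilon>)"
  proof (rule discrete_gronwall[where e="\<lambda>j. norm (h j)" and N="?N"])
    show "norm (h 0) = 0" by (simp add: h_def w_def t_def frechet_derivative_eq[OF has_derivative_const])
    show "0 \<le> \<Lambda> \<epsilon>" using C r by (intro mult_nonneg_nonneg) auto
    show "0 \<le> q'" unfolding q'_def using q \<nu> c0 by simp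
    show "?N \<le> ?N" "0 < ?N" using steps_pos by simp_all
    fix j assume "j < ?N"
    then have j: "j \<le> ?N" "Suc j \<le> ?N" by simp_all
    have tj: "0 \<le> t j" "t j \<le> 1" "t (Suc j) \<le> 1"
      using j steps_pos[of \<epsilon>] by (simp_all add: t_def divide_le_eq)
    have tS: "t (Suc j) = t j + \<nu>" by (simp add: t_def \<nu>_def add_divide_distrib)
    have n: "node \<epsilon> j x \<in> B" and z: "polygon \<epsilon> j x \<in> W" "polygon \<epsilon> j x \<in> P"
      using node_in[OF good x j(1)] polygon_in_W[OF good x j(1)] polygon_near(2)[OF good x j(1)] by blast+
    have pK: "p j \<in> cball x0 r \<times> P" unfolding p_def by (rule SigmaI, use n in simp, rule z(2))
    have "p j \<in> U \<times> V" unfolding p_def by (rule SigmaI, rule subsetD[OF BU n], rule subsetD[OF W(2) z(1)])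
    then have fd: "f \<epsilon> differentiable at (p j)" by (rule smooth_on_differentiable[OF f_smooth[OF good]])
    have lin: "linear (G j)" unfolding G_def by (rule linear_frechet_derivative[OF fd])
    have Fd: "norm (Fj j *v d) \<le> A * (2 * r)"
      using good n z(1) by (intro order_trans[OF norm_matrix_vector_mult_le] mult_mono nd A)
        (auto simp: good_def Fj_def p_def)
    have nc: "norm (d, Fj j *v d) \<le> c"
      using norm_Pair_le[of d "Fj j *v d"] nd Fd by (simp add: c(1) algebra_simps)
    define T where "T = Fj (Suc j) - Fj j - \<nu> *\<^sub>R G j (d, Fj j *v d)"
    have pS: "p (Suc j) - p j = \<nu> *\<^sub>R (d, Fj j *v d)"
      by (simp add: p_def node_def Fj_def \<nu>_def d_def add_divide_distrib scaleR_add_left)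
    have npS: "norm (p (Suc j) - p j) \<le> \<nu> * c"
      unfolding pS norm_scaleR using mult_left_mono[OF nc, of \<nu>] \<nu> by simp
    have nT: "norm T \<le> q2 * (\<nu> * c)\<^sup>2"
    proof -
      have "p (Suc j) \<in> cball (p j) \<delta>"
        using npS c(2) by (simp add: dist_norm norm_minus_commute \<nu>_def)
      from taylor[OF pK this] have "norm T \<le> q2 * (norm (p (Suc j) - p j))\<^sup>2"
        unfolding T_def Fj_def G_def[symmetric] pS linear_cmul[OF lin] by (simp add: Fj_def)
      also have "\<dots> \<le> q2 * (\<nu> * c)\<^sup>2" using npS q by (intro mult_left_mono power_mono) auto
      finally show ?thesis .
    qed
    have wS: "w (Suc j) = w j + \<nu> *\<^sub>R (Fj j *v b + G j (t j *\<^sub>R b, w j) *v d)"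
    proof -
      let ?Dz = "frechet_derivative (polygon \<epsilon> j) (at x)"
      have z': "(polygon \<epsilon> j has_derivative ?Dz) (at x)"
        using smooth_on_differentiable[OF smooth_on_polygon[OF good j(1)] x] by (simp add: frechet_derivative_works)
      have "(node \<epsilon> j has_derivative (\<lambda>v. t j *\<^sub>R v)) (at x)"
        unfolding node_def[abs_def] t_def by (auto intro!: derivative_eq_intros)
      from has_derivative_compose[OF has_derivative_Pair[OF this z'], of "f \<epsilon>" "G j"]
      have "((\<lambda>x. f \<epsilon> (node \<epsilon> j x, polygon \<epsilon> j x)) has_derivative (\<lambda>v. G j (t j *\<^sub>R v, ?Dz v))) (at x)"
        using fd by (simp add: frechet_derivative_works G_def p_def)
      moreover have "((\<lambda>x. x - \<xi> \<epsilon>) has_derivative (\<lambda>v. v)) (at x)" by (auto intro!: derivative_eq_intros)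
      ultimately have "((\<lambda>x. f \<epsilon> (node \<epsilon> j x, polygon \<epsilon> j x) *v (x - \<xi> \<epsilon>)) has_derivative
          (\<lambda>v. f \<epsilon> (node \<epsilon> j x, polygon \<epsilon> j x) *v v + G j (t j *\<^sub>R v, ?Dz v) *v (x - \<xi> \<epsilon>))) (at x)"
        by (rule bounded_bilinear.FDERIV[OF bounded_bilinear_matrix_vector_mult])
      from has_derivative_add[OF z' bounded_linear.has_derivative[OF bounded_linear_scaleR_right this, of \<nu>]]
      have "(polygon \<epsilon> (Suc j) has_derivative (\<lambda>v. ?Dz v + \<nu> *\<^sub>R (Fj j *v v + G j (t j *\<^sub>R v, ?Dz v) *v d))) (at x)"
        by (simp add: \<nu>_def Fj_def p_def d_def)
      then show ?thesis unfolding w_def by (simp only: frechet_derivative_eq)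
    qed
    have "h (Suc j) = h j + \<nu> *\<^sub>R (G j (0, h j) *v d)
      + (\<nu> * t j) *\<^sub>R (G j (b, Fj j *v b) *v d - G j (d, Fj j *v d) *v b)
      - (\<nu> * \<nu>) *\<^sub>R (G j (d, Fj j *v d) *v b) - (t j + \<nu>) *\<^sub>R (T *v b)"
      unfolding h_def wS tS by (rule residual_step[OF lin]) (simp add: T_def)
    moreover have "norm (a + b + c - d - e) \<le> norm a + norm b + norm c + norm d + norm e"
      for a b c d e :: "real^'m"
      using norm_triangle_ineq[of a b] norm_triangle_ineq[of "a + b" c]
        norm_triangle_ineq4[of "a + b + c" d] norm_triangle_ineq4[of "a + b + c - d" e] by linarith
    ultimately have step: "norm (h (Suc j)) \<le> norm (h j) + norm (\<nu> *\<^sub>R (G j (0, h j) *v d))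
      + norm ((\<nu> * t j) *\<^sub>R (G j (b, Fj j *v b) *v d - G j (d, Fj j *v d) *v b))
      + norm ((\<nu> * \<nu>) *\<^sub>R (G j (d, Fj j *v d) *v b)) + norm ((t j + \<nu>) *\<^sub>R (T *v b))"
      by (simp only:)
    have 1: "norm (\<nu> *\<^sub>R (G j (0, h j) *v d)) \<le> \<nu> * (\<Lambda> \<epsilon> * norm (h j))"
    proof -
      have "norm (G j (0, h j) *v d) \<le> (C * \<bar>ln \<epsilon>\<bar> * norm (h j)) * (2 * r)"
      proof (rule order_trans[OF norm_matrix_vector_mult_le mult_mono[OF _ nd]])
        show "norm (G j (0, h j)) \<le> C * \<bar>ln \<epsilon>\<bar> * norm (h j)" unfolding G_def p_def by (rule lip'[OF n z(1)])
        show "0 \<le> C * \<bar>ln \<epsilon>\<bar> * norm (h j)" by (intro mult_nonneg_nonneg C) auto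
      qed simp
      also have "\<dots> = \<Lambda> \<epsilon> * norm (h j)" by simp
      finally have "norm (G j (0, h j) *v d) \<le> \<Lambda> \<epsilon> * norm (h j)" .
      then show ?thesis using \<nu> by (simp only: norm_scaleR) (simp add: mult_left_mono)
    qed
    have 2: "norm ((\<nu> * t j) *\<^sub>R (G j (b, Fj j *v b) *v d - G j (d, Fj j *v d) *v b)) \<le> \<nu> * q0"
    proof -
      have "(node \<epsilon> j x, polygon \<epsilon> j x, b, d) \<in> cball x0 r \<times> P \<times> cball 0 1 \<times> cball 0 (2 * r)"
        using pK nd b unfolding p_def by auto
      from defect[OF this]
      have "norm (G j (b, Fj j *v b) *v d - G j (d, Fj j *v d) *v b) \<le> q0"
        by (simp add: defect_def integrand_def swap_vectors_def G_def Fj_def p_def)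
      then have "(\<nu> * t j) * norm (G j (b, Fj j *v b) *v d - G j (d, Fj j *v d) *v b) \<le> (\<nu> * 1) * q0"
        using \<nu> tj q by (intro mult_mono) auto
      then show ?thesis using \<nu> tj by simp
    qed
    have 3: "norm ((\<nu> * \<nu>) *\<^sub>R (G j (d, Fj j *v d) *v b)) \<le> \<nu> * (q1 * c * \<nu>)"
    proof -
      have "norm (G j (d, Fj j *v d) *v b) \<le> norm (G j (d, Fj j *v d))"
        using norm_matrix_vector_mult_le[of "G j (d, Fj j *v d)" b] b by simp
      also have "\<dots> \<le> q1 * norm (d, Fj j *v d)" unfolding G_def by (rule deriv[OF pK])
      also have "\<dots> \<le> q1 * c" using nc q by (intro mult_left_mono)
      finally have "\<nu> * \<nu> * norm (G j (d, Fj j *v d) *v b) \<le> \<nu> * \<nu> * (q1 * c)" using \<nu> by (intro mult_left_mono) auto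
      then show ?thesis using \<nu> by (simp add: mult_ac)
    qed
    have 4: "norm ((t j + \<nu>) *\<^sub>R (T *v b)) \<le> \<nu> * (q2 * c\<^sup>2 * \<nu>)"
    proof -
      have "norm (T *v b) \<le> q2 * (\<nu> * c)\<^sup>2"
        using norm_matrix_vector_mult_le[of T b] b nT by simp
      then have "(t j + \<nu>) * norm (T *v b) \<le> 1 * (q2 * (\<nu> * c)\<^sup>2)"
        using tj(3) tS by (intro mult_mono) auto
      then show ?thesis using tj \<nu> by (simp add: power_mult_distrib power2_eq_square mult_ac)
    qed
    have "norm (h (Suc j)) \<le> norm (h j) + \<nu> * (\<Lambda> \<epsilon> * norm (h j)) + \<nu> * q0
        + \<nu> * (q1 * c * \<nu>) + \<nu> * (q2 * c\<^sup>2 * \<nu>)"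
      using step 1 2 3 4 by linarith
    also have "\<dots> = (1 + \<Lambda> \<epsilon> * \<nu>) * norm (h j) + q' * \<nu>" by (simp add: q'_def algebra_simps)
    finally show "norm (h (Suc j)) \<le> (1 + \<Lambda> \<epsilon> / real ?N) * norm (h j) + q' / real ?N"
      by (simp add: \<nu>_def)
  qed
  moreover have "h ?N = (jacobian (polygon \<epsilon> ?N) (at x) - f \<epsilon> (x, polygon \<epsilon> ?N x)) *v b"
  proof -
    have "polygon \<epsilon> ?N differentiable at x"
      by (rule smooth_on_differentiable[OF smooth_on_polygon[OF good order_refl] x])
    moreover have "node \<epsilon> ?N x = x" "t ?N = 1" using steps_pos[of \<epsilon>] by (simp_all add: node_def t_def)
    ultimately show ?thesis
      by (simp add: h_def w_def Fj_def p_def matrix_vector_mult_diff_rdistrib jacobian_mult)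
  qed
  ultimately show ?thesis by (simp add: q'_def \<nu>_def)
qed

text \<open>The defect is negligible by integrability and \<open>1/N\<close> by the choice of \<open>N\<close>, while all other
  factors in the previous bound are moderate.\<close>

lemma residual_negl:
  assumes integrable: "\<And>K. K \<subset>\<subset> U \<times> V \<times> UNIV \<times> UNIV \<Longrightarrow> negl K (defect f)"
  shows "negl B (\<lambda>\<epsilon> x. jacobian (solution \<epsilon>) (at x) - f \<epsilon> (x, solution \<epsilon> x))"
proof -
  let ?R = "\<lambda>\<epsilon> x. jacobian (solution \<epsilon>) (at x) - f \<epsilon> (x, solution \<epsilon> x)"
  let ?K = "cball x0 r \<times> P"
  have K: "compact ?K" "?K \<subseteq> U \<times> V" using BP by (simp_all only: compactly_contained_open[OF open_UV])
  obtain \<delta> where \<delta>: "\<delta> > 0" "(\<Union>p\<in>?K. cball p \<delta>) \<subseteq> U \<times> V"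
    using compact_neighbourhood[OF K(1) open_UV K(2)] .
  obtain M2 where M2: "\<forall>\<^sub>F \<epsilon> in at_right 0. \<forall>p\<in>?K. \<forall>q\<in>cball p \<delta>.
      norm (f \<epsilon> q - f \<epsilon> p - frechet_derivative (f \<epsilon>) (at p) (q - p)) \<le> inverse \<epsilon> ^ M2 * (norm (q - p))\<^sup>2"
    using moderate_taylor[OF open_UV K(1) \<delta>(2) f] .
  have "ep.mod_bdd ?K (\<lambda>\<epsilon> p. \<Sum>b\<in>Basis. norm (partials [b] (f \<epsilon>) p))"
  proof (rule ep.mod_bdd_sum)
    fix b :: "(real^'n) \<times> (real^'m)" assume "b \<in> Basis"
    then have "ep.mod_bdd ?K (\<lambda>\<epsilon>. partials [b] (f \<epsilon>))" by (intro moderate_partial_mod_bdd[OF f BP]) auto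
    then show "ep.mod_bdd ?K (\<lambda>\<epsilon> p. norm (partials [b] (f \<epsilon>) p))" by (rule ep.mod_bdd_mono) simp
  qed
  then obtain M1 where M1: "\<forall>\<^sub>F \<epsilon> in at_right 0. \<forall>p\<in>?K.
      norm (\<Sum>b\<in>Basis. norm (partials [b] (f \<epsilon>) p)) \<le> inverse \<epsilon> ^ M1" by (rule ep.mod_bddE)
  obtain n where n: "\<forall>\<^sub>F \<epsilon> in at_right 0. exp (0 + (2 * r * C) * \<bar>ln \<epsilon>\<bar>) \<le> inverse \<epsilon> ^ n"
    by (rule exp_log_moderate[where C="2 * r * C" and A=0]) (use r C in auto)
  define c where "c = 2 * r * (1 + A)"
  have c0: "0 \<le> c" using r A by (simp add: c_def)
  let ?K4 = "cball x0 r \<times> P \<times> cball (0 :: real^'n) 1 \<times> cball (0 :: real^'n) (2 * r)"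
  have K4: "?K4 \<subset>\<subset> U \<times> V \<times> UNIV \<times> UNIV"
    by (intro compactly_contained_Times open_Times open_U open_V open_UNIV)
       (use r L W compact_P open_U open_V in \<open>auto simp: compactly_contained_open\<close>)
  have "negl B (\<lambda>\<epsilon> x. ?R \<epsilon> x *v b)" if b: "b \<in> Basis" for b
  proof (rule neglI)
    fix m :: nat
    have def: "\<forall>\<^sub>F \<epsilon> in at_right 0. \<forall>z\<in>?K4. norm (defect f \<epsilon> z) \<le> \<epsilon> ^ (m + n)"
      using integrable[OF K4] unfolding negl_def by blast
    \<comment> \<open>\<open>n\<close> powers of \<open>\<epsilon>\<close> are lost to Gronwall's factor, \<open>M1\<close> and \<open>M2\<close> to the constants of \<open>f\<close>\<close>
    have st: "\<forall>\<^sub>F \<epsilon> in at_right 0. inverse (real (steps \<epsilon>)) \<le> \<epsilon> ^ (m + n + M1 + M2 + 1)"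
      using negl_inverse_steps[of "{()}"] unfolding negl_def by (auto dest: spec[of _ "m + n + M1 + M2 + 1"])
    have small: "\<forall>\<^sub>F \<epsilon> in at_right 0. 0 < \<epsilon> \<and> \<epsilon> \<le> \<delta> / (c + 1)"
      by (rule eventually_le_small) (use \<delta> c0 in simp)
    have "\<forall>\<^sub>F \<epsilon> in at_right 0. \<forall>x\<in>B. norm (?R \<epsilon> x *v b) \<le> (1 + c + c\<^sup>2) * \<epsilon> ^ m"
      using eventually_solution M1 M2 n lip def st small
    proof eventually_elim
      case (elim \<epsilon>)
      let ?N = "real (steps \<epsilon>)"
      have good: "good \<epsilon>" and e: "0 < \<epsilon>" "\<epsilon> \<le> 1" using elim(1) by (simp_all add: good_def)
      have "c / ?N \<le> \<delta>"
      proof -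
        have "\<epsilon> ^ (m + n + M1 + M2 + 1) \<le> \<epsilon> ^ 1" using e by (intro power_decreasing) auto
        then have "inverse ?N \<le> \<epsilon>" using elim(7) by simp
        then have "c * inverse ?N \<le> (c + 1) * (\<delta> / (c + 1))" using elim(8) c0 by (intro mult_mono) auto
        also have "(c + 1) * (\<delta> / (c + 1)) = \<delta>" using c0 by simp
        finally show ?thesis by (simp add: divide_inverse)
      qed
      have bound: "norm (?R \<epsilon> x *v b) \<le> (\<epsilon> ^ (m + n) + (inverse \<epsilon> ^ M1 * c + inverse \<epsilon> ^ M2 * c\<^sup>2) / ?N) * exp (\<Lambda> \<epsilon>)"
        if x: "x \<in> B" for x
        unfolding conjunct2[OF elim(1)]
      proof (rule residual_bound[OF good x])
        show "norm b = 1" using b by simp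
        show "c = 2 * r * (1 + A)" by (rule c_def)
        show "c / ?N \<le> \<delta>" by fact
        show "norm (frechet_derivative (f \<epsilon>) (at (x, y)) (0, k)) \<le> C * \<bar>ln \<epsilon>\<bar> * norm k"
          if "x \<in> B" "y \<in> W" for x y k using elim(5) that by blast
        show "norm (defect f \<epsilon> z) \<le> \<epsilon> ^ (m + n)" if "z \<in> ?K4" for z using elim(6) that by blast
        show "norm (f \<epsilon> q - f \<epsilon> p - frechet_derivative (f \<epsilon>) (at p) (q - p)) \<le> inverse \<epsilon> ^ M2 * (norm (q - p))\<^sup>2"
          if "p \<in> ?K" "q \<in> cball p \<delta>" for p q using elim(3) that by blast
        show "norm (frechet_derivative (f \<epsilon>) (at p) h) \<le> inverse \<epsilon> ^ M1 * norm h" if p: "p \<in> ?K" for p h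
        proof -
          have "f \<epsilon> differentiable at p" using K(2) p smooth_on_differentiable[OF f_smooth[OF good]] by blast
          from norm_frechet_derivative_le[OF this, of h]
          have "norm (frechet_derivative (f \<epsilon>) (at p) h) \<le> (\<Sum>b\<in>Basis. norm (partials [b] (f \<epsilon>) p)) * norm h" .
          also have "\<dots> \<le> inverse \<epsilon> ^ M1 * norm h"
          proof (rule mult_right_mono)
            have "norm (\<Sum>b\<in>Basis. norm (partials [b] (f \<epsilon>) p)) \<le> inverse \<epsilon> ^ M1" using elim(2) p by (rule bspec)
            then show "(\<Sum>b\<in>Basis. norm (partials [b] (f \<epsilon>) p)) \<le> inverse \<epsilon> ^ M1"
              unfolding real_norm_def by (rule abs_le_D1)
          qed simp
          finally show ?thesis .
        qed
      qed (use e in simp_all)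
      have Nb: "inverse \<epsilon> ^ k * inverse ?N \<le> \<epsilon> ^ (m + n)" if "k \<le> M1 + M2" for k
      proof -
        have "inverse \<epsilon> ^ k * inverse ?N \<le> inverse \<epsilon> ^ k * \<epsilon> ^ (m + n + k)"
        proof (rule mult_left_mono)
          have "\<epsilon> ^ (m + n + M1 + M2 + 1) \<le> \<epsilon> ^ (m + n + k)" using e that by (intro power_decreasing) auto
          then show "inverse ?N \<le> \<epsilon> ^ (m + n + k)" using elim(7) by linarith
        qed (use e in simp)
        also have "\<dots> = \<epsilon> ^ (m + n)" using e by (simp add: power_add power_inverse)
        finally show ?thesis .
      qed
      have "(inverse \<epsilon> ^ M1 * c + inverse \<epsilon> ^ M2 * c\<^sup>2) / ?N
          = (inverse \<epsilon> ^ M1 * inverse ?N) * c + (inverse \<epsilon> ^ M2 * inverse ?N) * c\<^sup>2"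
        by (simp add: divide_inverse algebra_simps)
      also have "\<dots> \<le> \<epsilon> ^ (m + n) * c + \<epsilon> ^ (m + n) * c\<^sup>2"
        using c0 by (intro add_mono mult_right_mono Nb) auto
      finally have "\<epsilon> ^ (m + n) + (inverse \<epsilon> ^ M1 * c + inverse \<epsilon> ^ M2 * c\<^sup>2) / ?N \<le> (1 + c + c\<^sup>2) * \<epsilon> ^ (m + n)"
        by (simp add: algebra_simps)
      then have "(\<epsilon> ^ (m + n) + (inverse \<epsilon> ^ M1 * c + inverse \<epsilon> ^ M2 * c\<^sup>2) / ?N) * exp (\<Lambda> \<epsilon>)
          \<le> ((1 + c + c\<^sup>2) * \<epsilon> ^ (m + n)) * inverse \<epsilon> ^ n"
        using elim(4) e c0 by (intro mult_mono) auto
      also have "\<dots> = (1 + c + c\<^sup>2) * \<epsilon> ^ m" using e by (simp add: power_add power_inverse)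
      finally show ?case by (intro ballI order_trans[OF bound])
    qed
    then show "\<exists>C. \<forall>\<^sub>F \<epsilon> in at_right 0. \<forall>x\<in>B. norm (?R \<epsilon> x *v b) \<le> C * \<epsilon> ^ m" by blast
  qed
  then have "negl B (\<lambda>\<epsilon> x. \<Sum>b\<in>Basis. dyad b (?R \<epsilon> x *v b))"
    by (intro negl_sum negl_linear[OF bounded_linear_dyad])
  then show ?thesis by (simp only: matrix_dyad_expand[symmetric])
qed

end

section \<open>The equivalence\<close>

lemma plus_cball: "S + cball 0 d = (\<Union>y\<in>S. cball y d)" for S :: "'a::real_normed_vector set"
proof (intro set_eqI iffI)
  fix z assume "z \<in> (\<Union>y\<in>S. cball y d)"
  then obtain y where "y \<in> S" "dist y z \<le> d" by auto
  then have "y \<in> S" "z - y \<in> cball 0 d" "z = y + (z - y)" by (simp_all add: dist_norm norm_minus_commute)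
  then show "z \<in> S + cball 0 d" by (metis set_plus_intro)
next
  fix z assume "z \<in> S + cball 0 d"
  then obtain y e where "y \<in> S" "e \<in> cball 0 d" "z = y + e" by (rule set_plus_elim)
  then show "z \<in> (\<Union>y\<in>S. cball y d)" by (intro UN_I[of y]) (simp_all add: dist_norm)
qed

lemma plus_ball: "S + ball 0 d = (\<Union>y\<in>S. ball y d)" for S :: "'a::real_normed_vector set"
proof (intro set_eqI iffI)
  fix z assume "z \<in> (\<Union>y\<in>S. ball y d)"
  then obtain y where "y \<in> S" "dist y z < d" by auto
  then have "y \<in> S" "z - y \<in> ball 0 d" "z = y + (z - y)" by (simp_all add: dist_norm norm_minus_commute)
  then show "z \<in> S + ball 0 d" by (metis set_plus_intro)
next
  fix z assume "z \<in> S + ball 0 d"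
  then obtain y e where "y \<in> S" "e \<in> ball 0 d" "z = y + e" by (rule set_plus_elim)
  then show "z \<in> (\<Union>y\<in>S. ball y d)" by (intro UN_I[of y]) (simp_all add: dist_norm)
qed

lemma open_plus_ball: "open (S + ball 0 d)" for S :: "'a::real_normed_vector set"
  unfolding plus_ball by (intro open_UN ballI open_ball)

lemma plus_ball_subset: "S + ball 0 d \<subseteq> S + cball 0 d" for S :: "'a::real_normed_vector set"
  unfolding plus_ball plus_cball by (rule UN_mono) (simp_all add: ball_subset_cball)

text \<open>The Euler polygon provides a solution on a small ball, and on a ball around \<open>x\<^sub>0\<close> all points are
  reached by segments from the initial point, so that solutions are unique there.\<close>

lemma uniquely_solvable_if_integrable:
  fixes U :: "(real^'n) set" and V L :: "(real^'m) set"
    and F :: "((real^'n) \<times> (real^'m), real^'n^'m) net set"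
  assumes U: "open U" and V: "open V" and F: "F \<in> colombeau (U \<times> V)"
    and integrable: "integrability_condition U V F"
    and X: "X \<in> gpoints_c U" and near: "near_standard X x0" and x0: "x0 \<in> U"
    and Y: "Y \<in> gpoints_c V" "\<eta> \<in> Y" and L: "compact L" and \<eta>: "\<And>\<epsilon>. \<epsilon> \<in> {0<..e} \<Longrightarrow> \<eta> \<epsilon> \<in> L"
    and e: "e \<in> {0<..1}" and \<alpha>: "\<alpha> > 0" "cball x0 \<alpha> \<subseteq> U" and \<beta>: "\<beta> > 0" "L + cball 0 \<beta> \<subseteq> V"
    and f: "f \<in> F" and a: "a > 0"
    and bound: "\<And>\<epsilon> z. \<epsilon> \<in> {0<..e} \<Longrightarrow> z \<in> cball x0 \<alpha> \<times> (L + cball 0 \<beta>) \<Longrightarrow> norm (f \<epsilon> z) \<le> a"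
    and log: "sup_bigo (cball x0 \<alpha> \<times> (L + cball 0 \<beta>))
      (\<lambda>\<epsilon> (x, y). onorm (frechet_derivative (\<lambda>y'. f \<epsilon> (x, y')) (at y))) (\<lambda>\<epsilon>. \<bar>ln \<epsilon>\<bar>)"
  shows "\<exists>U'. open U' \<and> x0 \<in> U' \<and> U' \<subseteq> U \<and> (\<exists>!u. is_solution U V F X Y U' (L + ball 0 \<beta>) u)"
proof -
  let ?W = "L + ball 0 \<beta>" and ?Q = "cball x0 \<alpha> \<times> (L + cball 0 \<beta>)"
  have UV: "open (U \<times> V)" using U V by (rule open_Times)
  have W: "open ?W" "?W \<subseteq> L + cball 0 \<beta>" "?W \<subseteq> V"
    by (rule open_plus_ball, rule plus_ball_subset, rule order_trans[OF plus_ball_subset \<beta>(2)])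
  have fm: "f \<in> moderate_nets (U \<times> V)" by (rule colombeau_class(1)[OF UV F f])
  obtain \<xi> where \<xi>: "\<xi> \<in> X" "(\<xi> \<longlongrightarrow> x0) (at_right 0)" using near by (auto simp: near_standard_def)
  have XY: "X \<in> gpoints U" "Y \<in> gpoints V" using X Y by (simp_all add: gpoints_c_def)
  \<comment> \<open>on a ball of this radius the solution moves by at most \<open>2ar < \<beta>\<close>\<close>
  define r where "r = min \<alpha> (\<beta> / (2 * a + 1))"
  have r: "r > 0" "r \<le> \<alpha>" "2 * a * r < \<beta>"
  proof -
    show "r > 0" "r \<le> \<alpha>" using \<alpha> \<beta> a by (simp_all add: r_def)
    have "2 * a * r \<le> 2 * a * (\<beta> / (2 * a + 1))" using a by (intro mult_left_mono) (simp_all add: r_def)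
    also have "\<dots> < \<beta>" using a \<beta> by (simp add: field_simps)
    finally show "2 * a * r < \<beta>" .
  qed
  have ballQ: "ball x0 r \<subseteq> cball x0 \<alpha>" "cball x0 r \<subseteq> U" "ball x0 r \<subseteq> U" using r(2) \<alpha>(2) by auto
  have tube: "(\<Union>y\<in>L. cball y (2 * a * r)) \<subseteq> ?W" unfolding plus_ball using r(3) by force
  obtain C' where C': "\<forall>\<^sub>F \<epsilon> in at_right 0. \<forall>z\<in>?Q.
      norm (case z of (x, y) \<Rightarrow> onorm (frechet_derivative (\<lambda>y'. f \<epsilon> (x, y')) (at y))) \<le> C' * \<bar>\<bar>ln \<epsilon>\<bar>\<bar>"
    using log unfolding sup_bigo_def by blast
  have small: "\<forall>\<^sub>F \<epsilon> in at_right 0. \<epsilon> \<in> {0<..e}"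
    using eventually_le_small[of e] e by simp
  have bound': "\<forall>\<^sub>F \<epsilon> in at_right 0. \<forall>x\<in>ball x0 r. \<forall>y\<in>?W. norm (f \<epsilon> (x, y)) \<le> a"
    using small by eventually_elim (use bound ballQ W(2) in blast)
  have lip: "\<forall>\<^sub>F \<epsilon> in at_right 0. \<forall>x\<in>ball x0 r. \<forall>y\<in>?W. \<forall>k.
      norm (frechet_derivative (f \<epsilon>) (at (x, y)) (0, k)) \<le> \<bar>C'\<bar> * \<bar>ln \<epsilon>\<bar> * norm k"
    using C' eventually_moderate_differentiable[OF fm]
  proof eventually_elim
    case (elim \<epsilon>)
    show ?case
    proof (intro ballI allI)
      fix x y k assume x: "x \<in> ball x0 r" and y: "y \<in> ?W"
      have xy: "(x, y) \<in> ?Q" using x y ballQ(1) W(2) by blast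
      have "(x, y) \<in> U \<times> V" using x y ballQ(3) W(3) by blast
      then have "(f \<epsilon> has_derivative frechet_derivative (f \<epsilon>) (at (x, y))) (at (x, y))"
        using elim(2) by (simp add: frechet_derivative_works[symmetric])
      moreover have "((\<lambda>y'. (x, y')) has_derivative (\<lambda>k. (0, k))) (at y)" by (auto intro!: derivative_eq_intros)
      ultimately have d: "((\<lambda>y'. f \<epsilon> (x, y')) has_derivative (\<lambda>k. frechet_derivative (f \<epsilon>) (at (x, y)) (0, k))) (at y)"
        using has_derivative_compose by blast
      have "norm (frechet_derivative (f \<epsilon>) (at (x, y)) (0, k))
          \<le> onorm (\<lambda>k. frechet_derivative (f \<epsilon>) (at (x, y)) (0, k)) * norm k"
        by (rule onorm[OF has_derivative_bounded_linear[OF d]])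
      also have "\<dots> \<le> (\<bar>C'\<bar> * \<bar>ln \<epsilon>\<bar>) * norm k"
      proof (rule mult_right_mono)
        have "onorm (\<lambda>k. frechet_derivative (f \<epsilon>) (at (x, y)) (0, k)) \<le> C' * \<bar>ln \<epsilon>\<bar>"
          using bspec[OF elim(1) xy] by (simp add: frechet_derivative_eq[OF d])
        also have "\<dots> \<le> \<bar>C'\<bar> * \<bar>ln \<epsilon>\<bar>" by (intro mult_right_mono) auto
        finally show "onorm (\<lambda>k. frechet_derivative (f \<epsilon>) (at (x, y)) (0, k)) \<le> \<bar>C'\<bar> * \<bar>ln \<epsilon>\<bar>" .
      qed simp
      finally show "norm (frechet_derivative (f \<epsilon>) (at (x, y)) (0, k)) \<le> \<bar>C'\<bar> * \<bar>ln \<epsilon>\<bar> * norm k" .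
    qed
  qed
  have \<eta>L: "\<forall>\<^sub>F \<epsilon> in at_right 0. \<eta> \<epsilon> \<in> L" using small by eventually_elim (rule \<eta>)
  interpret ivp: initial_value_problem U V ?W L f x0 r a "\<bar>C'\<bar>" \<xi> \<eta>
    by unfold_locales (use U V fm r(1) ballQ(2) a W L tube bound' lip \<xi>(2) \<eta>L in auto)
  let ?B = "ball x0 r"
  have init_iff: "point_value u (gpoint_in ?B X) = gpoint_in UNIV Y \<longleftrightarrow> pnet_equiv (\<lambda>\<epsilon>. b \<epsilon> (\<xi> \<epsilon>)) \<eta>"
    if "u \<in> colombeau ?B" "b \<in> u" for u b
    by (rule initial_condition_iff[OF open_ball ballQ(3) _ XY(1) \<xi> that XY(2) Y(2)]) (use r in simp)
  note ode_iff = ode_residual_iff[OF U V open_ball W(1) ballQ(3) W(3) F f]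
  let ?s = ivp.solution
  define u where "u = colombeau_rel ?B `` {?s}"
  have u: "u \<in> colombeau ?B" "?s \<in> u"
    unfolding u_def by (rule colombeau_classI[OF open_ball ivp.moderate_solution])+
  have "negl ?B (\<lambda>\<epsilon> x. jacobian (?s \<epsilon>) (at x) - f \<epsilon> (x, ?s \<epsilon> x))"
    by (rule ivp.residual_negl) (use integrability_condition_iff[OF U V F f] integrable in blast)
  then have res: "negl K (\<lambda>\<epsilon> x. jacobian (?s \<epsilon>) (at x) - f \<epsilon> (x, ?s \<epsilon> x))" if "K \<subset>\<subset> ?B" for K
    by (rule negl_subset) (use that in \<open>simp add: compactly_contained_open\<close>)
  have init: "pnet_equiv (\<lambda>\<epsilon>. ?s \<epsilon> (\<xi> \<epsilon>)) \<eta>"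
    by (rule pnet_equiv_eventually_eq[OF ivp.solution_initial])
  have sol: "is_solution U V F X Y ?B ?W u"
    unfolding is_solution_def colombeau_cb_def
    using u ivp.c_bounded_solution ode_iff[OF u ivp.c_bounded_solution] res init_iff[OF u] init by blast
  have "u' = u" if u': "is_solution U V F X Y ?B ?W u'" for u'
  proof -
    obtain b where b: "u' \<in> colombeau ?B" "b \<in> u'" and cb: "c_bounded ?B ?W b"
      using u' by (auto simp: is_solution_def colombeau_cb_def)
    have ode': "gderiv ?B u' = gcompose ?B (U \<times> V) F (gpair_id ?B u')"
      and init': "pnet_equiv (\<lambda>\<epsilon>. b \<epsilon> (\<xi> \<epsilon>)) \<eta>"
      using u' init_iff[OF b] by (simp_all add: is_solution_def)
    have res': "negl K (\<lambda>\<epsilon> x. jacobian (b \<epsilon>) (at x) - f \<epsilon> (x, b \<epsilon> x))" if "K \<subset>\<subset> ?B" for K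
      using ode_iff[OF b cb] ode' that by blast
    have agree: "pnet_equiv (\<lambda>\<epsilon>. b \<epsilon> (\<xi> \<epsilon>)) (\<lambda>\<epsilon>. ?s \<epsilon> (\<xi> \<epsilon>))"
      by (rule pnet_equiv_trans[OF init' pnet_equiv_sym[OF init]])
    have "negl K (\<lambda>\<epsilon> x. b \<epsilon> x - ?s \<epsilon> x)" if "K \<subset>\<subset> ?B" for K
      by (rule solutions_agree[OF U V W(1,3) r(1) ballQ(3) fm _ _ bound' lip cb ivp.c_bounded_solution
            res' res \<xi>(2) agree that]) (use a in auto)
    then have "(b, ?s) \<in> colombeau_rel ?B"
      using colombeau_class(1)[OF open_ball b] ivp.moderate_solution
      by (simp add: colombeau_rel_iff[OF open_ball])
    then show ?thesis
      using colombeau_class(2)[OF open_ball b] equiv_class_eq[OF equiv_colombeau_rel[OF open_ball]]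
      unfolding u_def by blast
  qed
  with sol have "\<exists>!u. is_solution U V F X Y ?B ?W u" by (rule ex1I)
  then show ?thesis
    by (intro exI[of _ ?B] conjI) (use ballQ(3) r(1) in simp_all)
qed

theorem theorem4p1:
  fixes U :: "(real^'n) set" and V :: "(real^'m) set"
    and F :: "((real^'n) \<times> (real^'m), real^'n^'m) net set"
    and \<alpha> \<beta> \<epsilon>0 :: "real^'n \<Rightarrow> (real^'m) pnet set \<Rightarrow> real"
    and y0 :: "real^'n \<Rightarrow> (real^'m) pnet set \<Rightarrow> (real^'m) pnet"
    and L :: "real^'n \<Rightarrow> (real^'m) pnet set \<Rightarrow> (real^'m) set"
  assumes "open U" and "open V" and "F \<in> colombeau (U \<times> V)"
    and "\<And>x0 Y. x0 \<in> U \<Longrightarrow> Y \<in> gpoints_c V \<Longrightarrow> \<alpha> x0 Y > 0 \<and> cball x0 (\<alpha> x0 Y) \<subset>\<subset> U"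
    and "\<And>x0 Y. x0 \<in> U \<Longrightarrow> Y \<in> gpoints_c V \<Longrightarrow>
           y0 x0 Y \<in> Y \<and> L x0 Y \<subset>\<subset> V \<and> \<epsilon>0 x0 Y \<in> {0<..1} \<and>
           (\<forall>\<epsilon>\<in>{0<..\<epsilon>0 x0 Y}. y0 x0 Y \<epsilon> \<in> L x0 Y)"
    and "\<And>x0 Y. x0 \<in> U \<Longrightarrow> Y \<in> gpoints_c V \<Longrightarrow>
           \<beta> x0 Y > 0 \<and> L x0 Y + cball 0 (\<beta> x0 Y) \<subset>\<subset> V"
    and "\<And>x0 Y. x0 \<in> U \<Longrightarrow> Y \<in> gpoints_c V \<Longrightarrow>
           \<exists>F'\<in>F. let Q = cball x0 (\<alpha> x0 Y) \<times> (L x0 Y + cball 0 (\<beta> x0 Y)) in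
             (\<exists>a>0. \<forall>\<epsilon>\<in>{0<..\<epsilon>0 x0 Y}. \<forall>z\<in>Q. norm (F' \<epsilon> z) \<le> a) \<and>
             sup_bigo Q (\<lambda>\<epsilon> (x, y). onorm (frechet_derivative (\<lambda>y'. F' \<epsilon> (x, y')) (at y)))
               (\<lambda>\<epsilon>. \<bar>ln \<epsilon>\<bar>)"
  shows "(\<forall>X\<in>gpoints_c U. \<forall>Y\<in>gpoints_c V. \<forall>x0\<in>U. near_standard X x0 \<longrightarrow>
            (\<exists>U'. open U' \<and> x0 \<in> U' \<and> U' \<subseteq> U \<and>
               (\<exists>!u. is_solution U V F X Y U' (L x0 Y + ball 0 (\<beta> x0 Y)) u)))
         \<longleftrightarrow> integrability_condition U V F"
    (is "?solvable \<longleftrightarrow> _")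
proof
  assume solvable: ?solvable
  show "integrability_condition U V F"
  proof (rule integrable_if_solvable[OF assms(1-3)])
    fix X Y x0 assume *: "X \<in> gpoints_c U" "Y \<in> gpoints_c V" "x0 \<in> U" "near_standard X x0"
    let ?W = "L x0 Y + ball 0 (\<beta> x0 Y)"
    have "L x0 Y + cball 0 (\<beta> x0 Y) \<subseteq> V"
      using assms(6)[OF *(3,2)] by (simp add: compactly_contained_open[OF assms(2)])
    then have "open ?W" "?W \<subseteq> V"
      by (simp_all add: open_plus_ball order_trans[OF plus_ball_subset])
    moreover have "\<exists>U'. open U' \<and> x0 \<in> U' \<and> U' \<subseteq> U \<and> (\<exists>!u. is_solution U V F X Y U' ?W u)"
      by (rule solvable[rule_format, OF *])
    ultimately show "\<exists>U' W u. open U' \<and> x0 \<in> U' \<and> U' \<subseteq> U \<and> open W \<and> W \<subseteq> V \<and> is_solution U V F X Y U' W u"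
      using ex1_implies_ex by metis
  qed
next
  assume integrable: "integrability_condition U V F"
  show ?solvable
  proof (intro ballI impI)
    fix X Y x0 assume *: "X \<in> gpoints_c U" "Y \<in> gpoints_c V" "x0 \<in> U" "near_standard X x0"
    note d = assms(4)[OF *(3,2)] assms(5)[OF *(3,2)] assms(6)[OF *(3,2)]
    obtain f a where f: "f \<in> F" "a > 0"
      "\<forall>\<epsilon>\<in>{0<..\<epsilon>0 x0 Y}. \<forall>z\<in>cball x0 (\<alpha> x0 Y) \<times> (L x0 Y + cball 0 (\<beta> x0 Y)). norm (f \<epsilon> z) \<le> a"
      "sup_bigo (cball x0 (\<alpha> x0 Y) \<times> (L x0 Y + cball 0 (\<beta> x0 Y)))
        (\<lambda>\<epsilon> (x, y). onorm (frechet_derivative (\<lambda>y'. f \<epsilon> (x, y')) (at y))) (\<lambda>\<epsilon>. \<bar>ln \<epsilon>\<bar>)"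
      using assms(7)[OF *(3,2)] unfolding Let_def by blast
    show "\<exists>U'. open U' \<and> x0 \<in> U' \<and> U' \<subseteq> U \<and>
        (\<exists>!u. is_solution U V F X Y U' (L x0 Y + ball 0 (\<beta> x0 Y)) u)"
      by (rule uniquely_solvable_if_integrable[OF assms(1-3) integrable *(1,4,3,2), where f=f and a=a
            and \<alpha>="\<alpha> x0 Y" and \<eta>="y0 x0 Y" and e="\<epsilon>0 x0 Y"])
         (use d f in \<open>auto simp: compactly_contained_open[OF assms(1)] compactly_contained_open[OF assms(2)]\<close>)
  qed
qed

end
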